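(* For every $\varepsilon>0$, $N\ge 0$ and $\beta>1$ there are constants $B,B'$, depending only on $\varepsilon$, $N$ and $\beta$, with the following property. Let $\mu$ be a positive Borel measure on $\mathbb{C}$ with $\mu(B(x,r))\le r$ for all $x\in\mathbb{C}$, $r>0$, let $K$ be a Calderón–Zygmund kernel with exponent $\varepsilon$, and assume that the operator $T\varphi(x)=\int_{\mathbb{C}}K(x,y)\varphi(y)\,d\mu(y)$ is bounded on $L^2(\mu)$ with $\|T\|_{L^2(\mu)\to L^2(\mu)}\le N$. Then for every $\varphi\in L^p(\mu)$, $1<p<\infty$, and every $x\in\mathbb{C}$, $$T^\sharp\varphi(x)\le \widetilde M T\varphi(x)+B\,\widetilde M_\beta\varphi(x)+B'\,M'_\beta\varphi(x).$$
   Context: $B(x,r)=\{y\in\mathbb{C}:|x-y|<r\}$. A Calderón–Zygmund kernel with exponent $\varepsilon>0$ is a function $K:\{(x,y)\in\mathbb{C}^2:x\ne y\}\to\mathbb{C}$ such that $|K(x,y)|\le \frac{1}{|x-y|}$ for $x\neq y$, and $$|K(x,y)-K(x',y)|\le\frac{|x-x'|^{\varepsilon}}{|x-y|^{1+\varepsilon}},\qquad |K(y,x)-K(y,x')|\le\frac{|x-x'|^{\varepsilon}}{|x-y|^{1+\varepsilon}}\qquad\text{whenever } |x-x'|\le\tfrac12|x-y|,\ x\ne y.$$ That $T\varphi(x)=\int K(x,y)\varphi(y)\,d\mu(y)$ is a bounded operator on $L^2(\mu)$ means: $T$ is a bounded linear operator on $L^2(\mu)$ such that for every $\varphi\in L^2(\mu)$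 this formula holds for $\mu$-a.e. $x$ outside the closed support of $\varphi$ (where the integral converges absolutely). Under these hypotheses $T$ extends from $L^2(\mu)\cap L^p(\mu)$ to a bounded operator on $L^p(\mu)$ for every $1<p<\infty$, still denoted $T$. Truncations and maximal singular operator: $T_r\varphi(x)=\int_{\mathbb{C}\setminus B(x,r)}K(x,y)\varphi(y)\,d\mu(y)$ and $T^\sharp\varphi(x)=\sup_{r>0}|T_r\varphi(x)|$. Maximal functions (with values in $[0,\infty]$): $$\widetilde M\varphi(x)=\sup\Bigl\{\frac{1}{\mu(B(x,r))}\int_{B(x,r)}|\varphi|\,d\mu:\ r>0,\ \mu(B(x,r))>0,\ \mu(B(x,3r))\le 81\,\mu(B(x,r))\Bigr\},$$ $$M'\varphi(x)=\sup_{r>0}\frac1r\int_{B(x,r)}|\varphi|\,d\mu,$$ with the supremum over the empty set equal to $0$, and for $\beta>0$, $\widetilde M_\beta\varphi=\{\widetilde M[|\varphi|^\beta]\}^{1/\beta}$, $M'_\beta\varphi=\{M'[|\varphi|^\beta]\}^{1/\beta}$. *)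

theory Defs
  imports "HOL-Analysis.Analysis"
begin

text \<open>Elements of \<open>L\<^sup>p(\<mu>)\<close> are represented by measurable functions; identities between
  them are asserted \<open>\<mu>\<close>-almost everywhere.\<close>

definition Lp_space :: "real \<Rightarrow> complex measure \<Rightarrow> (complex \<Rightarrow> complex) set" where
  "Lp_space p \<mu> = {f \<in> borel_measurable \<mu>. integrable \<mu> (\<lambda>x. norm (f x) powr p)}"

definition Lp_norm :: "real \<Rightarrow> complex measure \<Rightarrow> (complex \<Rightarrow> complex) \<Rightarrow> real" where
  "Lp_norm p \<mu> f = (\<integral>x. norm (f x) powr p \<partial>\<mu>) powr (1 / p)"

text \<open>A linear operator on \<open>L\<^sup>p(\<mu>)\<close> of norm at most \<open>C\<close>. Compatibility with
  \<open>\<mu>\<close>-almost everywhere equality need not be required: it follows from linearity and the bound.\<close>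

definition Lp_operator_bound ::
  "real \<Rightarrow> complex measure \<Rightarrow> ((complex \<Rightarrow> complex) \<Rightarrow> complex \<Rightarrow> complex) \<Rightarrow> real \<Rightarrow> bool" where
  "Lp_operator_bound p \<mu> T C \<longleftrightarrow>
     (\<forall>f \<in> Lp_space p \<mu>. T f \<in> Lp_space p \<mu>) \<and>
     (\<forall>f \<in> Lp_space p \<mu>. \<forall>g \<in> Lp_space p \<mu>.
        AE x in \<mu>. T (\<lambda>y. f y + g y) x = T f x + T g x) \<and>
     (\<forall>f \<in> Lp_space p \<mu>. \<forall>c. AE x in \<mu>. T (\<lambda>y. c * f y) x = c * T f x) \<and>
     (\<forall>f \<in> Lp_space p \<mu>. Lp_norm p \<mu> (T f) \<le> C * Lp_norm p \<mu> f)"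

text \<open>The closed support of the class of \<open>f\<close>: the complement of the largest open set
  on which \<open>f\<close> vanishes \<open>\<mu>\<close>-almost everywhere.\<close>

definition closed_support :: "complex measure \<Rightarrow> (complex \<Rightarrow> complex) \<Rightarrow> complex set" where
  "closed_support \<mu> f = - \<Union>{U. open U \<and> (AE y in \<mu>. y \<in> U \<longrightarrow> f y = 0)}"

text \<open>Kernels are total functions; their values on the diagonal are unconstrained.\<close>

definition CZ_kernel :: "real \<Rightarrow> (complex \<Rightarrow> complex \<Rightarrow> complex) \<Rightarrow> bool" where
  "CZ_kernel \<epsilon> K \<longleftrightarrow>
     (\<forall>x y. x \<noteq> y \<longrightarrow> norm (K x y) \<le> 1 / dist x y) \<and>
     (\<forall>x x' y. x \<noteq> y \<longrightarrow> dist x x' \<le> dist x y / 2 \<longrightarrow>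
        norm (K x y - K x' y) \<le> dist x x' powr \<epsilon> / dist x y powr (1 + \<epsilon>) \<and>
        norm (K y x - K y x') \<le> dist x x' powr \<epsilon> / dist x y powr (1 + \<epsilon>))"

text \<open>\<open>T\<close> is a bounded operator on \<open>L\<^sup>2(\<mu>)\<close> with kernel \<open>K\<close> and norm at most \<open>N\<close>.
  The diagonal value \<open>K x x\<close> does not matter here, as \<open>\<phi>\<close> vanishes almost everywhere near
  any \<open>x\<close> outside its closed support.\<close>

definition CZ_operator ::
  "complex measure \<Rightarrow> (complex \<Rightarrow> complex \<Rightarrow> complex) \<Rightarrow>
    ((complex \<Rightarrow> complex) \<Rightarrow> complex \<Rightarrow> complex) \<Rightarrow> real \<Rightarrow> bool" where
  "CZ_operator \<mu> K T N \<longleftrightarrow>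
     Lp_operator_bound 2 \<mu> T N \<and>
     (\<forall>\<phi> \<in> Lp_space 2 \<mu>. AE x in \<mu>. x \<notin> closed_support \<mu> \<phi> \<longrightarrow>
        integrable \<mu> (\<lambda>y. K x y * \<phi> y) \<and> T \<phi> x = (\<integral>y. K x y * \<phi> y \<partial>\<mu>))"

text \<open>\<open>S\<close> is the bounded extension to \<open>L\<^sup>p(\<mu>)\<close> of the operator \<open>T\<close> on \<open>L\<^sup>2(\<mu>)\<close>
  (unique up to \<open>\<mu>\<close>-null sets, because \<open>L\<^sup>2(\<mu>) \<inter> L\<^sup>p(\<mu>)\<close> is dense in \<open>L\<^sup>p(\<mu>)\<close>).\<close>

definition Lp_extension ::
  "real \<Rightarrow> complex measure \<Rightarrow> ((complex \<Rightarrow> complex) \<Rightarrow> complex \<Rightarrow> complex) \<Rightarrow>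
    ((complex \<Rightarrow> complex) \<Rightarrow> complex \<Rightarrow> complex) \<Rightarrow> bool" where
  "Lp_extension p \<mu> T S \<longleftrightarrow>
     (\<exists>C. Lp_operator_bound p \<mu> S C) \<and>
     (\<forall>f \<in> Lp_space 2 \<mu> \<inter> Lp_space p \<mu>. AE x in \<mu>. S f x = T f x)"

definition truncated_op ::
  "complex measure \<Rightarrow> (complex \<Rightarrow> complex \<Rightarrow> complex) \<Rightarrow> real \<Rightarrow>
    (complex \<Rightarrow> complex) \<Rightarrow> complex \<Rightarrow> complex" where
  "truncated_op \<mu> K r \<phi> x = (LINT y:(- ball x r)|\<mu>. K x y * \<phi> y)"

definition maximal_op ::
  "complex measure \<Rightarrow> (complex \<Rightarrow> complex \<Rightarrow> complex) \<Rightarrow>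
    (complex \<Rightarrow> complex) \<Rightarrow> complex \<Rightarrow> ennreal" where
  "maximal_op \<mu> K \<phi> x = (SUP r\<in>{0<..}. ennreal (norm (truncated_op \<mu> K r \<phi> x)))"

text \<open>The maximal functions are defined for functions with values in any normed space, since they
  are applied both to complex functions and to the real functions \<open>|\<phi>|\<^sup>\<beta>\<close>.
  The supremum of the empty set in \<^typ>\<open>ennreal\<close> is \<open>0\<close>.\<close>

definition M_tilde :: "complex measure \<Rightarrow> (complex \<Rightarrow> 'a::real_normed_vector) \<Rightarrow> complex \<Rightarrow> ennreal" where
  "M_tilde \<mu> \<phi> x =
     (SUP r\<in>{r. r > 0 \<and> emeasure \<mu> (ball x r) > 0 \<and>
                emeasure \<mu> (ball x (3 * r)) \<le> 81 * emeasure \<mu> (ball x r)}.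
        (\<integral>\<^sup>+y\<in>ball x r. ennreal (norm (\<phi> y)) \<partial>\<mu>) / emeasure \<mu> (ball x r))"

definition M_prime :: "complex measure \<Rightarrow> (complex \<Rightarrow> 'a::real_normed_vector) \<Rightarrow> complex \<Rightarrow> ennreal" where
  "M_prime \<mu> \<phi> x =
     (SUP r\<in>{0<..}. (\<integral>\<^sup>+y\<in>ball x r. ennreal (norm (\<phi> y)) \<partial>\<mu>) / ennreal r)"

text \<open>Positive real powers of extended nonnegative reals, with \<open>\<infinity>\<^sup>a = \<infinity>\<close>.\<close>

definition ennpowr :: "ennreal \<Rightarrow> real \<Rightarrow> ennreal" where
  "ennpowr u a = (if u = \<infinity> then \<infinity> else ennreal (enn2real u powr a))"

definition M_tilde_pow :: "real \<Rightarrow> complex measure \<Rightarrow> (complex \<Rightarrow> complex) \<Rightarrow> complex \<Rightarrow> ennreal" where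
  "M_tilde_pow \<beta> \<mu> \<phi> x = ennpowr (M_tilde \<mu> (\<lambda>y. norm (\<phi> y) powr \<beta>) x) (1 / \<beta>)"

definition M_prime_pow :: "real \<Rightarrow> complex measure \<Rightarrow> (complex \<Rightarrow> complex) \<Rightarrow> complex \<Rightarrow> ennreal" where
  "M_prime_pow \<beta> \<mu> \<phi> x = ennpowr (M_prime \<mu> (\<lambda>y. norm (\<phi> y) powr \<beta>) x) (1 / \<beta>)"

end

theory Submission
  imports Defs
begin

text \<open>For \<open>r > 0\<close> let \<open>R = 3^k r\<close> be the first radius with \<open>\<mu>(B(x,9R)) \<le> 81 \<mu>(B(x,R))\<close> and
  \<open>\<mu>(B(x,R)) > 0\<close>. Before \<open>R\<close> the quotients \<open>\<mu>(B(x,t))/t\<close> decay geometrically towards small \<open>t\<close>, so the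
  annuli between \<open>r\<close> and \<open>3R\<close> cost only \<open>M'\<^sub>\<beta>\<close>; and the truncation at \<open>3R\<close> is compared with the average over
  \<open>B(x,R)\<close> of \<open>T\<phi>\<close> minus \<open>T(\<phi> 1\<^bsub>B(x,3R)\<^esub>)\<close>. What is left is the local estimate
  \<open>|\<langle>T\<psi>, g\<rangle>| \<le> C \<mu>(3B)\<^bsup>1-1/\<beta>\<^esup> \<parallel>\<psi>\<parallel>\<^sub>\<beta>\<close> for \<open>\<psi>\<close> supported in \<open>3B\<close>, \<open>|g| \<le> 1\<^sub>B\<close>, also for \<open>\<beta> < 2\<close>.

  It is obtained without weak type bounds or interpolation, from the transposed truncations of the
  bounded function \<open>g\<close>: by a good-\<open>\<lambda>\<close> argument on Whitney pieces of an open set \<open>U\<close>, whose enlargements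
  overlap boundedly inside \<open>U\<close>, there are open sets \<open>U\<^sub>0 \<supseteq> U\<^sub>1 \<supseteq> \<dots>\<close> with \<open>\<mu>(U\<^sub>n) \<le> 2\<^bsup>-n\<^esup> \<mu>(U\<^sub>0)\<close> off which
  the maximal transposed truncation of \<open>g\<close> is at most linear in \<open>n\<close>. There \<open>f \<mapsto> \<langle>Tf, g\<rangle>\<close> is bounded on
  \<open>L\<^sup>1\<close>, and summing over \<open>U\<^sub>n - U\<^bsub>n+1\<^esub>\<close> with Hoelder's inequality gives the claim.\<close>

section \<open>Covering, Hoelder and kernel preliminaries\<close>

text \<open>The measure need not be doubling, so only averages over selected balls carry
  information. A tripling raises a linear bound by 3 and two of them by 9; asking for 9R rather than
  3R makes both B(x,R) and B(x,3R) admissible in \<open>M_tilde\<close>. The first ball carries the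
  average of T\<phi>, with coefficient 1; the second carries the \<open>L^\<beta>\<close> average of
  the local part of \<phi>, and \<mu>(B(x,3R)) \<le> 81 \<mu>(B(x,R)) is where the factor 81 of B
  comes from. Only B involves N; B' is made of kernel bounds alone.

  For \<beta> \<ge> 2 the L2 norm of T would settle the local estimate. For smaller \<beta> it does
  not, and the function g on the other side of the pairing is exploited: it is bounded, so its local
  parts are controlled by L2 bounds alone, and the comparison of truncations with averages can be
  run for the transposed kernel.

  All estimates are made for bounded functions with bounded support. The given \<phi> and the
  extension S enter only through a final limit, which is why p and \<beta> are unrelated.\<close>

lemma Vitali_covering_finite:
  fixes c :: "'i \<Rightarrow> 'a::metric_space" and r :: "'i \<Rightarrow> real"
  assumes "finite I" and "\<And>i. i \<in> I \<Longrightarrow> r i > 0"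
  shows "\<exists>J\<subseteq>I. disjoint_family_on (\<lambda>i. ball (c i) (r i)) J \<and>
           (\<Union>i\<in>I. ball (c i) (r i)) \<subseteq> (\<Union>i\<in>J. ball (c i) (3 * r i))"
  using assms
proof (induction I rule: finite_psubset_induct)
  case (psubset I)
  show ?case
  proof (cases "I = {}")
    case True
    then show ?thesis by (auto simp: disjoint_family_on_def)
  next
    case False
    \<comment> \<open>Greedy choice: a ball of largest radius covers, once tripled, every ball that
      meets it. The recursion runs on the balls that miss it.\<close>
    have "Max (r ` I) \<in> r ` I" using psubset.hyps False by (intro Max_in) auto
    then obtain m where "m \<in> I" "r m = Max (r ` I)" by auto
    then have m: "m \<in> I" "\<And>i. i \<in> I \<Longrightarrow> r i \<le> r m"
      using psubset.hyps by auto
    define I' where "I' = {i \<in> I. ball (c i) (r i) \<inter> ball (c m) (r m) = {}}"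
    have "m \<notin> I'"
      using psubset.prems[OF m(1)] unfolding I'_def by auto
    then have "I' \<subset> I" using m(1) unfolding I'_def by blast
    with psubset.IH[OF this] psubset.prems obtain J where J: "J \<subseteq> I'"
      "disjoint_family_on (\<lambda>i. ball (c i) (r i)) J"
      "(\<Union>i\<in>I'. ball (c i) (r i)) \<subseteq> (\<Union>i\<in>J. ball (c i) (3 * r i))"
      by blast
    have "disjoint_family_on (\<lambda>i. ball (c i) (r i)) (insert m J)"
      using J(1,2) unfolding disjoint_family_on_def I'_def by blast
    moreover have "insert m J \<subseteq> I"
      using J(1) m(1) \<open>I' \<subset> I\<close> by auto
    moreover have "x \<in> (\<Union>i\<in>insert m J. ball (c i) (3 * r i))" if i: "i \<in> I" "x \<in> ball (c i) (r i)" for i x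
    proof (cases "i \<in> I'")
      case True
      then have "x \<in> (\<Union>i\<in>J. ball (c i) (3 * r i))" using J(3) i(2) by blast
      then show ?thesis by blast
    next
      case False
      then obtain y where y: "y \<in> ball (c i) (r i)" "y \<in> ball (c m) (r m)"
        using i unfolding I'_def by auto
      have "dist (c m) x \<le> dist (c m) y + dist y (c i) + dist (c i) x"
        by (meson dist_triangle dist_triangle_le order_trans add_mono order_refl)
      then have "dist (c m) x < 3 * r m"
        using y i m(2)[OF i(1)] by (simp add: dist_commute)
      then show ?thesis by simp
    qed
    ultimately show ?thesis by (intro exI[of _ "insert m J"]) blast
  qed
qed

lemma Hoelder_integral:
  fixes f g :: "'a \<Rightarrow> real"
  assumes [measurable]: "f \<in> borel_measurable M" "g \<in> borel_measurable M"
    and pq: "p > 1" "q > 1" "1 / p + 1 / q = 1"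
    and nonneg: "\<And>x. f x \<ge> 0" "\<And>x. g x \<ge> 0"
    and int: "integrable M (\<lambda>x. f x powr p)" "integrable M (\<lambda>x. g x powr q)"
  shows "integrable M (\<lambda>x. f x * g x)"
    and "(\<integral>x. f x * g x \<partial>M) \<le> (\<integral>x. f x powr p \<partial>M) powr (1 / p) * (\<integral>x. g x powr q \<partial>M) powr (1 / q)"
proof -
  have Y: "f x * g x \<le> f x powr p / p + g x powr q / q" for x
    using pq nonneg by (intro Youngs_inequality) auto
  show fg: "integrable M (\<lambda>x. f x * g x)"
    by (rule Bochner_Integration.integrable_bound[where f = "\<lambda>x. f x powr p / p + g x powr q / q"])
      (use Y int nonneg pq in \<open>auto intro!: AE_I2 order_trans[OF _ abs_ge_self]\<close>)
  define A where "A = (\<integral>x. f x powr p \<partial>M)"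
  define B where "B = (\<integral>x. g x powr q \<partial>M)"
  have AB: "A \<ge> 0" "B \<ge> 0" unfolding A_def B_def by auto
  \<comment> \<open>Young's inequality is applied below to the normalised functions, which requires
    both norms to be nonzero. If one is zero, the product vanishes almost everywhere.\<close>
  have zero: "(\<integral>x. f x * g x \<partial>M) \<le> A powr (1 / p) * B powr (1 / q)" if "A = 0 \<or> B = 0"
  proof -
    from that have "AE x in M. f x powr p = 0 \<or> g x powr q = 0"
    proof
      assume "A = 0"
      then have "AE x in M. f x powr p = 0"
        unfolding A_def using int by (subst (asm) integral_nonneg_eq_0_iff_AE) auto
      then show ?thesis by auto
    next
      assume "B = 0"
      then have "AE x in M. g x powr q = 0"
        unfolding B_def using int by (subst (asm) integral_nonneg_eq_0_iff_AE) auto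
      then show ?thesis by auto
    qed
    then have "AE x in M. f x * g x = 0" by auto
    then have "(\<integral>x. f x * g x \<partial>M) = 0" by (rule integral_eq_zero_AE)
    then show ?thesis by simp
  qed
  have "(\<integral>x. f x * g x \<partial>M) \<le> A powr (1 / p) * B powr (1 / q)" if "A > 0" "B > 0"
  proof -
    define a where "a = A powr (1 / p)"
    define b where "b = B powr (1 / q)"
    have ab: "a > 0" "b > 0" using that unfolding a_def b_def by auto
    have ap: "a powr p = A" "b powr q = B"
      using that pq unfolding a_def b_def by (auto simp: powr_powr)
    have "(f x / a) * (g x / b) \<le> f x powr p / A / p + g x powr q / B / q" for x
    proof -
      have "(f x / a) * (g x / b) \<le> (f x / a) powr p / p + (g x / b) powr q / q"
        using pq nonneg ab by (intro Youngs_inequality) auto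
      also have "\<dots> = f x powr p / A / p + g x powr q / B / q"
        using nonneg ab by (simp add: powr_divide ap)
      finally show ?thesis .
    qed
    then have "(\<integral>x. (f x / a) * (g x / b) \<partial>M) \<le> (\<integral>x. f x powr p / A / p + g x powr q / B / q \<partial>M)"
      using fg int by (intro integral_mono) auto
    also have "\<dots> = A / A / p + B / B / q"
      unfolding A_def B_def using int by (subst Bochner_Integration.integral_add) auto
    also have "\<dots> = 1" using that pq by simp
    finally have "(\<integral>x. f x * g x \<partial>M) / (a * b) \<le> 1" by (simp add: mult.assoc)
    then show ?thesis using ab unfolding a_def b_def by (simp add: divide_le_eq)
  qed
  with zero AB show "(\<integral>x. f x * g x \<partial>M) \<le> (\<integral>x. f x powr p \<partial>M) powr (1 / p) * (\<integral>x. g x powr q \<partial>M) powr (1 / q)"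
    unfolding A_def[symmetric] B_def[symmetric] by linarith
qed

text \<open>Integrability need not be checked by the user: the Bochner integral of a non-integrable
  function is 0 by convention.\<close>

lemma norm_integral_le_of_nn_integral:
  fixes f :: "'a \<Rightarrow> 'b::{banach, second_countable_topology}"
  assumes "(\<integral>\<^sup>+x. ennreal (norm (f x)) \<partial>M) \<le> ennreal c" "c \<ge> 0"
  shows "norm (\<integral>x. f x \<partial>M) \<le> c"
proof (cases "integrable M f")
  case True
  then have "ennreal (norm (\<integral>x. f x \<partial>M)) \<le> ennreal c"
    using integral_norm_bound_ennreal[OF True] assms by (meson order_trans)
  then show ?thesis using assms(2) by simp
next
  case False
  then show ?thesis using assms(2) by (simp add: not_integrable_integral_eq)
qed

lemma dist_powr_tendsto_0:
  fixes e :: real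
  assumes "e > 0" "(f \<longlongrightarrow> a) F"
  shows "((\<lambda>x. dist a (f x) powr e) \<longlongrightarrow> 0) F"
proof -
  have "((\<lambda>x. dist a (f x)) \<longlongrightarrow> 0) F"
    using tendsto_dist[OF tendsto_const assms(2), of a] by simp
  then show ?thesis
    by (rule tendsto_zero_powrI) (use assms(1) in \<open>auto intro: tendsto_const\<close>)
qed

lemma CZ_kernelD1: "CZ_kernel \<epsilon> K \<Longrightarrow> x \<noteq> y \<Longrightarrow> norm (K x y) \<le> 1 / dist x y"
  unfolding CZ_kernel_def by blast

lemma CZ_kernelD2: "CZ_kernel \<epsilon> K \<Longrightarrow> x \<noteq> y \<Longrightarrow> dist x x' \<le> dist x y / 2 \<Longrightarrow>
   norm (K x y - K x' y) \<le> dist x x' powr \<epsilon> / dist x y powr (1 + \<epsilon>)"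
  unfolding CZ_kernel_def by blast

lemma CZ_kernelD3: "CZ_kernel \<epsilon> K \<Longrightarrow> x \<noteq> y \<Longrightarrow> dist x x' \<le> dist x y / 2 \<Longrightarrow>
   norm (K y x - K y x') \<le> dist x x' powr \<epsilon> / dist x y powr (1 + \<epsilon>)"
  unfolding CZ_kernel_def by blast

lemma CZ_kernel_transpose: "CZ_kernel \<epsilon> K \<Longrightarrow> CZ_kernel \<epsilon> (\<lambda>x y. K y x)"
  unfolding CZ_kernel_def by (metis dist_commute)

text \<open>The two smoothness conditions are used one after the other along (a, b), (a,
  \<open>snd q\<close>), (\<open>fst q\<close>, \<open>snd q\<close>). Continuity off the diagonal
  is the source of the joint measurability on which Fubini's theorem rests.\<close>

lemma CZ_kernel_continuous_on:
  assumes K: "CZ_kernel \<epsilon> K" and "\<epsilon> > 0"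
  shows "continuous_on {p. fst p \<noteq> snd p} (\<lambda>p. K (fst p) (snd p))"
proof (rule continuous_at_imp_continuous_on, rule ballI)
  fix p :: "complex \<times> complex"
  assume p: "p \<in> {p. fst p \<noteq> snd p}"
  define a where "a = fst p" define b where "b = snd p"
  have d: "dist a b > 0" using p unfolding a_def b_def by simp
  let ?N = "nhds p"
  have lim: "(fst \<longlongrightarrow> a) ?N" "(snd \<longlongrightarrow> b) ?N"
    unfolding a_def b_def by (auto intro!: tendsto_fst tendsto_snd filterlim_ident)
  have c0: "((\<lambda>q. dist a (fst q)) \<longlongrightarrow> 0) ?N" "((\<lambda>q. dist b (snd q)) \<longlongrightarrow> 0) ?N"
    using tendsto_dist[OF tendsto_const lim(1), of a] tendsto_dist[OF tendsto_const lim(2), of b] by auto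
  have ev: "\<forall>\<^sub>F q in ?N. dist a (fst q) < dist a b / 4 \<and> dist b (snd q) < dist a b / 4"
    using d by (intro eventually_conj order_tendstoD(2)[OF c0(1)] order_tendstoD(2)[OF c0(2)]) auto
  let ?g = "\<lambda>q. dist a (fst q) powr \<epsilon> / dist a (snd q) powr (1 + \<epsilon>) + dist b (snd q) powr \<epsilon> / dist b a powr (1 + \<epsilon>)"
  have bound: "\<forall>\<^sub>F q in ?N. norm (K (fst q) (snd q) - K a b) \<le> ?g q"
    using ev
  proof eventually_elim
    case (elim q)
    have tri: "dist a b \<le> dist a (snd q) + dist b (snd q)"
      by (metis dist_triangle2)
    have "dist a (snd q) > 0" using elim tri d by linarith
    then have ne: "a \<noteq> snd q" by auto
    have "norm (K a (snd q) - K (fst q) (snd q)) \<le> dist a (fst q) powr \<epsilon> / dist a (snd q) powr (1 + \<epsilon>)"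
      using elim tri d by (intro CZ_kernelD2[OF K ne]) linarith
    moreover have "norm (K a b - K a (snd q)) \<le> dist b (snd q) powr \<epsilon> / dist b a powr (1 + \<epsilon>)"
      using elim d dist_commute[of a b] by (intro CZ_kernelD3[OF K]) (force, linarith)
    moreover have "norm (K (fst q) (snd q) - K a b) \<le> norm (K a (snd q) - K (fst q) (snd q)) + norm (K a b - K a (snd q))"
      by (smt (verit, ccfv_SIG) norm_minus_commute norm_triangle_ineq4 diff_add_cancel add.commute norm_triangle_sub diff_diff_eq2 add_diff_cancel)
    ultimately show ?case by linarith
  qed
  have "(?g \<longlongrightarrow> 0 / dist a b powr (1 + \<epsilon>) + 0 / dist b a powr (1 + \<epsilon>)) ?N"
    using d \<open>\<epsilon> > 0\<close> lim
    by (intro tendsto_add tendsto_divide dist_powr_tendsto_0 tendsto_const tendsto_powr tendsto_dist)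
      (auto simp: dist_commute)
  then have g: "(?g \<longlongrightarrow> 0) ?N" by simp
  have "((\<lambda>q. K (fst q) (snd q) - K a b) \<longlongrightarrow> 0) ?N"
    by (rule Lim_null_comparison[OF bound g])
  then have "((\<lambda>q. K (fst q) (snd q)) \<longlongrightarrow> K a b) ?N"
    using LIM_zero_iff by blast
  then have "((\<lambda>q. K (fst q) (snd q)) \<longlongrightarrow> K (fst p) (snd p)) (at p)"
    unfolding a_def b_def by (rule tendsto_mono[rotated]) (simp add: at_within_def)
  then show "isCont (\<lambda>p. K (fst p) (snd p)) p" unfolding isCont_def .
qed

lemma CZ_kernel_measurable:
  assumes "CZ_kernel \<epsilon> K" and "\<epsilon> > 0"
  shows "(\<lambda>p. if fst p = snd p then 0 else K (fst p) (snd p)) \<in> borel_measurable (borel \<Otimes>\<^sub>M borel)"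
proof -
  have "{p :: complex \<times> complex. fst p \<noteq> snd p} \<in> sets borel"
    by (intro borel_open open_Collect_neq continuous_intros)
  then have "(\<lambda>p. indicator {p. fst p \<noteq> snd p} p *\<^sub>R K (fst p) (snd p)) \<in> borel_measurable borel"
    by (intro borel_measurable_continuous_on_indicator CZ_kernel_continuous_on[OF assms])
  moreover have "(\<lambda>p. indicator {p. fst p \<noteq> snd p} p *\<^sub>R K (fst p) (snd p)) = (\<lambda>p. if fst p = snd p then 0 else K (fst p) (snd p))"
    by (auto simp: indicator_def)
  ultimately show ?thesis by (simp add: borel_prod)
qed

section \<open>Test functions and measures of linear growth\<close>

lemma pred_ball [measurable]: "Measurable.pred borel (\<lambda>x. x \<in> ball (z::complex) r)"
  by (simp add: pred_def)

text \<open>The class in which all computations take place. Under linear growth it lies in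
  \<open>Lp_space p \<mu>\<close> for every positive p, so the L2 operator and its extension both
  act on it and agree there almost everywhere.\<close>

definition test_fun :: "(complex \<Rightarrow> complex) \<Rightarrow> bool" where
  "test_fun f \<longleftrightarrow> f \<in> borel_measurable borel \<and> bounded (range f) \<and> bounded {x. f x \<noteq> 0}"

lemma test_fun_measurable: "test_fun f \<Longrightarrow> f \<in> borel_measurable borel"
  by (simp add: test_fun_def)

lemma test_fun_bound:
  assumes "test_fun f"
  obtains C where "C > 0" "\<And>x. norm (f x) \<le> C"
  using assms unfolding test_fun_def bounded_pos by auto

lemma test_fun_support:
  assumes "test_fun f"
  obtains r where "r > 0" "\<And>x. f x \<noteq> 0 \<Longrightarrow> x \<in> ball z r"
proof -
  from assms have "bounded {x. f x \<noteq> 0}" by (simp add: test_fun_def)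
  then obtain e where e: "{x. f x \<noteq> 0} \<subseteq> ball z e"
    by (meson bounded_subset_ballD)
  show ?thesis
    by (rule that[of "max e 1"]) (use e in \<open>force simp: subset_iff\<close>)+
qed

lemma test_funI:
  assumes "f \<in> borel_measurable borel" "\<And>x. norm (f x) \<le> C" "\<And>x. f x \<noteq> 0 \<Longrightarrow> x \<in> E" "bounded E"
  shows "test_fun f"
proof -
  have "bounded {x. f x \<noteq> 0}" by (rule bounded_subset[OF assms(4)]) (use assms(3) in auto)
  then show ?thesis using assms unfolding test_fun_def bounded_iff by auto
qed

lemma test_fun_dominated:
  assumes "test_fun f" "g \<in> borel_measurable borel" "\<And>x. norm (g x) \<le> C * norm (f x)"
  shows "test_fun g"
proof -
  obtain D where D: "D > 0" "\<And>x. norm (f x) \<le> D" using test_fun_bound[OF assms(1)] by blast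
  have "norm (g x) \<le> \<bar>C\<bar> * D" for x
    using assms(3)[of x] D(2)[of x] by (smt (verit, best) abs_ge_self mult_mono norm_ge_zero)
  moreover have "f x \<noteq> 0" if "g x \<noteq> 0" for x using assms(3)[of x] that by auto
  ultimately show ?thesis
    using assms by (intro test_funI[where E = "{x. f x \<noteq> 0}"]) (auto simp: test_fun_def)
qed

lemma test_fun_indicator:
  "bounded E \<Longrightarrow> E \<in> sets borel \<Longrightarrow> test_fun (indicator E)"
  by (rule test_funI[where C = 1 and E = E]) (auto simp: indicator_def)

lemma test_fun_zero: "test_fun (\<lambda>x. 0)"
  by (simp add: test_fun_def)

lemma test_fun_add:
  assumes "test_fun f" "test_fun g"
  shows "test_fun (\<lambda>x. f x + g x)"
proof -
  obtain D where D: "D > 0" "\<And>x. norm (g x) \<le> D" using test_fun_bound[OF assms(2)] by blast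
  obtain C where C: "C > 0" "\<And>x. norm (f x) \<le> C" using test_fun_bound[OF assms(1)] by blast
  show ?thesis
    by (rule test_funI[where C = "C + D" and E = "{x. f x \<noteq> 0} \<union> {x. g x \<noteq> 0}"])
      (use assms C D in \<open>auto simp: test_fun_def intro: norm_triangle_mono\<close>)
qed

lemma test_fun_cmult:
  assumes "test_fun f" shows "test_fun (\<lambda>x. c * f x)"
proof (rule test_fun_dominated[OF assms, where C = "norm c"])
  note [measurable] = test_fun_measurable[OF assms]
  show "(\<lambda>x. c * f x) \<in> borel_measurable borel" by measurable
qed (simp add: norm_mult)

lemma test_fun_sum:
  assumes "finite I" "\<And>i. i \<in> I \<Longrightarrow> test_fun (f i)"
  shows "test_fun (\<lambda>x. \<Sum>i\<in>I. f i x)"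
  using assms by (induction I rule: finite_induct) (auto simp: test_fun_zero test_fun_add)

locale linear_growth =
  fixes \<mu> :: "complex measure"
  assumes sets_mu [measurable_cong, simp]: "sets \<mu> = sets borel"
    and growth: "r > 0 \<Longrightarrow> emeasure \<mu> (ball z r) \<le> ennreal r"
begin

lemma space_mu [simp]: "space \<mu> = UNIV"
  using sets_eq_imp_space_eq[OF sets_mu] by simp

lemma measurable_mu: "borel_measurable \<mu> = borel_measurable borel"
  by (rule measurable_cong_sets) simp_all

lemma emeasure_bounded_finite:
  assumes "bounded E" shows "emeasure \<mu> E < \<infinity>"
proof -
  obtain e where e: "e > 0" "E \<subseteq> ball 0 e"
    using bounded_subset_ballD[OF assms, of 0] by blast
  then have "emeasure \<mu> E \<le> emeasure \<mu> (ball 0 e)" by (intro emeasure_mono) auto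
  also have "\<dots> \<le> ennreal e" using growth[OF e(1)] .
  finally show ?thesis using le_less_trans by fastforce
qed

lemma emeasure_bounded: "bounded E \<Longrightarrow> emeasure \<mu> E = ennreal (measure \<mu> E)"
  using emeasure_bounded_finite[of E] by (intro emeasure_eq_ennreal_measure) auto

lemma fmeasurable_bounded: "bounded E \<Longrightarrow> E \<in> sets borel \<Longrightarrow> E \<in> fmeasurable \<mu>"
  using emeasure_bounded_finite[of E] by (auto simp: fmeasurable_def)

lemma measure_mono_bounded: "A \<subseteq> E \<Longrightarrow> A \<in> sets borel \<Longrightarrow> bounded E \<Longrightarrow> E \<in> sets borel \<Longrightarrow> measure \<mu> A \<le> measure \<mu> E"
  by (intro measure_mono_fmeasurable fmeasurable_bounded) auto

lemma measure_ball_le: "r > 0 \<Longrightarrow> measure \<mu> (ball z r) \<le> r"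
  using growth[of r z] by (simp add: emeasure_bounded)

sublocale sigma_finite_measure \<mu>
proof
  show "\<exists>A. countable A \<and> A \<subseteq> sets \<mu> \<and> \<Union>A = space \<mu> \<and> (\<forall>a\<in>A. emeasure \<mu> a \<noteq> \<infinity>)"
  proof (intro exI conjI ballI)
    show "countable (range (\<lambda>n::nat. ball (0::complex) (real n)))" by simp
    show "\<Union> (range (\<lambda>n::nat. ball (0::complex) (real n))) = space \<mu>"
      using reals_Archimedean2 by auto
    show "emeasure \<mu> a \<noteq> \<infinity>" if "a \<in> range (\<lambda>n::nat. ball (0::complex) (real n))" for a
      using that emeasure_bounded_finite[of a] by auto
  qed auto
qed

lemma integrable_bounded_support:
  fixes f :: "complex \<Rightarrow> 'b::{banach, second_countable_topology}"
  assumes "f \<in> borel_measurable borel" "\<And>x. norm (f x) \<le> C" "\<And>x. f x \<noteq> 0 \<Longrightarrow> x \<in> ball z r"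
  shows "integrable \<mu> f"
  by (rule integrableI_bounded_set[where A = "ball z r" and B = C])
    (use assms emeasure_bounded_finite[of "ball z r"] in auto)

lemma norm_integral_le_measure:
  fixes f :: "complex \<Rightarrow> 'b::{banach, second_countable_topology}"
  assumes "bounded E" "E \<in> sets borel" "c \<ge> 0"
    and "\<And>x. x \<in> E \<Longrightarrow> norm (f x) \<le> c" "\<And>x. x \<notin> E \<Longrightarrow> f x = 0"
  shows "norm (\<integral>x. f x \<partial>\<mu>) \<le> c * measure \<mu> E"
proof (rule norm_integral_le_of_nn_integral)
  have "(\<integral>\<^sup>+x. ennreal (norm (f x)) \<partial>\<mu>) \<le> (\<integral>\<^sup>+x. ennreal c * indicator E x \<partial>\<mu>)"
    using assms(4,5) by (intro nn_integral_mono) (auto simp: indicator_def intro: ennreal_leI)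
  also have "\<dots> = ennreal c * emeasure \<mu> E" using assms(2) by (intro nn_integral_cmult_indicator) simp
  also have "\<dots> = ennreal (c * measure \<mu> E)" using assms(1,3) by (simp add: emeasure_bounded ennreal_mult)
  finally show "(\<integral>\<^sup>+x. ennreal (norm (f x)) \<partial>\<mu>) \<le> ennreal (c * measure \<mu> E)" .
qed (use assms(3) in simp)

lemma integrable_test_mult:
  assumes "test_fun f" "h \<in> borel_measurable borel" "\<And>x. f x \<noteq> 0 \<Longrightarrow> norm (h x) \<le> C"
  shows "integrable \<mu> (\<lambda>x. h x * f x)"
proof -
  obtain D where D: "D > 0" "\<And>x. norm (f x) \<le> D" using test_fun_bound[OF assms(1)] by blast
  obtain r where r: "\<And>x. f x \<noteq> 0 \<Longrightarrow> x \<in> ball 0 r" using test_fun_support[OF assms(1)] by blast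
  have "norm (h x * f x) \<le> \<bar>C\<bar> * D" for x
    using assms(3)[of x] D(2)[of x] by (cases "f x = 0") (auto simp: norm_mult intro!: mult_mono less_imp_le[OF D(1)])
  moreover have "(\<lambda>x. h x * f x) \<in> borel_measurable borel"
    using assms(2) test_fun_measurable[OF assms(1)] by measurable
  ultimately show ?thesis
    by (intro integrable_bounded_support[where z = 0 and r = r]) (use r in auto)
qed

lemma integrable_test: "test_fun f \<Longrightarrow> integrable \<mu> f"
  using integrable_test_mult[of f "\<lambda>x. 1" 1] by simp

lemma test_fun_Lp_space:
  assumes "test_fun f" "p > 0" shows "f \<in> Lp_space p \<mu>"
proof -
  obtain D where D: "D > 0" "\<And>x. norm (f x) \<le> D" using test_fun_bound[OF assms(1)] by blast
  obtain r where r: "\<And>x. f x \<noteq> 0 \<Longrightarrow> x \<in> ball 0 r" using test_fun_support[OF assms(1)] by blast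
  note [measurable] = test_fun_measurable[OF assms(1)]
  have "integrable \<mu> (\<lambda>x. norm (f x) powr p)"
    by (rule integrable_bounded_support[where z = 0 and r = r and C = "D powr p"])
      (use assms(2) D r in \<open>auto intro!: powr_mono2\<close>)
  then show ?thesis using assms by (simp add: Lp_space_def test_fun_measurable)
qed

section \<open>Integrals over dyadic tails of balls\<close>

lemma nn_integral_ball_suminf:
  fixes f :: "complex \<Rightarrow> ennreal" and c :: "nat \<Rightarrow> ennreal"
  assumes [measurable]: "f \<in> borel_measurable borel"
  shows "(\<integral>\<^sup>+y. (\<Sum>j. c j * (f y * indicator (ball z (t j)) y)) \<partial>\<mu>)
           = (\<Sum>j. c j * (\<integral>\<^sup>+y\<in>ball z (t j). f y \<partial>\<mu>))"
  by (simp add: nn_integral_suminf nn_integral_cmult)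

lemma nn_integral_ball_sum:
  fixes f :: "complex \<Rightarrow> ennreal" and c :: "nat \<Rightarrow> ennreal"
  assumes [measurable]: "f \<in> borel_measurable borel"
  shows "(\<integral>\<^sup>+y. (\<Sum>j\<in>I. c j * (f y * indicator (ball z (t j)) y)) \<partial>\<mu>)
           = (\<Sum>j\<in>I. c j * (\<integral>\<^sup>+y\<in>ball z (t j). f y \<partial>\<mu>))"
  by (simp add: nn_integral_sum nn_integral_cmult)

text \<open>On the annulus between 2^j \<rho> and 2^(j+1) \<rho> the weight is at most
  \<open>a j\<close> and the mass at most M 2^(j+1) \<rho>; the products 2 M 2^(-\<epsilon> j) form
  a geometric series. With f = 1 and \<epsilon> = q - 1 this also gives the integrability of |z -
  y|^(-q) at infinity for q > 1.\<close>

lemma tail_bound: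
  fixes f :: "complex \<Rightarrow> ennreal"
  assumes [measurable]: "f \<in> borel_measurable borel"
    and "\<rho> > 0" "\<epsilon> > 0" "M \<ge> 0"
    and M: "\<And>t. t \<ge> \<rho> \<Longrightarrow> (\<integral>\<^sup>+y\<in>ball z t. f y \<partial>\<mu>) \<le> ennreal (M * t)"
  shows "(\<integral>\<^sup>+y\<in>-ball z \<rho>. f y * ennreal (\<rho> powr \<epsilon> / dist z y powr (1 + \<epsilon>)) \<partial>\<mu>)
           \<le> ennreal (2 / (1 - 2 powr -\<epsilon>) * M)"
proof -
  define a where "a j = (2 powr - (1 + \<epsilon>)) ^ j / \<rho>" for j :: nat
  have a_nonneg: "a j \<ge> 0" for j using \<open>\<rho> > 0\<close> unfolding a_def by simp
  have q: "2 powr -\<epsilon> < (1::real)" "2 powr -\<epsilon> > (0::real)"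
    using \<open>\<epsilon> > 0\<close> by (auto simp: powr_less_one)
  have pt: "f y * ennreal (\<rho> powr \<epsilon> / dist z y powr (1 + \<epsilon>)) * indicator (-ball z \<rho>) y
      \<le> (\<Sum>j. ennreal (a j) * (f y * indicator (ball z (2 ^ Suc j * \<rho>)) y))" for y
  proof (cases "y \<in> - ball z \<rho>")
    case True
    define d where "d = dist z y"
    have d: "d \<ge> \<rho>" using True unfolding d_def by auto
    define j where "j = nat \<lfloor>log 2 (d / \<rho>)\<rfloor>"
    have "log 2 (d / \<rho>) \<ge> 0" using d \<open>\<rho> > 0\<close> by simp
    then have "real j \<le> log 2 (d / \<rho>)" "log 2 (d / \<rho>) < real (Suc j)"
      unfolding j_def by linarith+
    then have "2 powr real j \<le> d / \<rho>" "d / \<rho> < 2 powr real (Suc j)"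
      using d \<open>\<rho> > 0\<close> by (auto simp: le_log_iff log_less_iff simp del: of_nat_Suc)
    then have j: "2 ^ j * \<rho> \<le> d" "d < 2 ^ Suc j * \<rho>"
      using \<open>\<rho> > 0\<close> by (auto simp: powr_realpow field_simps simp del: of_nat_Suc)
    have "a j = \<rho> powr \<epsilon> / (2 ^ j * \<rho>) powr (1 + \<epsilon>)"
    proof -
      have "(2 ^ j * \<rho>) powr (1 + \<epsilon>) = (2 powr (1 + \<epsilon>)) ^ j * (\<rho> * \<rho> powr \<epsilon>)"
        using \<open>\<rho> > 0\<close> by (simp add: powr_mult powr_add powr_powr powr_power flip: powr_realpow) (simp add: mult.commute)
      then show ?thesis
        using \<open>\<rho> > 0\<close> unfolding a_def powr_minus by (simp add: power_inverse field_simps)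
    qed
    also have "\<dots> \<ge> \<rho> powr \<epsilon> / d powr (1 + \<epsilon>)"
      using j \<open>\<rho> > 0\<close> \<open>\<epsilon> > 0\<close> by (intro divide_left_mono powr_mono2 mult_pos_pos) auto
    finally have "f y * ennreal (\<rho> powr \<epsilon> / d powr (1 + \<epsilon>)) \<le> ennreal (a j) * (f y * indicator (ball z (2 ^ Suc j * \<rho>)) y)"
      using j unfolding d_def by (simp add: mult.commute) (intro mult_left_mono ennreal_leI; simp)
    also have "\<dots> \<le> (\<Sum>j. ennreal (a j) * (f y * indicator (ball z (2 ^ Suc j * \<rho>)) y))"
      using sum_le_suminf[OF summableI, of "{j}"] by simp
    finally show ?thesis using True unfolding d_def by simp
  qed simp
  have "(\<integral>\<^sup>+y\<in>-ball z \<rho>. f y * ennreal (\<rho> powr \<epsilon> / dist z y powr (1 + \<epsilon>)) \<partial>\<mu>)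
      \<le> (\<integral>\<^sup>+y. (\<Sum>j. ennreal (a j) * (f y * indicator (ball z (2 ^ Suc j * \<rho>)) y)) \<partial>\<mu>)"
    by (intro nn_integral_mono pt)
  also have "\<dots> = (\<Sum>j. ennreal (a j) * (\<integral>\<^sup>+y\<in>ball z (2 ^ Suc j * \<rho>). f y \<partial>\<mu>))"
    by (rule nn_integral_ball_suminf) fact
  also have "\<dots> \<le> (\<Sum>j. ennreal (2 * M * (2 powr -\<epsilon>) ^ j))"
  proof (intro suminf_le summableI)
    fix j
    have "\<rho> \<le> 2 ^ Suc j * \<rho>" using \<open>\<rho> > 0\<close> one_le_power[of "2::real" "Suc j"] by simp
    then have "ennreal (a j) * (\<integral>\<^sup>+y\<in>ball z (2 ^ Suc j * \<rho>). f y \<partial>\<mu>) \<le> ennreal (a j) * ennreal (M * (2 ^ Suc j * \<rho>))"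
      by (intro mult_left_mono M) auto
    also have "\<dots> = ennreal (a j * (M * (2 ^ Suc j * \<rho>)))"
      using a_nonneg by (simp add: ennreal_mult')
    also have "a j * (M * (2 ^ Suc j * \<rho>)) = 2 * M * (2 powr -\<epsilon>) ^ j"
    proof -
      have "(2 powr - (1 + \<epsilon>)) ^ j * 2 ^ j = ((2::real) powr -\<epsilon>) ^ j"
      proof -
        have "2 powr - (1 + \<epsilon>) * 2 = (2::real) powr -\<epsilon>"
          using powr_add[of "2::real" "- (1 + \<epsilon>)" 1] by simp
        then show ?thesis unfolding power_mult_distrib[symmetric] by (rule arg_cong)
      qed
      then show ?thesis using \<open>\<rho> > 0\<close> unfolding a_def by (simp add: mult_ac)
    qed
    finally show "ennreal (a j) * (\<integral>\<^sup>+y\<in>ball z (2 ^ Suc j * \<rho>). f y \<partial>\<mu>) \<le> ennreal (2 * M * (2 powr -\<epsilon>) ^ j)" .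
  qed
  also have "\<dots> = ennreal (2 * M * (1 / (1 - 2 powr -\<epsilon>)))"
    using q \<open>M \<ge> 0\<close> by (intro suminf_ennreal_eq sums_mult geometric_sums) auto
  finally show ?thesis by (simp add: mult.commute)
qed

section \<open>Doubling radii and the annuli below them\<close>

definition mu3 :: "complex \<Rightarrow> real \<Rightarrow> nat \<Rightarrow> real" where
  "mu3 z r j = measure \<mu> (ball z (3 ^ j * r))"

text \<open>Among the balls of radius \<open>3^j r\<close> take the first one of positive measure whose measure grows by
  at most \<open>81\<close> under dilation by \<open>9\<close>; it exists since \<open>81 > 9\<close> beats the linear growth.\<close>

lemma exists_doubling_radius:
  assumes "r > 0" and "measure \<mu> (ball z t) > 0"
  obtains k where "mu3 z r k > 0" "mu3 z r (k + 2) \<le> 81 * mu3 z r k"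
    "\<And>j. j < k \<Longrightarrow> 81 * mu3 z r j \<le> mu3 z r (j + 2)"
proof -
  let ?P = "\<lambda>k. mu3 z r k > 0 \<and> mu3 z r (k + 2) \<le> 81 * mu3 z r k"
  have mono: "mu3 z r i \<le> mu3 z r j" if "i \<le> j" for i j
    unfolding mu3_def using that \<open>r > 0\<close>
    by (intro measure_mono_bounded subset_ball mult_right_mono power_increasing) auto
  have ex: "\<exists>k. ?P k"
  proof (rule ccontr)
    assume neg: "\<nexists>k. ?P k"
    obtain j0 where j0: "t / r < 3 ^ j0"
      using real_arch_pow[of 3 "t / r"] by auto
    have "measure \<mu> (ball z t) \<le> mu3 z r j0"
      unfolding mu3_def using j0 \<open>r > 0\<close> by (intro measure_mono_bounded subset_ball) (auto simp: field_simps)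
    then have pos: "mu3 z r j0 > 0" using assms by linarith
    have grow: "81 ^ i * mu3 z r j0 \<le> mu3 z r (j0 + 2 * i)" for i
    proof (induction i)
      case (Suc i)
      have "mu3 z r (j0 + 2 * i) > 0" using pos mono[of j0 "j0 + 2 * i"] by simp
      then have "81 * mu3 z r (j0 + 2 * i) < mu3 z r (j0 + 2 * i + 2)"
        using neg by (meson not_le_imp_less)
      then show ?case using Suc by simp
    qed simp
    have "81 ^ i * mu3 z r j0 \<le> 9 ^ i * (3 ^ j0 * r)" for i
    proof -
      have "mu3 z r (j0 + 2 * i) \<le> 3 ^ (j0 + 2 * i) * r"
        unfolding mu3_def using \<open>r > 0\<close> by (intro measure_ball_le) auto
      also have "\<dots> = 9 ^ i * (3 ^ j0 * r)" by (simp add: power_add power_mult)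
      finally show ?thesis using grow[of i] by linarith
    qed
    then have "9 ^ i * mu3 z r j0 \<le> 3 ^ j0 * r" for i
    proof -
      have "(81::real) ^ i = 9 ^ i * 9 ^ i" by (simp flip: power_mult_distrib)
      then have "9 ^ i * (9 ^ i * mu3 z r j0) \<le> 9 ^ i * (3 ^ j0 * r)"
        using \<open>81 ^ i * mu3 z r j0 \<le> 9 ^ i * (3 ^ j0 * r)\<close> by simp
      then show ?thesis by simp
    qed
    then have b: "9 ^ i \<le> 3 ^ j0 * r / mu3 z r j0" for i
      using pos by (simp add: field_simps)
    obtain i where "3 ^ j0 * r / mu3 z r j0 < 9 ^ i"
      using real_arch_pow[of 9 "3 ^ j0 * r / mu3 z r j0"] by auto
    with b[of i] show False by simp
  qed
  define k where "k = (LEAST k. ?P k)"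
  have k: "?P k" using LeastI_ex[OF ex] unfolding k_def .
  \<comment> \<open>Before the least index either the measure is 0 or the growth bound fails; the
    reversed inequality holds in both cases.\<close>
  have "81 * mu3 z r j \<le> mu3 z r (j + 2)" if "j < k" for j
  proof -
    have "\<not> ?P j" using not_less_Least that unfolding k_def by blast
    moreover have "mu3 z r j \<ge> 0" "mu3 z r (j + 2) \<ge> 0" unfolding mu3_def by auto
    ultimately show ?thesis by force
  qed
  then show ?thesis using that[of k] k by blast
qed

text \<open>The condition on r under the supremum in \<open>M_tilde\<close>, with real-valued
  measures.\<close>

definition doubling :: "complex \<Rightarrow> real \<Rightarrow> bool" where
  "doubling z r \<longleftrightarrow> r > 0 \<and> measure \<mu> (ball z r) > 0 \<and> measure \<mu> (ball z (3 * r)) \<le> 81 * measure \<mu> (ball z r)"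

text \<open>Since \<mu>(B(z,3R)) lies between \<mu>(B(z,R)) and \<mu>(B(z,9R)), one bound for the
  dilation by 9 makes two consecutive radii doubling.\<close>

lemma exists_doubling_ball:
  assumes "r > 0" and "measure \<mu> (ball z t) > 0"
  obtains k R where "R = 3 ^ k * r" "doubling z R" "doubling z (3 * R)"
    "\<And>j. j < k \<Longrightarrow> 81 * mu3 z r j \<le> mu3 z r (j + 2)"
proof -
  obtain k where k: "mu3 z r k > 0" "mu3 z r (k + 2) \<le> 81 * mu3 z r k"
    "\<And>j. j < k \<Longrightarrow> 81 * mu3 z r j \<le> mu3 z r (j + 2)"
    using exists_doubling_radius[OF assms] by blast
  have "mu3 z r k \<le> mu3 z r (k + 1)" "mu3 z r (k + 1) \<le> mu3 z r (k + 2)"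
    unfolding mu3_def using \<open>r > 0\<close> by (intro measure_mono_bounded subset_ball; simp)+
  then have "doubling z (3 ^ k * r)" "doubling z (3 * (3 ^ k * r))"
    using k(1,2) \<open>r > 0\<close> unfolding doubling_def mu3_def by (simp_all add: mult.assoc)
  then show ?thesis using k(3) that by blast
qed

text \<open>Hypothesis \<open>M\<close> is what Hoelder's inequality makes of an
  \<open>L^\<beta>\<close> bound, with \<theta> = 1 - 1/\<beta>. The j-th annulus contributes 3 M
  u^\<theta>, where u is the ratio of measure to radius for its outer ball, and these ratios decay
  geometrically from the largest ball inwards. The case \<theta> = 1 serves bounded
  functions.\<close>

lemma annuli_bound:
  fixes f :: "complex \<Rightarrow> ennreal"
  assumes [measurable]: "f \<in> borel_measurable borel"
    and "r > 0" "0 < \<theta>" "\<theta> \<le> 1" "M \<ge> 0"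
    and k: "\<And>j. j < k \<Longrightarrow> 81 * mu3 z r j \<le> mu3 z r (j + 2)"
    and M: "\<And>t. t > 0 \<Longrightarrow> (\<integral>\<^sup>+y\<in>ball z t. f y \<partial>\<mu>) \<le> ennreal (M * t powr (1 - \<theta>) * measure \<mu> (ball z t) powr \<theta>)"
  shows "(\<integral>\<^sup>+y\<in>ball z (3 ^ Suc k * r) - ball z r. f y * ennreal (1 / dist z y) \<partial>\<mu>)
           \<le> ennreal (9 / (1 - 3 powr -\<theta>) * M)"
proof -
  define u where "u j = mu3 z r j / (3 ^ j * r)" for j
  have u_nonneg: "u j \<ge> 0" for j using \<open>r > 0\<close> unfolding u_def mu3_def by auto
  have u1: "u j \<le> 1" for j
    using measure_ball_le[of "3 ^ j * r" z] \<open>r > 0\<close> unfolding u_def mu3_def by (simp add: divide_le_eq)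
  have u2: "u j \<le> u (j + 2) / 9" if "j < k" for j
    using k[OF that] \<open>r > 0\<close> unfolding u_def by (simp add: field_simps)
  have q: "3 powr -\<theta> < (1::real)" "3 powr -\<theta> > (0::real)"
    using \<open>0 < \<theta>\<close> by (auto simp: powr_less_one)
  \<comment> \<open>The recursion has step two: u loses a factor 9 over two radii. Both starting
    values are at most 1, and the leading factor 3 makes the bound exact for i = 1.\<close>
  have u3: "i \<le> Suc k \<Longrightarrow> u (Suc k - i) \<le> 3 * (1 / 3) ^ i" for i
  proof (induction i rule: induct_nat_012)
    case (ge2 n)
    have "u (Suc k - Suc (Suc n)) \<le> u (Suc k - Suc (Suc n) + 2) / 9" 
      if "Suc (Suc n) \<le> Suc k"
      by (rule u2) (use that in auto)
    moreover have "Suc k - Suc (Suc n) + 2 = Suc k - n" using ge2.prems by auto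
    ultimately show ?case using ge2 by auto
  qed (use u1[of "Suc k"] u1[of k] in auto)
  have pt: "f y * ennreal (1 / dist z y) * indicator (ball z (3 ^ Suc k * r) - ball z r) y
      \<le> (\<Sum>j\<le>k. ennreal (1 / (3 ^ j * r)) * (f y * indicator (ball z (3 ^ Suc j * r)) y))" for y
  proof (cases "y \<in> ball z (3 ^ Suc k * r) - ball z r")
    case True
    define j where "j = (LEAST j. dist z y < 3 ^ Suc j * r)"
    have kk: "dist z y < 3 ^ Suc k * r" using True by simp
    have j: "dist z y < 3 ^ Suc j * r" "j \<le> k"
      unfolding j_def using LeastI[of "\<lambda>j. dist z y < 3 ^ Suc j * r", OF kk] 
       Least_le[of "\<lambda>j. dist z y < 3 ^ Suc j * r", OF kk] by auto
    have j2: "3 ^ j * r \<le> dist z y"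
    proof (cases j)
      case 0 then show ?thesis using True by auto
    next
      case (Suc i)
      then have "\<not> dist z y < 3 ^ Suc i * r"
        using not_less_Least[of i "\<lambda>j. dist z y < 3 ^ Suc j * r"] unfolding j_def by auto
      then show ?thesis using Suc by simp
    qed
    have "1 / dist z y \<le> 1 / (3 ^ j * r)"
      using j2 \<open>r > 0\<close> by (intro frac_le) auto
    then have "f y * ennreal (1 / dist z y) \<le> ennreal (1 / (3 ^ j * r)) * (f y * indicator (ball z (3 ^ Suc j * r)) y)"
      using j by (simp add: mult.commute del: power_Suc) (intro mult_left_mono ennreal_leI; simp)
    also have "\<dots> \<le> (\<Sum>j\<le>k. ennreal (1 / (3 ^ j * r)) * (f y * indicator (ball z (3 ^ Suc j * r)) y))"
      using j(2) by (intro member_le_sum) auto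
    finally show ?thesis using True by simp
  qed simp
  have "(\<integral>\<^sup>+y\<in>ball z (3 ^ Suc k * r) - ball z r. f y * ennreal (1 / dist z y) \<partial>\<mu>)
      \<le> (\<integral>\<^sup>+y. (\<Sum>j\<le>k. ennreal (1 / (3 ^ j * r)) * (f y * indicator (ball z (3 ^ Suc j * r)) y)) \<partial>\<mu>)"
    by (intro nn_integral_mono pt)
  also have "\<dots> = (\<Sum>j\<le>k. ennreal (1 / (3 ^ j * r)) * (\<integral>\<^sup>+y\<in>ball z (3 ^ Suc j * r). f y \<partial>\<mu>))"
    by (rule nn_integral_ball_sum) fact
  also have "\<dots> \<le> (\<Sum>j\<le>k. ennreal (3 * M * u (Suc j) powr \<theta>))"
  proof (intro sum_mono)
    fix j
    have r3: "3 ^ Suc j * r > 0" using \<open>r > 0\<close> by simp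
    have "ennreal (1 / (3 ^ j * r)) * (\<integral>\<^sup>+y\<in>ball z (3 ^ Suc j * r). f y \<partial>\<mu>)
       \<le> ennreal (1 / (3 ^ j * r)) * ennreal (M * (3 ^ Suc j * r) powr (1 - \<theta>) * measure \<mu> (ball z (3 ^ Suc j * r)) powr \<theta>)"
      by (intro mult_left_mono M r3) auto
    also have "\<dots> = ennreal (1 / (3 ^ j * r) * (M * (3 ^ Suc j * r) powr (1 - \<theta>) * measure \<mu> (ball z (3 ^ Suc j * r)) powr \<theta>))"
      using \<open>r > 0\<close> by (intro ennreal_mult'[symmetric]) auto
    also have "1 / (3 ^ j * r) * (M * (3 ^ Suc j * r) powr (1 - \<theta>) * measure \<mu> (ball z (3 ^ Suc j * r)) powr \<theta>) = 3 * M * u (Suc j) powr \<theta>"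
    proof -
      define R where "R = 3 ^ Suc j * r"
      have R: "R > 0" using r3 unfolding R_def .
      have "u (Suc j) powr \<theta> = measure \<mu> (ball z R) powr \<theta> / R powr \<theta>"
        unfolding u_def mu3_def R_def using r3 by (subst powr_divide) auto
      moreover have "1 / (3 ^ j * r) = 3 / R" unfolding R_def by simp
      ultimately show ?thesis
        unfolding R_def[symmetric] using R by (simp add: powr_diff)
    qed
    finally show "ennreal (1 / (3 ^ j * r)) * (\<integral>\<^sup>+y\<in>ball z (3 ^ Suc j * r). f y \<partial>\<mu>) \<le> ennreal (3 * M * u (Suc j) powr \<theta>)" .
  qed
  also have "\<dots> = ennreal (\<Sum>j\<le>k. 3 * M * u (Suc j) powr \<theta>)"
    using \<open>M \<ge> 0\<close> by (intro sum_ennreal) auto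
  also have "\<dots> \<le> ennreal (9 / (1 - 3 powr -\<theta>) * M)"
  proof (rule ennreal_leI)
    have "(\<Sum>j\<le>k. u (Suc j) powr \<theta>) = (\<Sum>i\<le>k. u (Suc k - i) powr \<theta>)"
      by (rule sum.reindex_bij_witness[of _ "\<lambda>i. k - i" "\<lambda>i. k - i"]) (auto simp: Suc_diff_le)
    also have "\<dots> \<le> (\<Sum>i\<le>k. 3 * (3 powr -\<theta>) ^ i)"
    proof (rule sum_mono)
      fix i assume "i \<in> {..k}"
      then have "u (Suc k - i) powr \<theta> \<le> (3 * (1 / 3) ^ i) powr \<theta>"
        using u3[of i] u_nonneg \<open>0 < \<theta>\<close> by (intro powr_mono2) auto
      also have "\<dots> = 3 powr \<theta> * ((1 / 3) ^ i) powr \<theta>" by (simp add: powr_mult)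
      also have "((1 / 3) ^ i) powr \<theta> = ((3::real) powr -\<theta>) ^ i"
      proof -
        have "(1 / 3) ^ i = (3::real) powr (- real i)"
          by (simp add: powr_minus powr_realpow power_one_over inverse_eq_divide)
        moreover have "((3::real) powr -\<theta>) ^ i = 3 powr (-\<theta> * real i)"
          by (subst powr_realpow[symmetric]) (auto simp: powr_powr)
        ultimately show ?thesis by (simp add: powr_powr mult.commute)
      qed
      also have "3 powr \<theta> * (3 powr -\<theta>) ^ i \<le> 3 powr 1 * (3 powr -\<theta>) ^ i"
        using \<open>\<theta> \<le> 1\<close> by (intro mult_right_mono powr_mono) auto
      finally show "u (Suc k - i) powr \<theta> \<le> 3 * (3 powr -\<theta>) ^ i" by simp
    qed
    also have "\<dots> = 3 * (\<Sum>i\<le>k. (3 powr -\<theta>) ^ i)" by (simp add: sum_distrib_left)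
    also have "(\<Sum>i\<le>k. (3 powr -\<theta>) ^ i) \<le> 1 / (1 - 3 powr -\<theta>)"
      using q sum_le_suminf[of "\<lambda>i. (3 powr -\<theta>) ^ i" "{..k}"] suminf_geometric[of "3 powr -\<theta>"]
      by (simp add: summable_geometric)
    finally have "(\<Sum>j\<le>k. u (Suc j) powr \<theta>) \<le> 3 * (1 / (1 - 3 powr -\<theta>))" by simp
    then have "3 * M * (\<Sum>j\<le>k. u (Suc j) powr \<theta>) \<le> 3 * M * (3 * (1 / (1 - 3 powr -\<theta>)))"
      using \<open>M \<ge> 0\<close> by (intro mult_left_mono) auto
    then show "(\<Sum>j\<le>k. 3 * M * u (Suc j) powr \<theta>) \<le> 9 / (1 - 3 powr -\<theta>) * M"
      by (simp add: sum_distrib_left mult.assoc)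
  qed
  finally show ?thesis .
qed

end

section \<open>Integrals against the kernel\<close>

definition restr :: "complex set \<Rightarrow> (complex \<Rightarrow> complex) \<Rightarrow> complex \<Rightarrow> complex" where
  "restr E f y = indicator E y * f y"

lemma restr_in [simp]: "y \<in> E \<Longrightarrow> restr E f y = f y"
  by (simp add: restr_def)

lemma restr_out [simp]: "y \<notin> E \<Longrightarrow> restr E f y = 0"
  by (simp add: restr_def)

lemma norm_restr_le: "norm (restr E f y) \<le> norm (f y)"
  by (cases "y \<in> E") auto

lemma test_fun_restr: "test_fun f \<Longrightarrow> E \<in> sets borel \<Longrightarrow> test_fun (restr E f)"
proof (rule test_fun_dominated[where C = 1])
  assume "test_fun f" and [measurable]: "E \<in> sets borel"
  note [measurable] = test_fun_measurable[OF this(1)]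
  show "restr E f \<in> borel_measurable borel" unfolding restr_def[abs_def] by measurable
qed (auto intro: norm_restr_le)

text \<open>Twice the sum of the geometric series with ratio 2^(-\<epsilon>), as it comes out of
  \<open>tail_bound\<close>.\<close>

definition tail_const :: "real \<Rightarrow> real" where
  "tail_const \<epsilon> = 2 / (1 - 2 powr -\<epsilon>)"

text \<open>Measurability is required on the whole product, diagonal included. A Calderon-Zygmund
  kernel satisfies it once its diagonal values are set to 0.\<close>

locale growth_kernel = linear_growth +
  fixes \<epsilon> :: real and K :: "complex \<Rightarrow> complex \<Rightarrow> complex"
  assumes eps: "\<epsilon> > 0" and CZ: "CZ_kernel \<epsilon> K"
    and K_measurable: "(\<lambda>p. K (fst p) (snd p)) \<in> borel_measurable (borel \<Otimes>\<^sub>M borel)"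
begin

lemma K_measurable_swap: "(\<lambda>p. K (snd p) (fst p)) \<in> borel_measurable (borel \<Otimes>\<^sub>M borel)"
proof -
  have "(\<lambda>p. (snd p, fst p)) \<in> borel \<Otimes>\<^sub>M borel \<rightarrow>\<^sub>M (borel \<Otimes>\<^sub>M borel :: (complex \<times> complex) measure)"
    by measurable
  from measurable_compose[OF this K_measurable] show ?thesis by simp
qed

lemma growth_kernel_transpose: "growth_kernel \<mu> \<epsilon> (\<lambda>x y. K y x)"
  by unfold_locales (use eps CZ_kernel_transpose[OF CZ] K_measurable_swap in auto)

lemma K_measurable1: "K z \<in> borel_measurable borel"
proof -
  have "Pair z \<in> borel \<rightarrow>\<^sub>M (borel \<Otimes>\<^sub>M borel :: (complex \<times> complex) measure)"
    by (rule measurable_Pair1') simp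
  from measurable_compose[OF this K_measurable] show ?thesis by simp
qed

abbreviation C\<epsilon> :: real where "C\<epsilon> \<equiv> tail_const \<epsilon>"

lemma C\<epsilon>_pos: "C\<epsilon> > 0"
  using eps unfolding tail_const_def by (simp add: powr_less_one)

definition Kint :: "(complex \<Rightarrow> complex) \<Rightarrow> complex \<Rightarrow> complex" where
  "Kint g z = (\<integral>y. K z y * g y \<partial>\<mu>)"

lemma truncated_op_eq: "truncated_op \<mu> K r f z = Kint (restr (- ball z r) f) z"
  unfolding truncated_op_def Kint_def set_lebesgue_integral_def
  by (intro Bochner_Integration.integral_cong) (auto simp: restr_def indicator_def)

lemma norm_K_le: "d > 0 \<Longrightarrow> dist x y \<ge> d \<Longrightarrow> norm (K x y) \<le> 1 / d"
  using CZ_kernelD1[OF CZ, of x y] by (smt (verit) dist_self frac_le)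

lemma Kint_integrable:
  assumes "test_fun g" "d > 0" "\<And>y. y \<in> ball z d \<Longrightarrow> g y = 0"
  shows "integrable \<mu> (\<lambda>y. K z y * g y)"
proof (rule integrable_test_mult[OF assms(1) K_measurable1])
  fix y assume "g y \<noteq> 0"
  then have "dist z y \<ge> d" using assms(3)[of y] by force
  then show "norm (K z y) \<le> 1 / d" by (rule norm_K_le[OF assms(2)])
qed

lemma Kint_add:
  assumes "test_fun f" "test_fun g" "d > 0" "\<And>y. y \<in> ball z d \<Longrightarrow> f y = 0" "\<And>y. y \<in> ball z d \<Longrightarrow> g y = 0"
  shows "Kint (\<lambda>y. f y + g y) z = Kint f z + Kint g z"
  unfolding Kint_def distrib_left
  by (rule Bochner_Integration.integral_add) (rule Kint_integrable; use assms in blast)+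

lemma Kint_restr_Un:
  assumes "test_fun f" "d > 0" "A \<inter> B = {}" "A \<in> sets borel" "B \<in> sets borel"
    "(A \<union> B) \<inter> ball z d = {}"
  shows "Kint (restr (A \<union> B) f) z = Kint (restr A f) z + Kint (restr B f) z"
proof -
  have "restr (A \<union> B) f = (\<lambda>y. restr A f y + restr B f y)"
    using assms(3) by (intro ext) (auto simp: restr_def indicator_def)
  moreover have "restr A f y = 0" "restr B f y = 0" if "y \<in> ball z d" for y
    using assms(6) that by (auto intro: restr_out)
  ultimately show ?thesis
    using assms by (simp only:) (rule Kint_add; auto intro: test_fun_restr)
qed

lemma Kint_measurable:
  assumes "test_fun g" shows "Kint g \<in> borel_measurable borel"
proof -
  note [measurable] = test_fun_measurable[OF assms]
  have "(\<lambda>p. K (fst p) (snd p)) \<in> borel_measurable (borel \<Otimes>\<^sub>M \<mu>)"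
    using K_measurable by (simp cong: measurable_cong_sets sets_pair_measure_cong)
  then have "(\<lambda>p. K (fst p) (snd p) * g (snd p)) \<in> borel_measurable (borel \<Otimes>\<^sub>M \<mu>)"
    by measurable
  then have "(\<lambda>z. \<integral>y. K z y * g y \<partial>\<mu>) \<in> borel_measurable borel"
    by (intro borel_measurable_lebesgue_integral) (simp add: case_prod_beta')
  then show ?thesis unfolding Kint_def[abs_def] .
qed

text \<open>Off B(z,\<rho>) the kernel changes by at most \<rho>^\<epsilon> / |z - y|^(1+\<epsilon>)
  when z moves by at most half of \<rho>, so \<open>tail_bound\<close> gives an estimate free of
  \<rho>.\<close>

lemma Kint_shift:
  assumes "test_fun f" "\<rho> > 0" "dist z z' \<le> \<rho> / 2" "M \<ge> 0"
    and M: "\<And>t. t \<ge> \<rho> \<Longrightarrow> (\<integral>\<^sup>+y\<in>ball z t. ennreal (norm (f y)) \<partial>\<mu>) \<le> ennreal (M * t)"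
  shows "norm (Kint (restr (- ball z \<rho>) f) z' - Kint (restr (- ball z \<rho>) f) z) \<le> C\<epsilon> * M"
proof -
  let ?g = "restr (- ball z \<rho>) f"
  note [measurable] = test_fun_measurable[OF assms(1)]
  have g: "test_fun ?g" using assms(1) by (intro test_fun_restr) auto
  have 1: "integrable \<mu> (\<lambda>y. K z y * ?g y)"
    by (rule Kint_integrable[OF g, where d = \<rho>]) (use assms in auto)
  have 2: "integrable \<mu> (\<lambda>y. K z' y * ?g y)"
  proof (rule Kint_integrable[OF g, where d = "\<rho> / 2"])
    fix y assume "y \<in> ball z' (\<rho> / 2)"
    then have "y \<in> ball z \<rho>" using assms(3) dist_triangle[of z y z'] by simp
    then show "?g y = 0" by simp
  qed (use assms in auto)
  have eq: "Kint ?g z' - Kint ?g z = (\<integral>y. (K z' y - K z y) * ?g y \<partial>\<mu>)"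
    unfolding Kint_def left_diff_distrib using 1 2 by (subst Bochner_Integration.integral_diff) auto
  have "(\<integral>\<^sup>+y. ennreal (norm ((K z' y - K z y) * ?g y)) \<partial>\<mu>)
    \<le> (\<integral>\<^sup>+y\<in>-ball z \<rho>. ennreal (norm (f y)) * ennreal (\<rho> powr \<epsilon> / dist z y powr (1 + \<epsilon>)) \<partial>\<mu>)"
  proof (rule nn_integral_mono)
    fix y
    show "ennreal (norm ((K z' y - K z y) * ?g y))
       \<le> ennreal (norm (f y)) * ennreal (\<rho> powr \<epsilon> / dist z y powr (1 + \<epsilon>)) * indicator (- ball z \<rho>) y"
    proof (cases "y \<in> ball z \<rho>")
      case False
      then have d: "dist z y \<ge> \<rho>" by simp
      then have "norm (K z y - K z' y) \<le> dist z z' powr \<epsilon> / dist z y powr (1 + \<epsilon>)"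
        using assms(2,3) by (intro CZ_kernelD2[OF CZ]) auto
      also have "\<dots> \<le> \<rho> powr \<epsilon> / dist z y powr (1 + \<epsilon>)"
        using assms(2,3) eps by (intro divide_right_mono powr_mono2) auto
      finally have "norm ((K z' y - K z y) * f y) \<le> norm (f y) * (\<rho> powr \<epsilon> / dist z y powr (1 + \<epsilon>))"
        unfolding norm_mult by (subst mult.commute, subst norm_minus_commute) (intro mult_left_mono; simp)
      then show ?thesis using False by (simp flip: ennreal_mult'')
    qed simp
  qed
  also have "\<dots> \<le> ennreal (C\<epsilon> * M)"
    unfolding tail_const_def by (rule tail_bound) (use assms eps in auto)
  finally show ?thesis
    unfolding eq using C\<epsilon>_pos assms(4) by (intro norm_integral_le_of_nn_integral) auto
qed

text \<open>On E the kernel is at most 1/a, and E has measure at most b by linear growth.\<close>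

lemma Kint_annulus:
  assumes "test_fun f" "\<And>y. norm (f y) \<le> 1" "0 < a" "0 < b" "E \<in> sets borel" "E \<subseteq> ball z b - ball z a"
  shows "norm (Kint (restr E f) z) \<le> b / a"
proof -
  have "norm (Kint (restr E f) z) \<le> 1 / a * measure \<mu> (ball z b)"
    unfolding Kint_def
  proof (rule norm_integral_le_measure)
    fix y
    show "norm (K z y * restr E f y) \<le> 1 / a"
    proof (cases "y \<in> E")
      case True
      then have "dist z y \<ge> a" using assms(6) by auto
      then have "norm (K z y) * norm (f y) \<le> 1 / a * 1"
        using assms(2,3) norm_K_le by (intro mult_mono) auto
      then show ?thesis using True by (simp add: norm_mult)
    qed (use assms(3) in simp)
    show "K z y * restr E f y = 0" if "y \<notin> ball z b"
    proof -
      have "y \<notin> E" using that assms(6) by blast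
      then show ?thesis by simp
    qed
  qed (use assms in auto)
  also have "\<dots> \<le> 1 / a * b" using assms by (intro mult_left_mono measure_ball_le) auto
  finally show ?thesis by simp
qed

text \<open>At z the truncations at r and 3R differ by the integral in \<open>annuli_bound\<close>.
  The truncated integral over the complement of B(z,3R) varies little on B(z,R) by
  \<open>Kint_shift\<close>, because R is less than half of 3R; so its value at z is compared with
  its average. The lemma is applied to K and to its transpose.\<close>

lemma Kint_le_average:
  assumes f: "test_fun f" and "r > 0" "0 < \<theta>" "\<theta> \<le> 1" "M \<ge> 0"
    and k: "\<And>j. j < k \<Longrightarrow> 81 * mu3 z r j \<le> mu3 z r (j + 2)"
    and R: "R = 3 ^ k * r"
    and M: "\<And>t. t > 0 \<Longrightarrow> (\<integral>\<^sup>+y\<in>ball z t. ennreal (norm (f y)) \<partial>\<mu>)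
              \<le> ennreal (M * t powr (1 - \<theta>) * measure \<mu> (ball z t) powr \<theta>)"
  shows "norm (Kint (restr (- ball z r) f) z) * measure \<mu> (ball z R)
     \<le> norm (\<integral>x. indicator (ball z R) x * Kint (restr (- ball z (3 * R)) f) x \<partial>\<mu>)
        + (9 / (1 - 3 powr -\<theta>) + C\<epsilon>) * M * measure \<mu> (ball z R)"
proof -
  note [measurable] = test_fun_measurable[OF f]
  define g where "g = restr (- ball z (3 * R)) f"
  define m where "m = measure \<mu> (ball z R)"
  have R0: "R > 0" "R \<ge> r" using \<open>r > 0\<close> unfolding R by auto
  have g: "test_fun g" unfolding g_def using f by (intro test_fun_restr) auto
  have q: "3 powr -\<theta> < (1::real)" using \<open>0 < \<theta>\<close> by (auto simp: powr_less_one)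
  have C0: "9 / (1 - 3 powr -\<theta>) * M \<ge> 0" using q \<open>M \<ge> 0\<close> by simp
  \<comment> \<open>Linear growth turns \<mu>(B)^\<theta> into t^\<theta>, which gives the linear
    bound that \<open>Kint_shift\<close> asks for.\<close>
  have M1: "(\<integral>\<^sup>+y\<in>ball z t. ennreal (norm (f y)) \<partial>\<mu>) \<le> ennreal (M * t)" if "t > 0" for t
  proof -
    have "t powr (1 - \<theta>) * measure \<mu> (ball z t) powr \<theta> \<le> t powr (1 - \<theta>) * t powr \<theta>"
      using that \<open>0 < \<theta>\<close> measure_ball_le[OF that, of z] by (intro mult_left_mono powr_mono2) auto
    also have "\<dots> = t" using that by (simp flip: powr_add)
    finally have "M * (t powr (1 - \<theta>) * measure \<mu> (ball z t) powr \<theta>) \<le> M * t"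
      using \<open>M \<ge> 0\<close> by (rule mult_left_mono)
    then show ?thesis using M[OF that] by (simp add: mult.assoc) (meson ennreal_leI order_trans)
  qed
  have near: "norm (Kint (restr (- ball z r) f) z - Kint g z) \<le> 9 / (1 - 3 powr -\<theta>) * M"
  proof -
    have e: "- ball z r = (ball z (3 * R) - ball z r) \<union> (- ball z (3 * R))" using R0 by auto
    have "Kint (restr (- ball z r) f) z = Kint (restr (ball z (3 * R) - ball z r) f) z + Kint g z"
      unfolding g_def by (subst e, rule Kint_restr_Un[OF f \<open>r > 0\<close>]) (use R0 in auto)
    then have "Kint (restr (- ball z r) f) z - Kint g z = Kint (restr (ball z (3 * R) - ball z r) f) z" by simp
    moreover have "norm \<dots> \<le> 9 / (1 - 3 powr -\<theta>) * M"
      unfolding Kint_def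
    proof (rule norm_integral_le_of_nn_integral[OF _ C0])
      have "(\<integral>\<^sup>+y. ennreal (norm (K z y * restr (ball z (3 * R) - ball z r) f y)) \<partial>\<mu>)
         \<le> (\<integral>\<^sup>+y\<in>ball z (3 ^ Suc k * r) - ball z r. ennreal (norm (f y)) * ennreal (1 / dist z y) \<partial>\<mu>)"
      proof (rule nn_integral_mono)
        fix y
        show "ennreal (norm (K z y * restr (ball z (3 * R) - ball z r) f y))
          \<le> ennreal (norm (f y)) * ennreal (1 / dist z y) * indicator (ball z (3 ^ Suc k * r) - ball z r) y"
        proof (cases "y \<in> ball z (3 * R) - ball z r")
          case True
          then have "z \<noteq> y" using \<open>r > 0\<close> by auto
          then have "norm (K z y) \<le> 1 / dist z y" by (rule CZ_kernelD1[OF CZ])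
          then have "norm (K z y) * norm (f y) \<le> norm (f y) * (1 / dist z y)"
            by (subst mult.commute) (intro mult_left_mono; simp)
          then have "ennreal (norm (K z y * f y)) \<le> ennreal (norm (f y)) * ennreal (1 / dist z y)"
            by (simp add: norm_mult flip: ennreal_mult'')
          then show ?thesis using True unfolding R by (simp add: mult.assoc)
        qed simp
      qed
      also have "\<dots> \<le> ennreal (9 / (1 - 3 powr -\<theta>) * M)"
        by (rule annuli_bound) (use assms in auto)
      finally show "(\<integral>\<^sup>+y. ennreal (norm (K z y * restr (ball z (3 * R) - ball z r) f y)) \<partial>\<mu>)
         \<le> ennreal (9 / (1 - 3 powr -\<theta>) * M)" .
    qed
    ultimately show ?thesis by metis
  qed
  have far: "norm (Kint g x - Kint g z) \<le> C\<epsilon> * M" if "x \<in> ball z R" for x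
    unfolding g_def by (rule Kint_shift[OF f]) (use that R0 \<open>M \<ge> 0\<close> M1 in auto)
  define D where "D x = indicator (ball z R) x * (Kint g x - Kint g z)" for x
  have D: "integrable \<mu> D"
  proof (rule integrable_bounded_support[where C = "C\<epsilon> * M" and z = z and r = R])
    show "D \<in> borel_measurable borel"
      unfolding D_def[abs_def] using Kint_measurable[OF g] by measurable
    show "norm (D x) \<le> C\<epsilon> * M" for x
      using far[of x] C\<epsilon>_pos \<open>M \<ge> 0\<close> unfolding D_def by (cases "x \<in> ball z R") auto
  qed (auto simp: D_def indicator_def split: if_splits)
  have "norm (\<integral>x. D x \<partial>\<mu>) \<le> C\<epsilon> * M * m"
    unfolding m_def
    by (rule norm_integral_le_measure) (use far C\<epsilon>_pos \<open>M \<ge> 0\<close> in \<open>auto simp: D_def\<close>)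
  moreover have "(\<integral>x. indicator (ball z R) x * Kint g x \<partial>\<mu>) = (\<integral>x. D x \<partial>\<mu>) + m * Kint g z"
  proof -
    have i: "integrable \<mu> (\<lambda>x. indicator (ball z R) x * Kint g z)"
      by (rule integrable_bounded_support[where C = "norm (Kint g z)" and z = z and r = R])
        (auto simp: indicator_def split: if_splits)
    have "(\<integral>x. indicator (ball z R) x * Kint g z \<partial>\<mu>) = m * Kint g z"
    proof -
      have "(\<integral>x. indicator (ball z R) x * Kint g z \<partial>\<mu>) = (\<integral>x. indicator (ball z R) x *\<^sub>R Kint g z \<partial>\<mu>)"
        by (intro Bochner_Integration.integral_cong) (auto simp: indicator_def)
      also have "\<dots> = m *\<^sub>R Kint g z"
        unfolding m_def using emeasure_bounded_finite[of "ball z R"]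
        by (subst has_bochner_integral_integral_eq[OF has_bochner_integral_scaleR_left[OF has_bochner_integral_real_indicator]]) auto
      finally show ?thesis by (simp add: scaleR_conv_of_real)
    qed
    moreover have "(\<integral>x. indicator (ball z R) x * Kint g x \<partial>\<mu>) = (\<integral>x. D x + indicator (ball z R) x * Kint g z \<partial>\<mu>)"
      unfolding D_def by (simp add: algebra_simps)
    ultimately show ?thesis using D i by simp
  qed
  ultimately have "norm (m * Kint g z) \<le> norm (\<integral>x. indicator (ball z R) x * Kint g x \<partial>\<mu>) + C\<epsilon> * M * m"
    by (smt (verit) norm_diff_ineq norm_triangle_ineq4 add_diff_cancel_left')
  then have b: "norm (Kint g z) * m \<le> norm (\<integral>x. indicator (ball z R) x * Kint g x \<partial>\<mu>) + C\<epsilon> * M * m"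
    by (simp add: norm_mult m_def mult.commute)
  have "norm (Kint (restr (- ball z r) f) z) * m \<le> (norm (Kint g z) + 9 / (1 - 3 powr -\<theta>) * M) * m"
    using near norm_triangle_sub[of "Kint (restr (- ball z r) f) z" "Kint g z"]
    by (intro mult_right_mono) (auto simp: m_def)
  with b show ?thesis unfolding g_def m_def by (simp add: algebra_simps)
qed

end

section \<open>The operator as a bilinear form\<close>

context linear_growth begin

lemma nn_integral_ball_le:
  fixes f :: "complex \<Rightarrow> complex"
  assumes "\<And>y. norm (f y) \<le> 1"
  shows "(\<integral>\<^sup>+y\<in>ball z t. ennreal (norm (f y)) \<partial>\<mu>) \<le> ennreal (measure \<mu> (ball z t))"
proof -
  have "(\<integral>\<^sup>+y\<in>ball z t. ennreal (norm (f y)) \<partial>\<mu>) \<le> (\<integral>\<^sup>+y. indicator (ball z t) y \<partial>\<mu>)"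
    using assms by (intro nn_integral_mono) (auto simp: indicator_def)
  then show ?thesis by (simp add: emeasure_bounded)
qed

lemma nn_integral_ball_le_radius:
  fixes f :: "complex \<Rightarrow> complex"
  assumes "\<And>y. norm (f y) \<le> 1" "t > 0"
  shows "(\<integral>\<^sup>+y\<in>ball z t. ennreal (norm (f y)) \<partial>\<mu>) \<le> ennreal (1 * t)"
  using nn_integral_ball_le[of f z t, OF assms(1)] measure_ball_le[OF assms(2), of z]
  by (auto intro: order_trans ennreal_leI)

text \<open>The measure is then zero. This is the one case without a doubling ball about z, and
  there all integrals vanish.\<close>

lemma AE_False_if_null_balls:
  assumes "\<And>t. measure \<mu> (ball z t) = 0"
  shows "AE x in \<mu>. False"
proof -
  have "ball z (real n) \<in> null_sets \<mu>" for n
    using assms[of "real n"] by (intro null_setsI) (auto simp: emeasure_bounded)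
  then have "(\<Union>n. ball z (real n)) \<in> null_sets \<mu>" by (intro null_sets_UN) auto
  moreover have "(\<Union>n. ball z (real n)) = UNIV" using reals_Archimedean2 by auto
  ultimately have "UNIV \<in> null_sets \<mu>" by simp
  from AE_not_in[OF this] show ?thesis by simp
qed

definition L2sq :: "(complex \<Rightarrow> complex) \<Rightarrow> real" where
  "L2sq f = (\<integral>x. (norm (f x))\<^sup>2 \<partial>\<mu>)"

lemma L2sq_nonneg: "L2sq f \<ge> 0"
  unfolding L2sq_def by simp

lemma L2sq_le:
  assumes "test_fun f" "\<And>x. norm (f x) \<le> c" "\<And>x. x \<notin> E \<Longrightarrow> f x = 0" "bounded E" "E \<in> sets borel"
  shows "L2sq f \<le> c\<^sup>2 * measure \<mu> E"
proof -
  have "norm (\<integral>x. (norm (f x))\<^sup>2 \<partial>\<mu>) \<le> c\<^sup>2 * measure \<mu> E"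
    by (rule norm_integral_le_measure) (use assms in \<open>auto intro: power_mono\<close>)
  then show ?thesis unfolding L2sq_def by simp
qed

end

locale cz_operator = growth_kernel +
  fixes T :: "(complex \<Rightarrow> complex) \<Rightarrow> complex \<Rightarrow> complex" and N :: real
  assumes N_nonneg: "N \<ge> 0" and CZ_T: "CZ_operator \<mu> K T N"
begin

text \<open>All estimates for \<open>Kint\<close> become estimates for \<open>tr.Kint\<close>, the
  integral against the transposed kernel.\<close>

sublocale tr: growth_kernel \<mu> \<epsilon> "\<lambda>x y. K y x"
  by (rule growth_kernel_transpose)

lemma T_bound: "Lp_operator_bound 2 \<mu> T N"
  using CZ_T unfolding CZ_operator_def by simp

lemma test_L2: "test_fun f \<Longrightarrow> f \<in> Lp_space 2 \<mu>"
  by (rule test_fun_Lp_space) auto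

lemma T_L2:
  assumes "test_fun f"
  shows "T f \<in> borel_measurable borel" "integrable \<mu> (\<lambda>x. (norm (T f x))\<^sup>2)" "L2sq (T f) \<le> N\<^sup>2 * L2sq f"
proof -
  have T: "T f \<in> Lp_space 2 \<mu>" and le: "Lp_norm 2 \<mu> (T f) \<le> N * Lp_norm 2 \<mu> f"
    using T_bound test_L2[OF assms] unfolding Lp_operator_bound_def by auto
  have eq: "norm (f x) powr 2 = (norm (f x))\<^sup>2" for f :: "complex \<Rightarrow> complex" and x
    by (simp add: powr_numeral)
  show "T f \<in> borel_measurable borel" "integrable \<mu> (\<lambda>x. (norm (T f x))\<^sup>2)"
    using T unfolding Lp_space_def eq by (auto simp: measurable_mu)
  have nrm: "Lp_norm 2 \<mu> f = sqrt (L2sq f)" for f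
    unfolding Lp_norm_def eq L2sq_def by (simp add: powr_half_sqrt)
  have "sqrt (L2sq (T f)) ^ 2 \<le> (N * sqrt (L2sq f)) ^ 2"
    using le unfolding nrm by (intro power_mono) (auto simp: L2sq_nonneg)
  then show "L2sq (T f) \<le> N\<^sup>2 * L2sq f" by (simp add: L2sq_nonneg power_mult_distrib)
qed

text \<open>The adjoint of \<open>T\<close> is only accessible through this bilinear form.\<close>

definition form :: "(complex \<Rightarrow> complex) \<Rightarrow> (complex \<Rightarrow> complex) \<Rightarrow> complex" where
  "form f g = (\<integral>x. T f x * g x \<partial>\<mu>)"

lemma form_integrable_bound:
  assumes "test_fun f" "test_fun g"
  shows "integrable \<mu> (\<lambda>x. T f x * g x)" "norm (form f g) \<le> N * sqrt (L2sq f) * sqrt (L2sq g)"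
proof -
  note [measurable] = test_fun_measurable[OF assms(2)] T_L2(1)[OF assms(1)]
  have eq: "norm (f x) powr 2 = (norm (f x))\<^sup>2" for f :: "complex \<Rightarrow> complex" and x
    by (simp add: powr_numeral)
  have ig: "integrable \<mu> (\<lambda>x. (norm (g x))\<^sup>2)"
    using test_L2[OF assms(2)] unfolding Lp_space_def eq by simp
  have m: "(\<lambda>x. norm (T f x)) \<in> borel_measurable \<mu>" "(\<lambda>x. norm (g x)) \<in> borel_measurable \<mu>"
    by measurable
  note H = Hoelder_integral[OF m, of 2 2, unfolded eq, OF _ _ _ _ _ T_L2(2)[OF assms(1)] ig, simplified]
  have "integrable \<mu> (\<lambda>x. norm (T f x * g x))" using H(1) by (simp add: norm_mult)
  then show int: "integrable \<mu> (\<lambda>x. T f x * g x)"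
    by (subst (asm) integrable_norm_iff) auto
  have "norm (form f g) \<le> (\<integral>x. norm (T f x) * norm (g x) \<partial>\<mu>)"
    unfolding form_def norm_mult[symmetric] by (rule integral_norm_bound)
  also have "\<dots> \<le> sqrt (L2sq (T f)) * sqrt (L2sq g)"
    using H(2) unfolding L2sq_def by (simp add: powr_half_sqrt)
  also have "\<dots> \<le> (N * sqrt (L2sq f)) * sqrt (L2sq g)"
    using real_sqrt_le_mono[OF T_L2(3)[OF assms(1)]] N_nonneg
    by (intro mult_right_mono) (auto simp: real_sqrt_mult L2sq_nonneg)
  finally show "norm (form f g) \<le> N * sqrt (L2sq f) * sqrt (L2sq g)" .
qed

lemma form_bound_sets:
  assumes "test_fun f" "\<And>x. norm (f x) \<le> c" "\<And>x. x \<notin> E \<Longrightarrow> f x = 0" "bounded E" "E \<in> sets borel"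
    and "test_fun g" "\<And>x. norm (g x) \<le> 1" "\<And>x. x \<notin> D \<Longrightarrow> g x = 0" "bounded D" "D \<in> sets borel"
  shows "norm (form f g) \<le> N * c * sqrt (measure \<mu> E) * sqrt (measure \<mu> D)"
proof -
  have c: "c \<ge> 0" using assms(2)[of 0] norm_ge_zero order_trans by blast
  have "norm (form f g) \<le> N * sqrt (L2sq f) * sqrt (L2sq g)"
    using assms by (intro form_integrable_bound) auto
  also have "\<dots> \<le> N * sqrt (c\<^sup>2 * measure \<mu> E) * sqrt (1\<^sup>2 * measure \<mu> D)"
    using assms N_nonneg by (intro mult_mono real_sqrt_le_mono L2sq_le mult_nonneg_nonneg) (auto simp: L2sq_nonneg)
  finally show ?thesis using c by (simp add: real_sqrt_mult mult.assoc)
qed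

lemma form_add_left:
  assumes "test_fun f1" "test_fun f2" "test_fun g"
  shows "form (\<lambda>x. f1 x + f2 x) g = form f1 g + form f2 g"
proof -
  note [measurable] = test_fun_measurable[OF assms(3)] T_L2(1)[OF assms(1)] T_L2(1)[OF assms(2)]
    T_L2(1)[OF test_fun_add[OF assms(1,2)]]
  have "AE x in \<mu>. T (\<lambda>y. f1 y + f2 y) x = T f1 x + T f2 x"
    using T_bound test_L2[OF assms(1)] test_L2[OF assms(2)] unfolding Lp_operator_bound_def by auto
  then have "form (\<lambda>x. f1 x + f2 x) g = (\<integral>x. T f1 x * g x + T f2 x * g x \<partial>\<mu>)"
    unfolding form_def by (intro integral_cong_AE; measurable?) (auto simp: algebra_simps)
  also have "\<dots> = form f1 g + form f2 g"
    unfolding form_def using assms by (intro Bochner_Integration.integral_add form_integrable_bound) auto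
  finally show ?thesis .
qed

lemma form_cmult_left:
  assumes "test_fun f" "test_fun g"
  shows "form (\<lambda>x. c * f x) g = c * form f g"
proof -
  note [measurable] = test_fun_measurable[OF assms(2)] T_L2(1)[OF assms(1)]
    T_L2(1)[OF test_fun_cmult[OF assms(1)]]
  have "AE x in \<mu>. T (\<lambda>y. c * f y) x = c * T f x"
    using T_bound test_L2[OF assms(1)] unfolding Lp_operator_bound_def by auto
  then have "form (\<lambda>x. c * f x) g = (\<integral>x. c * (T f x * g x) \<partial>\<mu>)"
    unfolding form_def by (intro integral_cong_AE; measurable?) auto
  then show ?thesis unfolding form_def by simp
qed

lemma form_zero_left:
  assumes "test_fun g" shows "form (\<lambda>x. 0) g = 0"
  using form_cmult_left[OF test_fun_zero assms, of 0] by simp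

lemma form_sum_left:
  assumes "finite I" "\<And>i. i \<in> I \<Longrightarrow> test_fun (f i)" "test_fun g"
  shows "form (\<lambda>x. \<Sum>i\<in>I. f i x) g = (\<Sum>i\<in>I. form (f i) g)"
  using assms by (induction I rule: finite_induct) (auto simp: form_zero_left form_add_left test_fun_sum)

lemma form_add_right:
  assumes "test_fun f" "test_fun g1" "test_fun g2"
  shows "form f (\<lambda>x. g1 x + g2 x) = form f g1 + form f g2"
  unfolding form_def distrib_left using assms
  by (intro Bochner_Integration.integral_add form_integrable_bound) auto

lemma restr_split: "(\<lambda>x. restr E f x + restr (- E) f x) = f"
  by (auto simp: restr_def indicator_def)

lemma form_split_right:
  assumes "test_fun f" "test_fun g" "E \<in> sets borel"
  shows "form f g = form f (restr E g) + form f (restr (- E) g)"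
  using form_add_right[of f "restr E g" "restr (- E) g"] assms by (simp add: test_fun_restr restr_split)

lemma form_split_left:
  assumes "test_fun f" "test_fun g" "E \<in> sets borel"
  shows "form f g = form (restr E f) g + form (restr (- E) f) g"
  using form_add_left[of "restr E f" "restr (- E) f" g] assms by (simp add: test_fun_restr restr_split)

lemma T_eq_Kint:
  assumes f: "test_fun f" and "d > 0"
  shows "AE x in \<mu>. (\<forall>y \<in> ball x d. f y = 0) \<longrightarrow> T f x = Kint f x"
proof -
  have "AE x in \<mu>. x \<notin> closed_support \<mu> f \<longrightarrow> T f x = Kint f x"
    using CZ_T test_L2[OF f] unfolding CZ_operator_def Kint_def by auto
  then show ?thesis
  proof eventually_elim
    case (elim x)
    have "x \<notin> closed_support \<mu> f" if "\<forall>y\<in>ball x d. f y = 0"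
      unfolding closed_support_def using that \<open>d > 0\<close> by (auto intro!: exI[of _ "ball x d"])
    then show ?case using elim by blast
  qed
qed

text \<open>For supports at positive distance the adjoint acts through the transposed kernel: K is
  at most 1/d where the integrand is nonzero, so Fubini's theorem applies.\<close>

lemma form_eq_Kint:
  assumes f: "test_fun f" and g: "test_fun g" and "d > 0"
    and sep: "\<And>x y. f y \<noteq> 0 \<Longrightarrow> g x \<noteq> 0 \<Longrightarrow> dist x y \<ge> d"
  shows "form f g = (\<integral>y. f y * tr.Kint g y \<partial>\<mu>)"
proof -
  note [measurable] = test_fun_measurable[OF f] test_fun_measurable[OF g] T_L2(1)[OF f] Kint_measurable[OF f]
  interpret P: pair_sigma_finite \<mu> \<mu> ..
  define F where "F x y = K x y * f y * g x" for x y
  obtain Cf where Cf: "Cf > 0" "\<And>x. norm (f x) \<le> Cf" using test_fun_bound[OF f] by blast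
  obtain Cg where Cg: "Cg > 0" "\<And>x. norm (g x) \<le> Cg" using test_fun_bound[OF g] by blast
  obtain rf where rf: "rf > 0" "\<And>x. f x \<noteq> 0 \<Longrightarrow> x \<in> ball 0 rf" using test_fun_support[OF f] by blast
  obtain rg where rg: "rg > 0" "\<And>x. g x \<noteq> 0 \<Longrightarrow> x \<in> ball 0 rg" using test_fun_support[OF g] by blast
  have Fb: "norm (F x y) \<le> 1 / d * Cf * Cg" for x y
  proof (cases "f y = 0 \<or> g x = 0")
    case True
    then show ?thesis using \<open>d > 0\<close> Cf(1) Cg(1) unfolding F_def by auto
  next
    case False
    then have "norm (K x y) \<le> 1 / d" using norm_K_le[OF \<open>d > 0\<close> sep] by auto
    then show ?thesis
      unfolding F_def norm_mult using Cf Cg \<open>d > 0\<close> by (intro mult_mono) auto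
  qed
  have "(\<lambda>p. K (fst p) (snd p)) \<in> borel_measurable (\<mu> \<Otimes>\<^sub>M \<mu>)"
    using K_measurable by (simp cong: measurable_cong_sets sets_pair_measure_cong)
  then have Fm: "case_prod F \<in> borel_measurable (\<mu> \<Otimes>\<^sub>M \<mu>)"
    unfolding F_def case_prod_beta' by measurable
  have "integrable (\<mu> \<Otimes>\<^sub>M \<mu>) (case_prod F)"
  proof (rule integrableI_bounded_set[where A = "ball 0 rg \<times> ball 0 rf" and B = "1 / d * Cf * Cg"])
    have "emeasure (\<mu> \<Otimes>\<^sub>M \<mu>) (ball 0 rg \<times> ball 0 rf) = emeasure \<mu> (ball 0 rg) * emeasure \<mu> (ball 0 rf)"
      by (rule emeasure_pair_measure_Times) auto
    also have "\<dots> < \<infinity>"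
      using emeasure_bounded_finite[of "ball 0 rg"] emeasure_bounded_finite[of "ball 0 rf"] by (simp add: ennreal_mult_less_top)
    finally show "emeasure (\<mu> \<Otimes>\<^sub>M \<mu>) (ball 0 rg \<times> ball 0 rf) < \<infinity>" .
    show "AE p \<in> ball 0 rg \<times> ball 0 rf in \<mu> \<Otimes>\<^sub>M \<mu>. norm (case p of (x, y) \<Rightarrow> F x y) \<le> 1 / d * Cf * Cg"
      using Fb by auto
    show "AE p in \<mu> \<Otimes>\<^sub>M \<mu>. p \<notin> ball 0 rg \<times> ball 0 rf \<longrightarrow> (case p of (x, y) \<Rightarrow> F x y) = 0"
      using rf(2) rg(2) unfolding F_def by (intro AE_I2) auto
  qed (use Fm in auto)
  from P.Fubini_integral[OF this] have fub: "(\<integral>y. (\<integral>x. F x y \<partial>\<mu>) \<partial>\<mu>) = (\<integral>x. (\<integral>y. F x y \<partial>\<mu>) \<partial>\<mu>)" .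
  have "form f g = (\<integral>x. Kint f x * g x \<partial>\<mu>)"
    unfolding form_def
  proof (rule integral_cong_AE)
    have "AE x in \<mu>. (\<forall>y \<in> ball x d. f y = 0) \<longrightarrow> T f x = Kint f x"
      by (rule T_eq_Kint[OF f \<open>d > 0\<close>])
    then show "AE x in \<mu>. T f x * g x = Kint f x * g x"
    proof eventually_elim
      case (elim x)
      have "\<forall>y \<in> ball x d. f y = 0" if "g x \<noteq> 0" using sep[OF _ that] by force
      then show ?case using elim by auto
    qed
  qed measurable
  also have "\<dots> = (\<integral>x. (\<integral>y. F x y \<partial>\<mu>) \<partial>\<mu>)"
    unfolding Kint_def F_def by simp
  also have "\<dots> = (\<integral>y. (\<integral>x. F x y \<partial>\<mu>) \<partial>\<mu>)" by (rule fub[symmetric])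
  also have "\<dots> = (\<integral>y. f y * tr.Kint g y \<partial>\<mu>)"
  proof (rule Bochner_Integration.integral_cong[OF refl])
    fix y
    have "(\<integral>x. F x y \<partial>\<mu>) = (\<integral>x. f y * (K x y * g x) \<partial>\<mu>)" unfolding F_def by (simp add: mult_ac)
    then show "(\<integral>x. F x y \<partial>\<mu>) = f y * tr.Kint g y" unfolding tr.Kint_def by simp
  qed
  finally show ?thesis .
qed

section \<open>Doubling balls on which the adjoint has a large average\<close>

definition bad_balls :: "real \<Rightarrow> (complex \<Rightarrow> complex) \<Rightarrow> (complex \<times> real) set" where
  "bad_balls a h = {p. doubling (fst p) (snd p) \<and>
     norm (form (indicator (ball (fst p) (snd p))) h) > a * measure \<mu> (ball (fst p) (snd p))}"

text \<open>Contains the set where the maximal function over doubling balls of the adjoint of \<open>T\<close>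
  applied to \<open>h\<close> exceeds \<open>a\<close>.\<close>

definition bad_set :: "real \<Rightarrow> (complex \<Rightarrow> complex) \<Rightarrow> complex set" where
  "bad_set a h = (\<Union>p\<in>bad_balls a h. ball (fst p) (snd p))"

lemma open_bad_set: "open (bad_set a h)"
  unfolding bad_set_def by auto

text \<open>A Chebyshev estimate by duality. Let m be the measure of a disjoint Vitali subfamily and
  f the sum of its indicators with suitable phases. Then a m \<le> |form f h| \<le> N sqrt(m)
  sqrt(\<mu>(E)), hence m \<le> N^2 \<mu>(E) / a^2. Tripling the balls costs the doubling factor
  81.\<close>

lemma finite_bad_balls_measure:
  assumes h: "test_fun h" "\<And>x. norm (h x) \<le> 1" "\<And>x. x \<notin> E \<Longrightarrow> h x = 0" "bounded E" "E \<in> sets borel"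
    and "a > 0" and P: "finite P" "P \<subseteq> bad_balls a h"
  shows "measure \<mu> (\<Union>p\<in>P. ball (fst p) (snd p)) \<le> 81 * N\<^sup>2 / a\<^sup>2 * measure \<mu> E"
proof -
  let ?B = "\<lambda>p :: complex \<times> real. ball (fst p) (snd p)"
  have pos: "snd p > 0" if "p \<in> P" for p
    using that P(2) unfolding bad_balls_def doubling_def by auto
  obtain J where J: "J \<subseteq> P" "disjoint_family_on ?B J" "(\<Union>p\<in>P. ?B p) \<subseteq> (\<Union>p\<in>J. ball (fst p) (3 * snd p))"
    using Vitali_covering_finite[OF P(1), of snd fst] pos by blast
  have finJ: "finite J" using J(1) P(1) finite_subset by blast
  define V where "V = (\<Union>p\<in>J. ?B p)"
  have V: "bounded V" "V \<in> sets borel" unfolding V_def using finJ by auto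
  define m where "m = measure \<mu> V"
  have m: "m = (\<Sum>p\<in>J. measure \<mu> (?B p))"
    unfolding m_def V_def using emeasure_bounded_finite[of "ball _ _"]
    by (intro measure_finite_Union finJ J(2)) (auto simp: less_top)
  \<comment> \<open>These phases turn \<open>form f h\<close> into a sum of absolute values. If the
    form vanishes, \<open>s p\<close> is 0 by the convention for division, which does no
    harm.\<close>
  define s where "s p = cnj (form (indicator (?B p)) h) / norm (form (indicator (?B p)) h)" for p
  have s1: "norm (s p) \<le> 1" for p unfolding s_def by (auto simp: norm_divide divide_le_eq)
  have s2: "s p * form (indicator (?B p)) h = norm (form (indicator (?B p)) h)" for p
  proof (cases "form (indicator (?B p)) h = 0")
    case False
    then show ?thesis
      unfolding s_def using complex_norm_square[of "form (indicator (?B p)) h"]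
      by (simp add: power2_eq_square mult.commute field_simps)
  qed simp
  define f where "f x = (\<Sum>p\<in>J. s p * indicator (?B p) x)" for x
  have tf: "test_fun (indicator (?B p))" for p by (rule test_fun_indicator) auto
  have f: "test_fun f" unfolding f_def[abs_def] by (intro test_fun_sum finJ test_fun_cmult tf)
  have fval: "f x = s p" if "p \<in> J" "x \<in> ?B p" for x p
  proof -
    have "f x = (\<Sum>q\<in>J. if q = p then s p else 0)"
      unfolding f_def
    proof (rule sum.cong[OF refl])
      fix q assume q: "q \<in> J"
      have "x \<notin> ?B q" if "q \<noteq> p"
        using disjoint_family_onD[OF J(2) q \<open>p \<in> J\<close> that] \<open>x \<in> ?B p\<close> by blast
      then show "s q * indicator (?B q) x = (if q = p then s p else 0)"
        using \<open>x \<in> ?B p\<close> by (cases "q = p") auto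
    qed
    then show ?thesis using finJ that by simp
  qed
  have f0: "f x = 0" if "x \<notin> V" for x
    using that unfolding f_def V_def by (intro sum.neutral) auto
  have f1: "norm (f x) \<le> 1" for x
  proof (cases "x \<in> V")
    case True then show ?thesis using fval s1 unfolding V_def by auto
  qed (simp add: f0)
  have "form f h = (\<Sum>p\<in>J. form (\<lambda>x. s p * indicator (?B p) x) h)"
    unfolding f_def[abs_def] using finJ h(1) by (intro form_sum_left test_fun_cmult tf) auto
  also have "\<dots> = of_real (\<Sum>p\<in>J. norm (form (indicator (?B p)) h))"
    using h(1) tf by (simp add: form_cmult_left s2)
  finally have "norm (form f h) = \<bar>\<Sum>p\<in>J. norm (form (indicator (?B p)) h)\<bar>"
    by (simp only: norm_of_real)
  also have "\<dots> = (\<Sum>p\<in>J. norm (form (indicator (?B p)) h))"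
    by (intro abs_of_nonneg sum_nonneg norm_ge_zero)
  finally have "norm (form f h) = (\<Sum>p\<in>J. norm (form (indicator (?B p)) h))" .
  moreover have "a * m \<le> (\<Sum>p\<in>J. norm (form (indicator (?B p)) h))"
    unfolding m sum_distrib_left using J(1) P(2) by (intro sum_mono) (force simp: bad_balls_def)
  moreover have "norm (form f h) \<le> N * 1 * sqrt m * sqrt (measure \<mu> E)"
    unfolding m_def using V f f0 f1 h by (intro form_bound_sets) auto
  ultimately have "a * m \<le> N * sqrt m * sqrt (measure \<mu> E)" by linarith
  then have "a * sqrt m * sqrt m \<le> N * sqrt (measure \<mu> E) * sqrt m"
    unfolding m_def by (simp add: mult_ac)
  then have am: "a * sqrt m \<le> N * sqrt (measure \<mu> E)"
    using N_nonneg by (cases "m > 0") (auto simp: m_def not_less zero_less_measure_iff measure_le_0_iff)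
  have "(a * sqrt m) ^ 2 \<le> (N * sqrt (measure \<mu> E)) ^ 2"
    using am \<open>a > 0\<close> by (intro power_mono) (auto simp: m_def)
  then have me: "m \<le> N\<^sup>2 / a\<^sup>2 * measure \<mu> E"
    using \<open>a > 0\<close> by (simp add: power_mult_distrib m_def field_simps)
  have "measure \<mu> (\<Union>p\<in>P. ?B p) \<le> measure \<mu> (\<Union>p\<in>J. ball (fst p) (3 * snd p))"
    by (rule measure_mono_bounded[OF J(3)]) (use P(1) finJ in auto)
  also have "\<dots> \<le> (\<Sum>p\<in>J. measure \<mu> (ball (fst p) (3 * snd p)))"
    by (rule measure_UNION_le[OF finJ]) auto
  also have "\<dots> \<le> (\<Sum>p\<in>J. 81 * measure \<mu> (?B p))"
    using J(1) P(2) by (intro sum_mono) (auto simp: bad_balls_def doubling_def)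
  also have "\<dots> = 81 * m" unfolding m by (simp add: sum_distrib_left)
  finally show ?thesis using me by simp
qed

text \<open>By the Lindelof property countably many bad balls cover the set, and continuity from
  below carries over the bound for finite unions, which does not depend on their number.\<close>

lemma emeasure_bad_set:
  assumes h: "test_fun h" "\<And>x. norm (h x) \<le> 1" "\<And>x. x \<notin> E \<Longrightarrow> h x = 0" "bounded E" "E \<in> sets borel"
    and "a > 0"
  shows "emeasure \<mu> (bad_set a h) \<le> ennreal (81 * N\<^sup>2 / a\<^sup>2 * measure \<mu> E)"
proof -
  let ?B = "\<lambda>p :: complex \<times> real. ball (fst p) (snd p)"
  obtain C where C: "C \<subseteq> ?B ` bad_balls a h" "countable C" "\<Union>C = \<Union>(?B ` bad_balls a h)"
    using Lindelof[of "?B ` bad_balls a h"] by auto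
  show ?thesis
  proof (cases "C = {}")
    case True
    then have "bad_set a h = {}" using C(3) unfolding bad_set_def by auto
    then show ?thesis by simp
  next
    case False
    define A where "A n = (\<Union>i<n. from_nat_into C i)" for n
    have Ci: "from_nat_into C i \<in> C" for i using from_nat_into[OF False] .
    have "(\<Union>n. A n) = (\<Union>i. from_nat_into C i)"
      unfolding A_def by (auto intro: lessI)
    also have "\<dots> = \<Union>C" using range_from_nat_into[OF False C(2)] by simp
    finally have "(\<Union>n. A n) = \<Union>C" .
    then have U: "(\<Union>n. A n) = bad_set a h" using C(3) unfolding bad_set_def by simp
    have inc: "incseq A"
      by (rule incseq_SucI) (auto simp: A_def lessThan_Suc)
    have "open (from_nat_into C i)" for i using Ci[of i] C(1) by (auto simp: subset_iff)
    then have op: "open (A n)" for n unfolding A_def by (intro open_UN) auto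
    have "emeasure \<mu> (A n) \<le> ennreal (81 * N\<^sup>2 / a\<^sup>2 * measure \<mu> E)" for n
    proof -
      have "\<forall>i. \<exists>p \<in> bad_balls a h. from_nat_into C i = ?B p" using Ci C(1) by blast
      then obtain p where p: "\<And>i. p i \<in> bad_balls a h" "\<And>i. from_nat_into C i = ?B (p i)" by metis
      have An: "A n = (\<Union>q\<in>p ` {..<n}. ?B q)" unfolding A_def using p(2) by auto
      have "measure \<mu> (A n) \<le> 81 * N\<^sup>2 / a\<^sup>2 * measure \<mu> E"
        unfolding An by (rule finite_bad_balls_measure[OF h \<open>a > 0\<close>]) (use p in auto)
      moreover have "bounded (A n)" unfolding An by auto
      ultimately show ?thesis by (simp add: emeasure_bounded ennreal_leI)
    qed
    then have "(SUP n. emeasure \<mu> (A n)) \<le> ennreal (81 * N\<^sup>2 / a\<^sup>2 * measure \<mu> E)"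
      by (rule SUP_least)
    moreover have "(SUP n. emeasure \<mu> (A n)) = emeasure \<mu> (\<Union>n. A n)"
      by (rule SUP_emeasure_incseq) (use op inc in auto)
    ultimately show ?thesis unfolding U by simp
  qed
qed

text \<open>The comparison with averages for the transposed kernel, with \<theta> = 1 and M = 1. As
  z lies in no bad ball, the average over B(z,R) of the adjoint applied to h is at most a. The part
  of h in B(z,3R) is removed by the L2 bound, where sqrt(m) sqrt(81 m) = 9 m; and 27/2 is 9 / (1 -
  1/3).\<close>

lemma transposed_truncation_bound:
  assumes h: "test_fun h" "\<And>x. norm (h x) \<le> 1" and "a > 0" "z \<notin> bad_set a h" "r > 0"
  shows "norm (tr.Kint (restr (- ball z r) h) z) \<le> a + 9 * N + 27 / 2 + C\<epsilon>"
proof (cases "\<forall>t. measure \<mu> (ball z t) = 0")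
  case True
  then have "AE x in \<mu>. False" by (intro AE_False_if_null_balls) auto
  then have "tr.Kint (restr (- ball z r) h) z = 0"
    unfolding tr.Kint_def by (intro integral_eq_zero_AE) auto
  then show ?thesis using \<open>a > 0\<close> N_nonneg C\<epsilon>_pos by simp
next
  case False
  then obtain t where "measure \<mu> (ball z t) > 0" by (auto simp: zero_less_measure_iff)
  then obtain k R where R_def: "R = 3 ^ k * r" and dbl: "doubling z R"
    and k: "\<And>j. j < k \<Longrightarrow> 81 * mu3 z r j \<le> mu3 z r (j + 2)"
    using exists_doubling_ball[OF \<open>r > 0\<close>] by metis
  define m where "m = measure \<mu> (ball z R)"
  have R: "R > 0" and m: "m > 0" and m3: "measure \<mu> (ball z (3 * R)) \<le> 81 * m"
    using dbl unfolding doubling_def m_def by auto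
  let ?I = "indicator (ball z R) :: complex \<Rightarrow> complex"
  have I: "test_fun ?I" by (rule test_fun_indicator) auto
  have "norm (form ?I h) \<le> a * m"
  proof (rule ccontr)
    assume "\<not> norm (form ?I h) \<le> a * m"
    then have "(z, R) \<in> bad_balls a h"
      using dbl unfolding bad_balls_def m_def by auto
    then have "z \<in> bad_set a h" unfolding bad_set_def using R by force
    then show False using assms by simp
  qed
  moreover have "norm (form ?I (restr (ball z (3 * R)) h)) \<le> 9 * N * m"
  proof -
    have "norm (form ?I (restr (ball z (3 * R)) h)) \<le> N * 1 * sqrt (measure \<mu> (ball z R)) * sqrt (measure \<mu> (ball z (3 * R)))"
      by (rule form_bound_sets[OF I])
        (use h in \<open>auto intro!: test_fun_restr order_trans[OF norm_restr_le] simp: indicator_def\<close>)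
    also have "\<dots> \<le> N * 1 * sqrt m * sqrt (81 * m)"
      unfolding m_def[symmetric] using m3 N_nonneg m by (intro mult_left_mono real_sqrt_le_mono) auto
    also have "\<dots> = 9 * N * m"
      using m by (simp add: real_sqrt_mult)
    finally show ?thesis .
  qed
  moreover have "form ?I h = form ?I (restr (ball z (3 * R)) h) + form ?I (restr (- ball z (3 * R)) h)"
    by (rule form_split_right[OF I h(1)]) auto
  ultimately have far: "norm (form ?I (restr (- ball z (3 * R)) h)) \<le> (a + 9 * N) * m"
    by (smt (verit) distrib_right add_diff_cancel_left' norm_triangle_ineq4)
  have "form ?I (restr (- ball z (3 * R)) h) = (\<integral>y. ?I y * tr.Kint (restr (- ball z (3 * R)) h) y \<partial>\<mu>)"
  proof (rule form_eq_Kint[OF I])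
    show "test_fun (restr (- ball z (3 * R)) h)" using h by (intro test_fun_restr) auto
    fix x y assume "?I y \<noteq> 0" "restr (- ball z (3 * R)) h x \<noteq> 0"
    then have "dist z y < R" "dist z x \<ge> 3 * R" by (auto simp: restr_def indicator_def split: if_splits)
    then show "dist x y \<ge> R" using dist_triangle[of z x y] R by (simp add: dist_commute)
  qed (use R in auto)
  moreover have "norm (tr.Kint (restr (- ball z r) h) z) * m
     \<le> norm (\<integral>y. ?I y * tr.Kint (restr (- ball z (3 * R)) h) y \<partial>\<mu>) + (9 / (1 - 3 powr -1) + C\<epsilon>) * 1 * m"
    unfolding m_def
  proof (rule tr.Kint_le_average[OF h(1) \<open>r > 0\<close> _ _ _ k R_def])
    show "(\<integral>\<^sup>+y\<in>ball z t. ennreal (norm (h y)) \<partial>\<mu>) \<le> ennreal (1 * t powr (1 - 1) * measure \<mu> (ball z t) powr 1)"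
      if "t > 0" for t using nn_integral_ball_le[of h z t, OF h(2)] that by simp
  qed auto
  ultimately have "norm (tr.Kint (restr (- ball z r) h) z) * m \<le> (a + 9 * N + 27 / 2 + C\<epsilon>) * m"
    using far by (simp add: powr_minus algebra_simps)
  then show ?thesis using m by simp
qed

end

section \<open>Whitney pieces and the good-\<open>\<lambda>\<close> step\<close>

definition grid :: "real \<Rightarrow> complex \<Rightarrow> int \<times> int" where
  "grid \<delta> z = (\<lfloor>Re z / \<delta>\<rfloor>, \<lfloor>Im z / \<delta>\<rfloor>)"

definition grid_nbrs :: "int \<times> int \<Rightarrow> (int \<times> int) set" where
  "grid_nbrs p = {fst p - 4..fst p + 4} \<times> {snd p - 4..snd p + 4}"

lemma finite_grid_nbrs: "finite (grid_nbrs p)" and card_grid_nbrs: "card (grid_nbrs p) = 81"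
  unfolding grid_nbrs_def by (auto simp: card_cartesian_product)

lemma grid_eq_imp_dist_le:
  assumes "\<delta> > 0" "grid \<delta> z = grid \<delta> w"
  shows "dist z w \<le> 2 * \<delta>"
proof -
  have *: "\<bar>a - b\<bar> \<le> \<delta>" if "\<lfloor>a / \<delta>\<rfloor> = \<lfloor>b / \<delta>\<rfloor>" for a b :: real
  proof -
    have "\<bar>a / \<delta> - b / \<delta>\<bar> \<le> 1" using that by linarith
    then have "\<bar>(a - b) / \<delta>\<bar> \<le> 1" by (simp add: diff_divide_distrib)
    then show ?thesis using assms(1) by (simp add: abs_divide)
  qed
  have "dist z w \<le> \<bar>Re (z - w)\<bar> + \<bar>Im (z - w)\<bar>" unfolding dist_norm by (rule cmod_le)
  moreover have "\<bar>Re z - Re w\<bar> \<le> \<delta>" "\<bar>Im z - Im w\<bar> \<le> \<delta>"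
    using assms(2) unfolding grid_def by (auto intro: *)
  ultimately show ?thesis by simp
qed

lemma grid_mem_nbrs:
  assumes "\<delta> > 0" "dist z w < 4 * \<delta>"
  shows "grid \<delta> w \<in> grid_nbrs (grid \<delta> z)"
proof -
  have *: "\<lfloor>b / \<delta>\<rfloor> \<in> {\<lfloor>a / \<delta>\<rfloor> - 4..\<lfloor>a / \<delta>\<rfloor> + 4}" if "\<bar>a - b\<bar> < 4 * \<delta>" for a b :: real
  proof -
    have "\<bar>(a - b) / \<delta>\<bar> < 4" using that assms(1) by (simp add: abs_divide divide_less_eq)
    then have "\<bar>a / \<delta> - b / \<delta>\<bar> < 4" by (simp add: diff_divide_distrib)
    then show ?thesis unfolding atLeastAtMost_iff by linarith
  qed
  have "\<bar>Re z - Re w\<bar> < 4 * \<delta>" "\<bar>Im z - Im w\<bar> < 4 * \<delta>"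
    using abs_Re_le_cmod[of "z - w"] abs_Im_le_cmod[of "z - w"] assms(2) unfolding dist_norm by auto
  from this[THEN *] show ?thesis unfolding grid_def grid_nbrs_def by simp
qed

text \<open>Pieces of \<open>U\<close> on which the distance to the complement lies in a dyadic interval
  \<open>[s, 2s)\<close>, cut by a square grid of side \<open>s / 8\<close>; the constant is
  \<open>243 = 3 \<cdot> 81\<close>: three scales, \<open>9 \<times> 9\<close> squares for each.\<close>

lemma Whitney_covering:
  fixes U :: "complex set"
  assumes "open U" "U \<noteq> UNIV"
  obtains c :: "nat \<Rightarrow> complex" and s :: "nat \<Rightarrow> real" and A :: "nat set" where
    "\<And>n. n \<in> A \<Longrightarrow> s n > 0" "\<And>n. n \<in> A \<Longrightarrow> ball (c n) (s n / 2) \<subseteq> U"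
    "\<And>z. z \<in> U \<Longrightarrow> \<exists>n\<in>A. dist z (c n) \<le> s n / 4 \<and> (\<exists>b\<in>-U. dist z b \<le> 2 * s n)"
    "\<And>y. finite {n\<in>A. y \<in> ball (c n) (s n / 2)}" "\<And>y. card {n\<in>A. y \<in> ball (c n) (s n / 2)} \<le> 243"
proof -
  have cl: "closed (- U)" "- U \<noteq> {}" using assms by (auto simp: closed_Compl)
  define d where "d z = infdist z (- U)" for z
  have d_pos: "d z > 0" if "z \<in> U" for z
    using that cl infdist_nonneg[of z "- U"] in_closed_iff_infdist_zero[OF cl, of z] unfolding d_def by fastforce
  have d_tri: "d z \<le> d w + dist z w" for z w unfolding d_def by (rule infdist_triangle)
  have d_notin: "w \<in> U" if "d w > 0" for w
    using that in_closed_iff_infdist_zero[OF cl, of w] unfolding d_def by fastforce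
  define k where "k z = \<lfloor>log 2 (d z)\<rfloor>" for z
  define \<sigma> where "\<sigma> z = (2::real) powr k z" for z
  have \<sigma>_pos: "\<sigma> z > 0" for z unfolding \<sigma>_def by simp
  have \<sigma>: "\<sigma> z \<le> d z" "d z < 2 * \<sigma> z" if "z \<in> U" for z
  proof -
    have "log 2 (d z) \<ge> k z" "log 2 (d z) < k z + 1" unfolding k_def by linarith+
    then have "2 powr k z \<le> d z" "d z < 2 powr (k z + 1)"
      using d_pos[OF that] by (auto simp: le_log_iff log_less_iff)
    then show "\<sigma> z \<le> d z" "d z < 2 * \<sigma> z" unfolding \<sigma>_def by (auto simp: powr_add)
  qed
  define idx where "idx z = (k z, grid (\<sigma> z / 8) z)" for z
  define rep where "rep i = inv_into U idx i" for i
  have rep: "rep i \<in> U" "idx (rep i) = i" if "i \<in> idx ` U" for i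
    using that unfolding rep_def by (auto intro: inv_into_into f_inv_into_f)
  \<comment> \<open>The centre of a piece is a chosen point of U with the same scale and grid
    square. Distances within a square are at most 2 (s/8) = s/4.\<close>
  define c where "c n = rep (from_nat n)" for n
  define s where "s n = \<sigma> (c n)" for n
  define A where "A = to_nat ` idx ` U"
  have cU: "c n \<in> U" "n = to_nat (idx (c n))" if "n \<in> A" for n
  proof -
    obtain x where "x \<in> U" "n = to_nat (idx x)" using \<open>n \<in> A\<close> unfolding A_def by blast
    then show "c n \<in> U" "n = to_nat (idx (c n))" using rep[of "idx x"] unfolding c_def by simp_all
  qed
  show ?thesis
  proof (rule that[of A s c])
    show "s n > 0" for n unfolding s_def by (rule \<sigma>_pos)
    show "ball (c n) (s n / 2) \<subseteq> U" if "n \<in> A" for n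
    proof
      fix y assume "y \<in> ball (c n) (s n / 2)"
      then have "d y > 0"
        using d_tri[of "c n" y] \<sigma>(1)[OF cU(1)[OF that]] \<sigma>_pos[of "c n"] unfolding s_def by simp
      then show "y \<in> U" by (rule d_notin)
    qed
    show "\<exists>n\<in>A. dist z (c n) \<le> s n / 4 \<and> (\<exists>b\<in>-U. dist z b \<le> 2 * s n)" if "z \<in> U" for z
    proof
      let ?n = "to_nat (idx z)"
      have i: "idx (c ?n) = idx z" unfolding c_def using rep(2)[of "idx z"] that by simp
      then have "k (c ?n) = k z" unfolding idx_def by simp
      then have sn: "s ?n = \<sigma> z" unfolding s_def \<sigma>_def by simp
      then have "grid (\<sigma> z / 8) (c ?n) = grid (\<sigma> z / 8) z" using i unfolding idx_def s_def by simp
      from grid_eq_imp_dist_le[OF _ this] \<sigma>_pos[of z] have "dist z (c ?n) \<le> s ?n / 4"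
        unfolding sn by (simp add: dist_commute)
      moreover obtain b where "b \<in> - U" "infdist z (- U) = dist z b"
        using infdist_attains_inf[OF cl, of z] by blast
      then have "\<exists>b\<in>-U. dist z b \<le> 2 * s ?n"
        using \<sigma>(2)[OF that] unfolding sn d_def by (intro bexI[of _ b]) auto
      ultimately show "dist z (c ?n) \<le> s ?n / 4 \<and> (\<exists>b\<in>-U. dist z b \<le> 2 * s ?n)" by blast
      show "?n \<in> A" unfolding A_def using that by simp
    qed
    fix y
    let ?F = "{n\<in>A. y \<in> ball (c n) (s n / 2)}"
    \<comment> \<open>If y lies in the ball about c, then d(y)/4 < \<sigma>(c) < 2 d(y), which
      leaves three exponents. The distance from y to c is less than 4 sides of the grid at that
      scale, which leaves 81 squares.\<close>
    define S where "S = (SIGMA i:{k y - 1..k y + 1}. grid_nbrs (grid (2 powr i / 8) y))"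
    have finS: "finite S" unfolding S_def by (auto intro: finite_grid_nbrs)
    have cardS: "card S = 243" unfolding S_def by (simp add: finite_grid_nbrs card_grid_nbrs)
    have sub: "?F \<subseteq> to_nat ` S"
    proof
      fix n assume "n \<in> ?F"
      then have n: "n \<in> A" "dist (c n) y < s n / 2" by auto
      let ?c = "c n"
      note cn = cU[OF n(1)]
      have y1: "d y > \<sigma> ?c / 2" using d_tri[of ?c y] \<sigma>(1)[OF cn(1)] n(2) unfolding s_def by simp
      have y2: "d y < 4 * \<sigma> ?c"
        using d_tri[of y ?c] \<sigma>(2)[OF cn(1)] n(2) \<sigma>_pos[of ?c] unfolding s_def by (simp add: dist_commute)
      have yU: "y \<in> U" using y1 \<sigma>_pos[of ?c] by (intro d_notin) linarith
      have "2 powr k y < 2 powr (k ?c + 2)"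
        using \<sigma>(1)[OF yU] y2 unfolding \<sigma>_def by (simp add: powr_add)
      then have k1: "k y < k ?c + 2" by (simp flip: of_int_add)
      have "2 powr (k ?c - 1) < (2::real) powr (k y + 1)"
        using \<sigma>(2)[OF yU] y1 unfolding \<sigma>_def by (simp add: powr_add powr_diff)
      then have k2: "k ?c - 1 < k y + 1" by (simp flip: of_int_add)
      have "grid (\<sigma> ?c / 8) ?c \<in> grid_nbrs (grid (\<sigma> ?c / 8) y)"
        using n(2) \<sigma>_pos[of ?c] unfolding s_def by (intro grid_mem_nbrs) (auto simp: dist_commute)
      then have "idx ?c \<in> S" using k1 k2 unfolding idx_def S_def \<sigma>_def by auto
      then show "n \<in> to_nat ` S" using cn(2) by blast
    qed
    show "finite ?F" by (rule finite_subset[OF sub]) (use finS in simp)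
    have "card ?F \<le> card (to_nat ` S)" by (rule card_mono) (use finS sub in auto)
    also have "\<dots> \<le> 243" using card_image_le[OF finS, of to_nat] cardS by simp
    finally show "card ?F \<le> 243" .
  qed
qed

context linear_growth begin

text \<open>The sum is the integral of the counting function of the family, which is at most m on U
  and 0 off U.\<close>

lemma sum_emeasure_overlap:
  assumes "finite J" "\<And>j. j \<in> J \<Longrightarrow> D j \<in> sets borel" "\<And>j. j \<in> J \<Longrightarrow> D j \<subseteq> U" "U \<in> sets borel"
    and "\<And>y. card {j\<in>J. y \<in> D j} \<le> m"
  shows "(\<Sum>j\<in>J. emeasure \<mu> (D j)) \<le> of_nat m * emeasure \<mu> U"
proof -
  have "(\<Sum>j\<in>J. emeasure \<mu> (D j)) = (\<Sum>j\<in>J. \<integral>\<^sup>+y. indicator (D j) y \<partial>\<mu>)"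
    using assms by (intro sum.cong) auto
  also have "\<dots> = (\<integral>\<^sup>+y. (\<Sum>j\<in>J. indicator (D j) y) \<partial>\<mu>)"
    using assms by (intro nn_integral_sum[symmetric]) (auto intro!: borel_measurable_indicator)
  also have "\<dots> \<le> (\<integral>\<^sup>+y. of_nat m * indicator U y \<partial>\<mu>)"
  proof (rule nn_integral_mono)
    fix y
    have "(\<Sum>j\<in>J. indicator (D j) y) = (\<Sum>j\<in>{j\<in>J. y \<in> D j}. 1 :: ennreal)"
      using assms(1) by (intro sum.mono_neutral_cong_right) (auto simp: indicator_def)
    also have "\<dots> = of_nat (card {j\<in>J. y \<in> D j})" by simp
    also have "\<dots> \<le> of_nat m * indicator U y"
    proof (cases "y \<in> U")
      case True then show ?thesis using assms(5)[of y] by simp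
    next
      case False
      then have "{j\<in>J. y \<in> D j} = {}" using assms(3) by auto
      then show ?thesis by (simp only: card.empty) simp
    qed
    finally show "(\<Sum>j\<in>J. indicator (D j) y) \<le> of_nat m * (indicator U y :: ennreal)" .
  qed
  also have "\<dots> = of_nat m * emeasure \<mu> U" using assms(4) by (intro nn_integral_cmult_indicator) auto
  finally show ?thesis .
qed

end

text \<open>The sum of the costs in one good-\<lambda> step: a + 9N + 27/2 + C for the local part
  with a = 200N + 1, then C + 4 for the far part, and 32 for the annulus between them, where C is
  the tail constant. The constant term 50.5 is rounded up.\<close>

definition step_const :: "real \<Rightarrow> real \<Rightarrow> real" where
  "step_const \<epsilon> N = 209 * N + 51 + 2 * tail_const \<epsilon>"

context cz_operator begin

text \<open>A pointwise bound for the maximal transposed truncation, kept as a quantified statement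
  so that it stays in the reals.\<close>

definition tr_bounded :: "(complex \<Rightarrow> complex) \<Rightarrow> real \<Rightarrow> complex \<Rightarrow> bool" where
  "tr_bounded g l z \<longleftrightarrow> (\<forall>r>0. norm (tr.Kint (restr (- ball z r) g) z) \<le> l)"

lemma tr_boundedD: "tr_bounded g l z \<Longrightarrow> r > 0 \<Longrightarrow> norm (tr.Kint (restr (- ball z r) g) z) \<le> l"
  unfolding tr_bounded_def by blast

abbreviation level_step :: real where
  "level_step \<equiv> step_const \<epsilon> N"

lemma level_step_pos: "level_step > 0"
  using N_nonneg C\<epsilon>_pos unfolding step_const_def by simp

text \<open>Moving the argument of the kernel from z to b costs the tail constant. Replacing B(z,r)
  by B(b,r) changes the domain by two sets lying between distances 3r/4 and 5r/4 from b; each costs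
  at most 5/3, rounded up to 2.\<close>

lemma far_truncation_bound:
  assumes g: "test_fun g" "\<And>x. norm (g x) \<le> 1" and b: "tr_bounded g l b" and "r > 0" "dist z b \<le> r / 4"
  shows "norm (tr.Kint (restr (- ball z r) g) z) \<le> l + C\<epsilon> + 4"
proof -
  define X where "X E = tr.Kint (restr E g) b" for E
  have "norm (tr.Kint (restr (- ball z r) g) b - tr.Kint (restr (- ball z r) g) z) \<le> C\<epsilon> * 1"
  proof (rule tr.Kint_shift[OF g(1) \<open>r > 0\<close>])
    fix t assume "r \<le> t"
    then show "(\<integral>\<^sup>+y\<in>ball z t. ennreal (norm (g y)) \<partial>\<mu>) \<le> ennreal (1 * t)"
      using \<open>r > 0\<close> by (intro nn_integral_ball_le_radius g) auto
  qed (use assms in auto)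
  then have 1: "norm (tr.Kint (restr (- ball z r) g) z) \<le> norm (X (- ball z r)) + C\<epsilon>"
    unfolding X_def using norm_triangle_ineq2[of "tr.Kint (restr (- ball z r) g) z" "tr.Kint (restr (- ball z r) g) b"]
    by (simp add: norm_minus_commute)
  define E1 where "E1 = ball b r - ball z r"
  define E2 where "E2 = ball z r - ball b r"
  define E0 where "E0 = - ball z r \<inter> - ball b r"
  have far: "dist b y \<ge> 3 / 4 * r" if "y \<in> - ball z r" for y
    using that assms(5) dist_triangle[of z y b] by (simp add: dist_commute)
  have near: "dist b y < 5 / 4 * r" if "y \<in> ball z r" for y
    using that assms(5) dist_triangle[of b y z] by (simp add: dist_commute)
  have sets: "E0 \<in> sets borel" "E1 \<in> sets borel" "E2 \<in> sets borel" unfolding E0_def E1_def E2_def by auto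
  have e1: "- ball z r = E0 \<union> E1" unfolding E0_def E1_def by auto
  have e2: "- ball b r = E0 \<union> E2" unfolding E0_def E2_def by auto
  have "X (- ball z r) = X E0 + X E1"
    unfolding X_def e1
  proof (rule tr.Kint_restr_Un[OF g(1), where d = "3 / 4 * r"])
    show "(E0 \<union> E1) \<inter> ball b (3 / 4 * r) = {}"
      unfolding e1[symmetric] using far by fastforce
  qed (use sets \<open>r > 0\<close> in \<open>auto simp: E0_def E1_def\<close>)
  moreover have "X (- ball b r) = X E0 + X E2"
    unfolding X_def e2
    by (rule tr.Kint_restr_Un[OF g(1), where d = "r"]) (use sets \<open>r > 0\<close> in \<open>auto simp: E0_def E2_def\<close>)
  moreover have "norm (X E1) \<le> (5 / 4 * r) / (3 / 4 * r)"
    unfolding X_def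
  proof (rule tr.Kint_annulus[OF g])
    show "E1 \<subseteq> ball b (5 / 4 * r) - ball b (3 / 4 * r)"
      using far \<open>r > 0\<close> unfolding E1_def by fastforce
  qed (use sets \<open>r > 0\<close> in auto)
  moreover have "norm (X E2) \<le> (5 / 4 * r) / (3 / 4 * r)"
    unfolding X_def
  proof (rule tr.Kint_annulus[OF g])
    show "E2 \<subseteq> ball b (5 / 4 * r) - ball b (3 / 4 * r)"
      using near \<open>r > 0\<close> unfolding E2_def by fastforce
  qed (use sets \<open>r > 0\<close> in auto)
  moreover have "(5 / 4 * r) / (3 / 4 * r) \<le> 2" using \<open>r > 0\<close> by (simp add: field_simps)
  moreover have "norm (X (- ball b r)) \<le> l" unfolding X_def by (rule tr_boundedD[OF b \<open>r > 0\<close>])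
  moreover have "norm (X (- ball z r)) \<le> norm (X (- ball b r)) + norm (X E1) + norm (X E2)"
    if "X (- ball z r) = X E0 + X E1" "X (- ball b r) = X E0 + X E2"
  proof -
    have "X (- ball z r) = X (- ball b r) + X E1 - X E2" using that by simp
    then show ?thesis by (metis add.assoc norm_triangle_le_diff norm_triangle_ineq add_right_mono)
  qed
  ultimately show ?thesis using 1 by linarith
qed

text \<open>Good-\<open>\<lambda>\<close> step: inside \<open>U\<close> only the local parts \<open>g 1_D\<close> on the Whitney pieces matter,
  and their \<open>L\<^sup>2\<close> bounds add up because the enlarged pieces overlap boundedly within \<open>U\<close>;
  no doubling of \<open>\<mu>\<close> is involved.\<close>

lemma good_lambda_step:
  assumes g: "test_fun g" "\<And>x. norm (g x) \<le> 1"
    and U: "open U" "bounded U" and l: "l \<ge> 0" "\<And>z. z \<notin> U \<Longrightarrow> tr_bounded g l z"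
  obtains V where "open V" "V \<subseteq> U" "measure \<mu> V \<le> measure \<mu> U / 2"
    "\<And>z. z \<notin> V \<Longrightarrow> tr_bounded g (l + level_step) z"
proof -
  have "U \<noteq> UNIV" using U(2) not_bounded_UNIV by auto
  obtain c :: "nat \<Rightarrow> complex" and s A where W: "\<And>n. n \<in> A \<Longrightarrow> s n > 0" "\<And>n. n \<in> A \<Longrightarrow> ball (c n) (s n / 2) \<subseteq> U"
    "\<And>z. z \<in> U \<Longrightarrow> \<exists>n\<in>A. dist z (c n) \<le> s n / 4 \<and> (\<exists>b\<in>-U. dist z b \<le> 2 * s n)"
    "\<And>y. finite {n\<in>A. y \<in> ball (c n) (s n / 2)}" "\<And>y. card {n\<in>A. y \<in> ball (c n) (s n / 2)} \<le> 243"
    by (rule Whitney_covering[OF U(1) \<open>U \<noteq> UNIV\<close>]) (rule that)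
  \<comment> \<open>The bad sets have total measure at most 81 (N/a)^2 times 243 \<mu>(U). This is
    at most half of \<mu>(U) once a^2 \<ge> 39366 N^2, and 200 squared is 40000; the summand 1 keeps
    a positive for N = 0.\<close>
  define a where "a = 200 * N + 1"
  have a: "a > 0" unfolding a_def using N_nonneg by simp
  define D where "D n = ball (c n) (s n / 2)" for n
  define h where "h n = restr (D n) g" for n
  have h: "test_fun (h n)" for n unfolding h_def D_def by (intro test_fun_restr g) auto
  have h1: "norm (h n x) \<le> 1" for n x unfolding h_def using norm_restr_le g(2) order_trans by blast
  define bad where "bad n = (if n \<in> A then bad_set a (h n) else {})" for n
  define V where "V = U \<inter> (\<Union>n. bad n)"
  have op: "open (bad n)" for n unfolding bad_def by (simp add: open_bad_set)
  have V: "open V" "V \<subseteq> U" unfolding V_def using U op by auto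
  define q where "q = 81 * N\<^sup>2 / a\<^sup>2"
  have q: "q \<ge> 0" unfolding q_def by simp
  have q2: "q * 243 \<le> 1 / 2"
  proof -
    have "39366 * N\<^sup>2 \<le> a\<^sup>2" unfolding a_def using N_nonneg by (simp add: power2_eq_square algebra_simps)
    then show ?thesis unfolding q_def using a by (simp add: field_simps)
  qed
  have "emeasure \<mu> V \<le> emeasure \<mu> (\<Union>n. bad n)" unfolding V_def using op by (intro emeasure_mono) auto
  also have "\<dots> \<le> (\<Sum>n. emeasure \<mu> (bad n))" using op by (intro emeasure_subadditive_countably) auto
  also have "\<dots> \<le> ennreal (measure \<mu> U / 2)"
    unfolding suminf_eq_SUP
  proof (rule SUP_least)
    fix n :: nat
    have "(\<Sum>i<n. emeasure \<mu> (bad i)) = (\<Sum>i\<in>{..<n} \<inter> A. emeasure \<mu> (bad i))"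
      by (intro sum.mono_neutral_right) (auto simp: bad_def)
    also have "\<dots> \<le> (\<Sum>i\<in>{..<n} \<inter> A. ennreal q * emeasure \<mu> (D i))"
    proof (rule sum_mono)
      fix i assume i: "i \<in> {..<n} \<inter> A"
      have "emeasure \<mu> (bad_set a (h i)) \<le> ennreal (81 * N\<^sup>2 / a\<^sup>2 * measure \<mu> (D i))"
        by (rule emeasure_bad_set[OF h h1 _ _ _ a]) (auto simp: h_def D_def)
      also have "\<dots> = ennreal q * emeasure \<mu> (D i)"
        unfolding q_def[symmetric] using q by (simp add: D_def emeasure_bounded ennreal_mult')
      finally show "emeasure \<mu> (bad i) \<le> ennreal q * emeasure \<mu> (D i)" using i unfolding bad_def by simp
    qed
    also have "\<dots> = ennreal q * (\<Sum>i\<in>{..<n} \<inter> A. emeasure \<mu> (D i))" by (simp add: sum_distrib_left)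
    also have "(\<Sum>i\<in>{..<n} \<inter> A. emeasure \<mu> (D i)) \<le> of_nat 243 * emeasure \<mu> U"
    proof (rule sum_emeasure_overlap)
      show "card {j \<in> {..<n} \<inter> A. y \<in> D j} \<le> 243" for y
        using W(5)[of y] card_mono[OF W(4)[of y], of "{j \<in> {..<n} \<inter> A. y \<in> D j}"] unfolding D_def by fastforce
    qed (use U W in \<open>auto simp: D_def\<close>)
    also have "ennreal q * (of_nat 243 * emeasure \<mu> U) = ennreal q * (ennreal 243 * ennreal (measure \<mu> U))"
      using U by (simp add: emeasure_bounded)
    also have "\<dots> = ennreal (q * (243 * measure \<mu> U))"
      using q by (simp only: ennreal_mult zero_le_numeral measure_nonneg mult_nonneg_nonneg)
    also have "\<dots> = ennreal (q * 243 * measure \<mu> U)" by (simp only: mult.assoc)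
    also have "\<dots> \<le> ennreal (measure \<mu> U / 2)"
      using mult_right_mono[OF q2, of "measure \<mu> U"] by (intro ennreal_leI) auto
    finally show "(\<Sum>i<n. emeasure \<mu> (bad i)) \<le> ennreal (measure \<mu> U / 2)"
      by (simp add: mult_left_mono)
  qed
  finally have mV: "measure \<mu> V \<le> measure \<mu> U / 2"
    using bounded_subset[OF U(2) V(2)] by (simp add: emeasure_bounded)
  have "tr_bounded g (l + level_step) z" if z: "z \<notin> V" for z
  proof (cases "z \<in> U")
    case False
    then show ?thesis using l(2)[of z] level_step_pos unfolding tr_bounded_def by force
  next
    case True
    then obtain n b where n: "n \<in> A" "dist z (c n) \<le> s n / 4" and b: "b \<in> - U" "dist z b \<le> 2 * s n"
      using W(3) by blast
    have sn: "s n > 0" by (rule W(1)[OF n(1)])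
    have tb: "tr_bounded g l b" using b l(2) by auto
    have zb: "z \<notin> bad_set a (h n)" using z True n(1) unfolding V_def bad_def by auto
    show ?thesis
      unfolding tr_bounded_def
    proof (intro allI impI)
      fix r :: real assume r: "r > 0"
      show "norm (tr.Kint (restr (- ball z r) g) z) \<le> l + level_step"
      proof (cases "r \<ge> 8 * s n")
        case True
        have "norm (tr.Kint (restr (- ball z r) g) z) \<le> l + C\<epsilon> + 4"
          by (rule far_truncation_bound[OF g tb r]) (use b True in auto)
        then show ?thesis using N_nonneg C\<epsilon>_pos unfolding step_const_def by simp
      next
        case False
        \<comment> \<open>E1 is the part in the Whitney piece, governed by the bad set of
          \<open>h n\<close>. E2 is far enough to be compared with b, as 2s is a quarter of 8s. E3
          lies between distances s/4 and 8s from z and costs the ratio 32.\<close>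
        define E1 where "E1 = - ball z r \<inter> D n"
        define E2 where "E2 = - ball z (8 * s n)"
        define E3 where "E3 = (ball z (8 * s n) - ball z r) - D n"
        have sets: "E1 \<in> sets borel" "E2 \<in> sets borel" "E3 \<in> sets borel" unfolding E1_def E2_def E3_def D_def by auto
        have Dz: "y \<in> ball z (8 * s n)" if "y \<in> D n" for y
          using that dist_triangle[of z y "c n"] n(2) sn unfolding D_def by simp
        have zD: "dist z y \<ge> s n / 4" if "y \<notin> D n" for y
          using that dist_triangle[of "c n" y z] n(2) unfolding D_def by (simp add: dist_commute)
        have e: "- ball z r = E1 \<union> (E2 \<union> E3)" using False Dz unfolding E1_def E2_def E3_def by auto
        have dj: "E1 \<inter> (E2 \<union> E3) = {}" "E2 \<inter> E3 = {}" using Dz unfolding E1_def E2_def E3_def by blast+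
        have nb: "(E1 \<union> (E2 \<union> E3)) \<inter> ball z r = {}" unfolding e[symmetric] by auto
        have "tr.Kint (restr (- ball z r) g) z = tr.Kint (restr E1 g) z + tr.Kint (restr (E2 \<union> E3) g) z"
          unfolding e by (rule tr.Kint_restr_Un[OF g(1) r dj(1)]) (use sets nb in auto)
        moreover have "tr.Kint (restr (E2 \<union> E3) g) z = tr.Kint (restr E2 g) z + tr.Kint (restr E3 g) z"
          by (rule tr.Kint_restr_Un[OF g(1) r dj(2)]) (use sets nb in auto)
        moreover have "norm (tr.Kint (restr E1 g) z) \<le> a + 9 * N + 27 / 2 + C\<epsilon>"
        proof -
          have "restr E1 g = restr (- ball z r) (h n)"
            unfolding h_def E1_def by (auto simp: restr_def indicator_def)
          then show ?thesis using transposed_truncation_bound[OF h h1 a zb r] by simp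
        qed
        moreover have "norm (tr.Kint (restr E2 g) z) \<le> l + C\<epsilon> + 4"
          unfolding E2_def by (rule far_truncation_bound[OF g tb]) (use b sn in auto)
        moreover have "norm (tr.Kint (restr E3 g) z) \<le> 8 * s n / (s n / 4)"
        proof (rule tr.Kint_annulus[OF g])
          show "E3 \<subseteq> ball z (8 * s n) - ball z (s n / 4)" using zD unfolding E3_def by force
        qed (use sets sn in auto)
        moreover have "8 * s n / (s n / 4) = 32" using sn by simp
        ultimately have "norm (tr.Kint (restr (- ball z r) g) z) \<le> (a + 9 * N + 27 / 2 + C\<epsilon>) + (l + C\<epsilon> + 4) + 32"
          by (smt (verit) norm_triangle_ineq)
        then show ?thesis unfolding step_const_def a_def by simp
      qed
    qed
  qed
  then show ?thesis using that[OF V mV] by blast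
qed

end

section \<open>Local \<open>L\<^sup>\<beta>\<close> bounds\<close>

lemma AM_GM_sqrt:
  fixes a b :: real
  assumes "a \<ge> 0" "b \<ge> 0" shows "sqrt a * sqrt b \<le> (a + b) / 2"
  using arith_geo_mean_sqrt[OF assms] by (simp add: real_sqrt_mult)

lemma grid_fibre_borel: "{x. grid \<delta> x = j} \<in> sets borel"
proof -
  have 1: "(\<lambda>x::complex. Re x / \<delta>) \<in> borel_measurable borel" "(\<lambda>x::complex. Im x / \<delta>) \<in> borel_measurable borel"
    by measurable
  have 2: "{x \<in> space borel. \<lfloor>f x\<rfloor> = a} \<in> sets borel" if "f \<in> borel_measurable borel" for f :: "complex \<Rightarrow> real" and a
    using measurable_compose[OF that measurable_real_floor] by (rule measurable_sets_Collect) simp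
  have "{x. grid \<delta> x = j} = {x \<in> space borel. \<lfloor>Re x / \<delta>\<rfloor> = fst j} \<inter> {x \<in> space borel. \<lfloor>Im x / \<delta>\<rfloor> = snd j}"
    unfolding grid_def by auto
  then show ?thesis using 2[OF 1(1)] 2[OF 1(2)] by simp
qed

lemma finite_grid_image:
  assumes "bounded F" "\<delta> > 0" shows "finite (grid \<delta> ` F)"
proof -
  obtain r where r: "\<And>x. x \<in> F \<Longrightarrow> norm x \<le> r" using assms(1) unfolding bounded_iff by blast
  have *: "\<lfloor>t / \<delta>\<rfloor> \<in> {\<lfloor>- r / \<delta>\<rfloor>..\<lfloor>r / \<delta>\<rfloor>}" if "\<bar>t\<bar> \<le> r" for t
  proof -
    have "- r / \<delta> \<le> t / \<delta>" "t / \<delta> \<le> r / \<delta>"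
      using that assms(2) by (intro divide_right_mono; simp)+
    then show ?thesis unfolding atLeastAtMost_iff by (intro conjI floor_mono)
  qed
  have "grid \<delta> ` F \<subseteq> {\<lfloor>- r / \<delta>\<rfloor>..\<lfloor>r / \<delta>\<rfloor>} \<times> {\<lfloor>- r / \<delta>\<rfloor>..\<lfloor>r / \<delta>\<rfloor>}"
    unfolding grid_def
  proof (intro image_subsetI SigmaI *)
    fix x assume "x \<in> F"
    then show "\<bar>Re x\<bar> \<le> r" "\<bar>Im x\<bar> \<le> r"
      using order_trans[OF abs_Re_le_cmod r] order_trans[OF abs_Im_le_cmod r] by blast+
  qed
  then show ?thesis by (rule finite_subset) auto
qed

section \<open>Regularity of the measure on bounded sets\<close>

context linear_growth begin

lemma sum_measure_overlap:
  assumes "finite J" "\<And>j. j \<in> J \<Longrightarrow> D j \<in> sets borel" "\<And>j. j \<in> J \<Longrightarrow> D j \<subseteq> U" "U \<in> sets borel" "bounded U"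
    and "\<And>y. card {j\<in>J. y \<in> D j} \<le> m"
  shows "(\<Sum>j\<in>J. measure \<mu> (D j)) \<le> real m * measure \<mu> U"
proof -
  have "ennreal (\<Sum>j\<in>J. measure \<mu> (D j)) = (\<Sum>j\<in>J. ennreal (measure \<mu> (D j)))" by (rule sum_ennreal[symmetric]) auto
  also have "\<dots> = (\<Sum>j\<in>J. emeasure \<mu> (D j))"
    using assms(3,5) by (intro sum.cong) (auto simp: emeasure_bounded[OF bounded_subset])
  also have "\<dots> \<le> of_nat m * emeasure \<mu> U" by (rule sum_emeasure_overlap) (use assms in auto)
  also have "\<dots> = ennreal (real m * measure \<mu> U)"
    using assms(5) by (simp add: emeasure_bounded ennreal_mult'' ennreal_of_nat_eq_real_of_nat)
  finally show ?thesis by (simp add: ennreal_le_iff)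
qed

text \<open>Inner and outer regularity are applied to a finite measure, whereas \<mu> may be
  infinite; M is \<mu> restricted to a ball that contains E.\<close>

lemma exists_finite_restriction:
  assumes "E \<in> sets borel" "bounded E"
  obtains M W where "sets M = sets borel" "open W" "bounded W" "E \<subseteq> W"
    "\<And>A. A \<in> sets borel \<Longrightarrow> emeasure M A = ennreal (measure \<mu> (W \<inter> A))"
proof -
  obtain r where r: "E \<subseteq> ball 0 r" using bounded_subset_ballD[OF assms(2), of 0] by blast
  let ?M = "density \<mu> (indicator (ball 0 r))"
  have "emeasure ?M A = ennreal (measure \<mu> (ball 0 r \<inter> A))" if "A \<in> sets borel" for A
  proof -
    have "emeasure ?M A = (\<integral>\<^sup>+x. indicator (ball 0 r) x * indicator A x \<partial>\<mu>)"
      using that by (intro emeasure_density) (auto intro!: borel_measurable_indicator)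
    also have "\<dots> = (\<integral>\<^sup>+x. indicator (ball 0 r \<inter> A) x \<partial>\<mu>)" by (simp add: indicator_inter_arith)
    also have "\<dots> = emeasure \<mu> (ball 0 r \<inter> A)" using that by (intro nn_integral_indicator) auto
    also have "bounded (ball 0 r \<inter> A)" by (rule bounded_subset[OF bounded_ball]) auto
    then have "emeasure \<mu> (ball 0 r \<inter> A) = ennreal (measure \<mu> (ball 0 r \<inter> A))" by (rule emeasure_bounded)
    finally show ?thesis .
  qed
  then show ?thesis using r by (intro that[of ?M "ball 0 r"]) auto
qed

lemma outer_approximation:
  assumes E: "E \<in> sets borel" "bounded E" and "e > 0"
  obtains V where "open V" "bounded V" "E \<subseteq> V" "measure \<mu> V \<le> measure \<mu> E + e"
proof -
  obtain M W where M: "sets M = sets borel" "open W" "bounded W" "E \<subseteq> W"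
    "\<And>A. A \<in> sets borel \<Longrightarrow> emeasure M A = ennreal (measure \<mu> (W \<inter> A))"
    by (rule exists_finite_restriction[OF E]) (rule that)
  have fin: "emeasure M (space M) \<noteq> \<infinity>"
    using M(5)[of UNIV] sets_eq_imp_space_eq[OF M(1)] by simp
  have "emeasure M E < ennreal (measure \<mu> E + e)"
    using M(4,5) E \<open>e > 0\<close> by (simp add: Int_absorb1 ennreal_lessI add_nonneg_pos)
  then have "(INF U \<in> {U. E \<subseteq> U \<and> open U}. emeasure M U) < ennreal (measure \<mu> E + e)"
    using outer_regular[OF M(1) fin E(1)] by simp
  then obtain U where U: "E \<subseteq> U" "open U" "emeasure M U < ennreal (measure \<mu> E + e)"
    unfolding INF_less_iff by auto
  have "measure \<mu> (W \<inter> U) \<le> measure \<mu> E + e"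
    using U(3) M(5)[of U] U(2) by (simp add: ennreal_less_iff del: ennreal_plus)
  moreover have "bounded (W \<inter> U)" using M(3) by (rule bounded_subset) auto
  ultimately show ?thesis using that[of "W \<inter> U"] U M by auto
qed

lemma inner_approximation:
  assumes E: "E \<in> sets borel" "bounded E" and "e > 0"
  obtains F where "compact F" "F \<subseteq> E" "measure \<mu> (E - F) \<le> e"
proof -
  obtain M W where M: "sets M = sets borel" "open W" "bounded W" "E \<subseteq> W"
    "\<And>A. A \<in> sets borel \<Longrightarrow> emeasure M A = ennreal (measure \<mu> (W \<inter> A))"
    by (rule exists_finite_restriction[OF E]) (rule that)
  have fin: "emeasure M (space M) \<noteq> \<infinity>"
    using M(5)[of UNIV] sets_eq_imp_space_eq[OF M(1)] by simp
  have diff: "measure \<mu> (E - F) = measure \<mu> E - measure \<mu> F" if "compact F" "F \<subseteq> E" for F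
    using that E by (intro measurable_measure_Diff fmeasurable_bounded) (auto simp: borel_compact)
  note main = that
  show ?thesis
  proof (rule ccontr)
    assume no: "\<not> thesis"
    have neg: "measure \<mu> F < measure \<mu> E - e" if F: "compact F" "F \<subseteq> E" for F
    proof (rule ccontr)
      assume "\<not> measure \<mu> F < measure \<mu> E - e"
      then have "measure \<mu> (E - F) \<le> e" using diff[OF F] by simp
      then show False using no main[OF F] by simp
    qed
    have "emeasure M E = (SUP F \<in> {F. F \<subseteq> E \<and> compact F}. emeasure M F)"
      by (rule inner_regular[OF M(1) fin E(1)])
    also have "\<dots> \<le> ennreal (measure \<mu> E - e)"
    proof (rule SUP_least)
      fix F assume "F \<in> {F. F \<subseteq> E \<and> compact F}"
      then have F: "compact F" "F \<subseteq> E" by auto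
      then show "emeasure M F \<le> ennreal (measure \<mu> E - e)"
        using neg[OF F] M(4,5) by (simp add: borel_compact Int_absorb1 ennreal_leI subset_trans)
    qed
    finally have "ennreal (measure \<mu> E) \<le> ennreal (measure \<mu> E - e)"
      using M(4,5) E(1) by (simp add: Int_absorb1)
    \<comment> \<open>The empty set is an admissible F. Positivity matters because
      \<open>ennreal\<close> sends negative reals to 0.\<close>
    moreover have "measure \<mu> E - e > 0" using neg[of "{}"] by simp
    ultimately show False using \<open>e > 0\<close> by simp
  qed
qed

end

text \<open>With q = 2^(-\<theta>), the sum of (i+1) q^i is 1/(1-q)^2. The numerator bounds the
  first summand: initial level 1, one level step, and the cost C + 41N of the \<open>L^1\<close>
  estimate, C being the tail constant.\<close>

definition local_const :: "real \<Rightarrow> real \<Rightarrow> real \<Rightarrow> real" where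
  "local_const \<epsilon> N \<theta> = (1 + step_const \<epsilon> N + tail_const \<epsilon> + 41 * N) / (1 - 2 powr -\<theta>)\<^sup>2"

context linear_growth begin

text \<open>The power of \<mu>(U) has a positive exponent. It is the gain that beats the linear
  growth of the levels when U is repeatedly halved in measure.\<close>

lemma integral_restr_Hoelder:
  assumes "test_fun \<psi>" "\<beta> > 1" "U \<in> sets borel" "bounded U"
  shows "(\<integral>x. norm (restr U \<psi> x) \<partial>\<mu>)
     \<le> measure \<mu> U powr (1 - 1 / \<beta>) * (\<integral>x. norm (\<psi> x) powr \<beta> \<partial>\<mu>) powr (1 / \<beta>)"
proof -
  define \<theta> where "\<theta> = 1 - 1 / \<beta>"
  have \<theta>: "\<theta> > 0" unfolding \<theta>_def using \<open>\<beta> > 1\<close> by simp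
  note [measurable] = test_fun_measurable[OF assms(1)] assms(3)
  have ind: "indicator U x powr (1 / \<theta>) = (indicator U x :: real)" for x by (simp add: indicator_def)
  have "(\<integral>x. norm (\<psi> x) * indicator U x \<partial>\<mu>)
    \<le> (\<integral>x. norm (\<psi> x) powr \<beta> \<partial>\<mu>) powr (1 / \<beta>) * (\<integral>x. indicator U x powr (1 / \<theta>) \<partial>\<mu>) powr (1 / (1 / \<theta>))"
  proof (rule Hoelder_integral(2))
    show "integrable \<mu> (\<lambda>x. norm (\<psi> x) powr \<beta>)"
      using test_fun_Lp_space[OF assms(1), of \<beta>] \<open>\<beta> > 1\<close> unfolding Lp_space_def by simp
    show "integrable \<mu> (\<lambda>x. indicator U x powr (1 / \<theta>) :: real)"
      unfolding ind using emeasure_bounded_finite[OF assms(4)] assms(3)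
      by (intro integrable_real_indicator) auto
    show "1 < 1 / \<theta>" using \<theta> \<open>\<beta> > 1\<close> unfolding \<theta>_def by (simp add: field_simps)
    show "1 / \<beta> + 1 / (1 / \<theta>) = 1" unfolding \<theta>_def by simp
  qed (use \<open>\<beta> > 1\<close> in auto)
  also have "(\<integral>x. indicator U x powr (1 / \<theta>) \<partial>\<mu>) = measure \<mu> U"
    unfolding ind using assms(3) by simp
  finally have "(\<integral>x. norm (\<psi> x) * indicator U x \<partial>\<mu>) \<le> (\<integral>x. norm (\<psi> x) powr \<beta> \<partial>\<mu>) powr (1 / \<beta>) * measure \<mu> U powr \<theta>"
    by simp
  moreover have "norm (restr U \<psi> x) = norm (\<psi> x) * indicator U x" for x
    by (cases "x \<in> U") auto
  ultimately show ?thesis unfolding \<theta>_def by (simp add: mult.commute)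
qed

end

section \<open>Pairing with g where its transposed truncations are bounded\<close>

context cz_operator begin

text \<open>The part of \<open>g\<close> near \<open>z\<close> is paired by the \<open>L\<^sup>2\<close> bound, the rest by the kernel.\<close>

lemma form_cell_bound:
  assumes f: "test_fun f" "\<And>x. norm (f x) \<le> 1" "\<And>x. x \<notin> Q \<Longrightarrow> f x = 0" and Q: "Q \<in> sets borel" "bounded Q"
    and g: "test_fun g" "\<And>x. norm (g x) \<le> 1" and z: "tr_bounded g l z"
    and "\<delta> > 0" and Qz: "\<And>y. y \<in> Q \<Longrightarrow> dist z y \<le> 2 * \<delta>" and "l \<ge> 0"
  shows "norm (form f g) \<le> (l + C\<epsilon>) * measure \<mu> Q + N * ((measure \<mu> Q + measure \<mu> (ball z (4 * \<delta>))) / 2)"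
proof -
  let ?D = "ball z (4 * \<delta>)"
  let ?g = "restr (- ?D) g"
  have tg: "test_fun ?g" using g by (intro test_fun_restr) auto
  have "form f g = form f (restr ?D g) + form f ?g" by (rule form_split_right[OF f(1) g(1)]) auto
  moreover have "norm (form f (restr ?D g)) \<le> N * ((measure \<mu> Q + measure \<mu> ?D) / 2)"
  proof -
    have "norm (form f (restr ?D g)) \<le> N * 1 * sqrt (measure \<mu> Q) * sqrt (measure \<mu> ?D)"
      by (rule form_bound_sets[OF f Q(2,1)])
        (use g in \<open>auto intro!: test_fun_restr order_trans[OF norm_restr_le]\<close>)
    also have "\<dots> = N * (sqrt (measure \<mu> Q) * sqrt (measure \<mu> ?D))" by simp
    \<comment> \<open>The arithmetic-geometric mean inequality makes the L2 bound additive, so that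
      it can be summed over the cells.\<close>
    also have "\<dots> \<le> N * ((measure \<mu> Q + measure \<mu> ?D) / 2)"
      using N_nonneg by (intro mult_left_mono AM_GM_sqrt) auto
    finally show ?thesis .
  qed
  moreover have "norm (form f ?g) \<le> (l + C\<epsilon>) * measure \<mu> Q"
  proof -
    have eq: "form f ?g = (\<integral>y. f y * tr.Kint ?g y \<partial>\<mu>)"
    proof (rule form_eq_Kint[OF f(1) tg, where d = "2 * \<delta>"])
      fix x y assume "f y \<noteq> 0" "?g x \<noteq> 0"
      then have "dist z y \<le> 2 * \<delta>" "dist z x \<ge> 4 * \<delta>" using f(3) Qz by (force simp: restr_def indicator_def)+
      then show "2 * \<delta> \<le> dist x y" using dist_triangle[of z x y] by (simp add: dist_commute)
    qed (use \<open>\<delta> > 0\<close> in auto)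
    have pt: "norm (tr.Kint ?g y) \<le> l + C\<epsilon>" if "y \<in> Q" for y
    proof -
      have "norm (tr.Kint ?g y - tr.Kint ?g z) \<le> C\<epsilon> * 1"
      proof (rule tr.Kint_shift[OF g(1)])
        fix t assume "4 * \<delta> \<le> t"
        then show "(\<integral>\<^sup>+y\<in>ball z t. ennreal (norm (g y)) \<partial>\<mu>) \<le> ennreal (1 * t)"
          using \<open>\<delta> > 0\<close> by (intro nn_integral_ball_le_radius g) auto
      qed (use Qz[OF that] \<open>\<delta> > 0\<close> in auto)
      moreover have "norm (tr.Kint ?g z) \<le> l" using tr_boundedD[OF z] \<open>\<delta> > 0\<close> by simp
      ultimately show ?thesis using norm_triangle_ineq2[of "tr.Kint ?g y" "tr.Kint ?g z"] by simp
    qed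
    have lC: "l + C\<epsilon> \<ge> 0" using \<open>l \<ge> 0\<close> C\<epsilon>_pos by simp
    have "norm (f y * tr.Kint ?g y) \<le> l + C\<epsilon>" if "y \<in> Q" for y
      using mult_mono[OF f(2) pt[OF that]] by (simp add: norm_mult)
    then show ?thesis
      unfolding eq using Q lC f(3) by (intro norm_integral_le_measure) auto
  qed
  ultimately show ?thesis using norm_triangle_le[of "form f (restr ?D g)" "form f ?g"] by simp
qed

text \<open>The cells of a fine grid meeting \<open>F\<close> have small enlargements, contained in an open set of
  almost the same measure as \<open>F\<close>; this replaces Lebesgue differentiation.\<close>

lemma form_compact_bound:
  assumes f: "test_fun f" "\<And>x. norm (f x) \<le> 1" "\<And>x. x \<notin> F \<Longrightarrow> f x = 0" and F: "compact F"
    and g: "test_fun g" "\<And>x. norm (g x) \<le> 1" and z: "\<And>z. z \<in> F \<Longrightarrow> tr_bounded g l z" and "l \<ge> 0"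
  shows "norm (form f g) \<le> (l + C\<epsilon> + 41 * N) * measure \<mu> F"
proof (rule field_le_epsilon)
  fix e :: real assume "e > 0"
  define e' where "e' = e / (41 * N + 1)"
  have e': "e' > 0" "41 * N * e' \<le> e" unfolding e'_def using \<open>e > 0\<close> N_nonneg by (auto simp: field_simps)
  have F': "F \<in> sets borel" "bounded F" using F by (auto simp: borel_compact compact_imp_bounded)
  obtain V where V: "open V" "bounded V" "F \<subseteq> V" "measure \<mu> V \<le> measure \<mu> F + e'"
    by (rule outer_approximation[OF F' e'(1)])
  obtain \<eta> where \<eta>: "\<eta> > 0" "(\<Union>x\<in>F. ball x \<eta>) \<subseteq> V"
    by (rule compact_subset_open_imp_ball_epsilon_subset[OF F V(1,3)])
  \<comment> \<open>The enlarged cells are balls of radius 4 \<delta> = \<eta> about points of F,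
    hence contained in V.\<close>
  define \<delta> where "\<delta> = \<eta> / 4"
  have \<delta>: "\<delta> > 0" "4 * \<delta> = \<eta>" unfolding \<delta>_def using \<eta> by auto
  define J where "J = grid \<delta> ` F"
  have J: "finite J" unfolding J_def by (rule finite_grid_image) (use F' \<delta> in auto)
  define rep where "rep j = inv_into F (grid \<delta>) j" for j
  have rep: "rep j \<in> F" "grid \<delta> (rep j) = j" if "j \<in> J" for j
    using that unfolding rep_def J_def by (auto intro: inv_into_into f_inv_into_f)
  define Q where "Q j = F \<inter> {x. grid \<delta> x = j}" for j
  have Q: "Q j \<in> sets borel" "bounded (Q j)" for j
    unfolding Q_def using F' grid_fibre_borel by (auto intro: bounded_subset)
  define D where "D j = ball (rep j) (4 * \<delta>)" for j
  have fsum: "f x = (\<Sum>j\<in>J. restr (Q j) f x)" for x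
  proof (cases "x \<in> F")
    case True
    have "(\<Sum>j\<in>J. restr (Q j) f x) = (\<Sum>j\<in>J. if j = grid \<delta> x then f x else 0)"
      using True by (intro sum.cong) (auto simp: Q_def restr_def indicator_def)
    also have "\<dots> = f x" using J True unfolding J_def by simp
    finally show ?thesis by simp
  next
    case False
    then have "(\<Sum>j\<in>J. restr (Q j) f x) = 0" by (intro sum.neutral) (auto simp: Q_def)
    then show ?thesis using f(3)[OF False] by simp
  qed
  have "form f g = form (\<lambda>x. \<Sum>j\<in>J. restr (Q j) f x) g" by (rule arg_cong2[OF ext[OF fsum] refl])
  also have "\<dots> = (\<Sum>j\<in>J. form (restr (Q j) f) g)"
    using J Q f g by (intro form_sum_left test_fun_restr) auto
  finally have "norm (form f g) \<le> (\<Sum>j\<in>J. norm (form (restr (Q j) f) g))" by (simp add: norm_sum)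
  also have "\<dots> \<le> (\<Sum>j\<in>J. (l + C\<epsilon>) * measure \<mu> (Q j) + N * ((measure \<mu> (Q j) + measure \<mu> (D j)) / 2))"
  proof (rule sum_mono)
    fix j assume j: "j \<in> J"
    show "norm (form (restr (Q j) f) g) \<le> (l + C\<epsilon>) * measure \<mu> (Q j) + N * ((measure \<mu> (Q j) + measure \<mu> (D j)) / 2)"
      unfolding D_def
    proof (rule form_cell_bound)
      show "test_fun (restr (Q j) f)" by (rule test_fun_restr[OF f(1) Q(1)])
      show "norm (restr (Q j) f x) \<le> 1" for x using norm_restr_le f(2) order_trans by blast
      show "dist (rep j) y \<le> 2 * \<delta>" if "y \<in> Q j" for y
        using grid_eq_imp_dist_le[OF \<delta>(1), of "rep j" y] rep(2)[OF j] that unfolding Q_def by simp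
      show "tr_bounded g l (rep j)" using z rep(1)[OF j] by simp
    qed (use Q f g \<delta> \<open>l \<ge> 0\<close> in \<open>auto intro: test_fun_restr\<close>)
  qed
  also have "\<dots> = (l + C\<epsilon> + N / 2) * (\<Sum>j\<in>J. measure \<mu> (Q j)) + N / 2 * (\<Sum>j\<in>J. measure \<mu> (D j))"
    by (simp add: sum.distrib sum_distrib_left algebra_simps add_divide_distrib)
  \<comment> \<open>The cells are disjoint, and at most 81 enlargements meet at a point; 41 N is N/2
    plus 81 N/2.\<close>
  also have "\<dots> \<le> (l + C\<epsilon> + N / 2) * (real 1 * measure \<mu> F) + N / 2 * (real 81 * measure \<mu> V)"
  proof (intro add_mono mult_left_mono sum_measure_overlap)
    fix y
    show "card {j \<in> J. y \<in> Q j} \<le> 1"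
      using card_mono[of "{grid \<delta> y}" "{j \<in> J. y \<in> Q j}"] unfolding Q_def by auto
    have "{j \<in> J. y \<in> D j} \<subseteq> grid_nbrs (grid \<delta> y)"
    proof
      fix j assume "j \<in> {j \<in> J. y \<in> D j}"
      then have "j \<in> J" "dist y (rep j) < 4 * \<delta>" unfolding D_def by (auto simp: dist_commute)
      then show "j \<in> grid_nbrs (grid \<delta> y)" using grid_mem_nbrs[OF \<delta>(1), of y "rep j"] rep(2) by simp
    qed
    then show "card {j \<in> J. y \<in> D j} \<le> 81" using card_mono[OF finite_grid_nbrs] card_grid_nbrs by metis
  next
    fix j assume "j \<in> J"
    then show "D j \<subseteq> V" using rep(1)[of j] \<eta>(2) unfolding D_def \<delta>(2) by blast
  qed (use J Q F' V \<open>l \<ge> 0\<close> C\<epsilon>_pos N_nonneg in \<open>auto simp: Q_def D_def\<close>)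
  also have "\<dots> \<le> (l + C\<epsilon> + N / 2) * (real 1 * measure \<mu> F) + N / 2 * (real 81 * (measure \<mu> F + e'))"
    using V(4) N_nonneg by (intro add_left_mono mult_left_mono) auto
  also have "\<dots> \<le> (l + C\<epsilon> + 41 * N) * measure \<mu> F + 41 * N * e'"
    using N_nonneg e'(1) by (simp add: algebra_simps)
  finally show "norm (form f g) \<le> (l + C\<epsilon> + 41 * N) * measure \<mu> F + e" using e'(2) by simp
qed

text \<open>Inner regularity reduces to compact sets. The remainder is paired by the L2 bound, which
  sees the square root of its measure; hence the tolerance d^2.\<close>

lemma form_set_bound:
  assumes f: "test_fun f" "\<And>x. norm (f x) \<le> 1" "\<And>x. x \<notin> E \<Longrightarrow> f x = 0" and E: "E \<in> sets borel" "bounded E"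
    and g: "test_fun g" "\<And>x. norm (g x) \<le> 1" and z: "\<And>z. z \<in> E \<Longrightarrow> tr_bounded g l z" and "l \<ge> 0"
  shows "norm (form f g) \<le> (l + C\<epsilon> + 41 * N) * measure \<mu> E"
proof (rule field_le_epsilon)
  fix e :: real assume "e > 0"
  obtain R where R: "R > 0" "\<And>x. g x \<noteq> 0 \<Longrightarrow> x \<in> ball 0 R" using test_fun_support[OF g(1)] by blast
  define d where "d = e / (N * sqrt (measure \<mu> (ball 0 R)) + 1)"
  have den: "N * sqrt (measure \<mu> (ball 0 R)) + 1 > 0" using N_nonneg by (simp add: add_nonneg_pos)
  have d: "d > 0" "N * sqrt (measure \<mu> (ball 0 R)) * d \<le> e"
    unfolding d_def using \<open>e > 0\<close> den N_nonneg by (auto simp: field_simps)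
  obtain F where F: "compact F" "F \<subseteq> E" "measure \<mu> (E - F) \<le> d\<^sup>2"
    by (rule inner_approximation[OF E, of "d\<^sup>2"]) (use d in auto)
  have F': "F \<in> sets borel" "bounded F" using F by (auto simp: borel_compact compact_imp_bounded)
  have r1: "norm (restr A f x) \<le> 1" for A x using norm_restr_le f(2) order_trans by blast
  have "form f g = form (restr F f) g + form (restr (- F) f) g"
    by (rule form_split_left[OF f(1) g(1) F'(1)])
  moreover have "norm (form (restr F f) g) \<le> (l + C\<epsilon> + 41 * N) * measure \<mu> F"
    by (rule form_compact_bound) (use f g F F' z r1 \<open>l \<ge> 0\<close> in \<open>auto intro: test_fun_restr\<close>)
  moreover have "measure \<mu> F \<le> measure \<mu> E" using F F' E by (intro measure_mono_bounded) auto
  then have "(l + C\<epsilon> + 41 * N) * measure \<mu> F \<le> (l + C\<epsilon> + 41 * N) * measure \<mu> E"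
    using \<open>l \<ge> 0\<close> C\<epsilon>_pos N_nonneg by (intro mult_left_mono) auto
  moreover have "norm (form (restr (- F) f) g) \<le> e"
  proof -
    have "norm (form (restr (- F) f) g) \<le> N * 1 * sqrt (measure \<mu> (E - F)) * sqrt (measure \<mu> (ball 0 R))"
    proof (rule form_bound_sets)
      show "restr (- F) f x = 0" if "x \<notin> E - F" for x using that f(3)[of x] by (cases "x \<in> F") (auto simp: restr_def)
      show "bounded (E - F)" using E(2) by (rule bounded_subset) auto
    qed (use f g F' E R r1 in \<open>auto intro: test_fun_restr\<close>)
    also have "\<dots> \<le> N * 1 * d * sqrt (measure \<mu> (ball 0 R))"
      using real_sqrt_le_mono[OF F(3)] d N_nonneg by (intro mult_right_mono mult_left_mono) auto
    finally show ?thesis using d(2) by (simp add: mult_ac)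
  qed
  ultimately show "norm (form f g) \<le> (l + C\<epsilon> + 41 * N) * measure \<mu> E + e"
    using norm_triangle_le[of "form (restr F f) g" "form (restr (- F) f) g"] by simp
qed

text \<open>Cut f into layers on which |f| lies between j \<eta> and (j+1) \<eta>, divide each by
  (j+1) \<eta>, and apply the bound for functions of modulus at most 1. The resulting sum exceeds
  the integral of |f| by at most \<eta> \<mu>(E).\<close>

lemma form_L1_bound:
  assumes f: "test_fun f" "\<And>x. x \<notin> E \<Longrightarrow> f x = 0" and E: "E \<in> sets borel" "bounded E"
    and g: "test_fun g" "\<And>x. norm (g x) \<le> 1" and z: "\<And>z. z \<in> E \<Longrightarrow> tr_bounded g l z" and "l \<ge> 0"
  shows "norm (form f g) \<le> (l + C\<epsilon> + 41 * N) * (\<integral>x. norm (f x) \<partial>\<mu>)"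
proof (rule field_le_epsilon)
  fix e :: real assume "e > 0"
  define \<Lambda> where "\<Lambda> = l + C\<epsilon> + 41 * N"
  have \<Lambda>: "\<Lambda> > 0" unfolding \<Lambda>_def using \<open>l \<ge> 0\<close> C\<epsilon>_pos N_nonneg by simp
  define \<eta> where "\<eta> = e / (\<Lambda> * measure \<mu> E + 1)"
  have den: "\<Lambda> * measure \<mu> E + 1 > 0" using \<Lambda> by (simp add: add_nonneg_pos)
  have \<eta>: "\<eta> > 0" "\<Lambda> * (\<eta> * measure \<mu> E) \<le> e"
    unfolding \<eta>_def using \<open>e > 0\<close> den by (auto simp: field_simps)
  obtain c where c: "c > 0" "\<And>x. norm (f x) \<le> c" using test_fun_bound[OF f(1)] by blast
  define lev where "lev x = nat \<lfloor>norm (f x) / \<eta>\<rfloor>" for x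
  have lev: "real (lev x) * \<eta> \<le> norm (f x)" "norm (f x) \<le> (real (lev x) + 1) * \<eta>" for x
  proof -
    have "norm (f x) / \<eta> \<ge> 0" using \<eta> by simp
    then have "real (lev x) \<le> norm (f x) / \<eta>" "norm (f x) / \<eta> \<le> real (lev x) + 1" unfolding lev_def by linarith+
    then show "real (lev x) * \<eta> \<le> norm (f x)" "norm (f x) \<le> (real (lev x) + 1) * \<eta>"
      using \<eta>(1) by (auto simp: field_simps)
  qed
  define n where "n = Suc (nat \<lfloor>c / \<eta>\<rfloor>)"
  have levn: "lev x < n" for x
    unfolding lev_def n_def using c(2)[of x] \<eta>(1) by (auto intro!: le_imp_less_Suc nat_mono floor_mono divide_right_mono)
  define L where "L j = E \<inter> {x. lev x = j}" for j
  note [measurable] = test_fun_measurable[OF f(1)]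
  have "{x \<in> space borel. lev x = j} \<in> sets borel" for j unfolding lev_def by measurable
  then have L: "L j \<in> sets borel" "bounded (L j)" for j
    unfolding L_def using E by (auto intro: bounded_subset)
  have fsum: "f x = (\<Sum>j<n. restr (L j) f x)" for x
  proof (cases "x \<in> E")
    case True
    have "(\<Sum>j<n. restr (L j) f x) = (\<Sum>j<n. if j = lev x then f x else 0)"
      using True by (intro sum.cong) (auto simp: L_def restr_def indicator_def)
    also have "\<dots> = f x" using levn[of x] by simp
    finally show ?thesis by simp
  next
    case False
    then have "(\<Sum>j<n. restr (L j) f x) = 0" by (intro sum.neutral) (auto simp: L_def)
    then show ?thesis using f(2)[OF False] by simp
  qed
  have "form f g = form (\<lambda>x. \<Sum>j<n. restr (L j) f x) g" by (rule arg_cong2[OF ext[OF fsum] refl])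
  also have "\<dots> = (\<Sum>j<n. form (restr (L j) f) g)"
    using L f g by (intro form_sum_left test_fun_restr) auto
  finally have "norm (form f g) \<le> (\<Sum>j<n. norm (form (restr (L j) f) g))" by (simp add: norm_sum)
  also have "\<dots> \<le> (\<Sum>j<n. (real j + 1) * \<eta> * (\<Lambda> * measure \<mu> (L j)))"
  proof (rule sum_mono)
    fix j assume "j \<in> {..<n}"
    define t where "t = (real j + 1) * \<eta>"
    have t: "t > 0" unfolding t_def using \<eta> by simp
    define h where "h = (\<lambda>x. of_real (1 / t) * restr (L j) f x)"
    have h: "test_fun h" unfolding h_def using f L by (intro test_fun_cmult test_fun_restr) auto
    have "norm (form h g) \<le> \<Lambda> * measure \<mu> (L j)"
      unfolding \<Lambda>_def
    proof (rule form_set_bound[OF h])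
      show "norm (h x) \<le> 1" for x
      proof (cases "x \<in> L j")
        case True
        then have "norm (f x) \<le> t" using lev(2)[of x] unfolding L_def t_def by simp
        then show ?thesis using True t unfolding h_def by (simp add: norm_mult norm_divide)
      qed (simp add: h_def)
      show "tr_bounded g l z" if "z \<in> L j" for z using z that unfolding L_def by simp
    qed (use L g \<open>l \<ge> 0\<close> in \<open>auto simp: h_def\<close>)
    moreover have "restr (L j) f = (\<lambda>x. of_real t * h x)" unfolding h_def using t by (auto simp: fun_eq_iff)
    then have "form (restr (L j) f) g = of_real t * form h g" using form_cmult_left[OF h g(1)] by simp
    ultimately show "norm (form (restr (L j) f) g) \<le> (real j + 1) * \<eta> * (\<Lambda> * measure \<mu> (L j))"
      using t unfolding t_def[symmetric] by (simp add: norm_mult mult_left_mono)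
  qed
  also have "\<dots> = \<Lambda> * ((\<Sum>j<n. real j * \<eta> * measure \<mu> (L j)) + \<eta> * (\<Sum>j<n. measure \<mu> (L j)))"
    by (simp add: sum.distrib sum_distrib_left algebra_simps)
  also have "\<dots> \<le> \<Lambda> * ((\<integral>x. norm (f x) \<partial>\<mu>) + \<eta> * (real 1 * measure \<mu> E))"
  proof (intro mult_left_mono add_mono sum_measure_overlap)
    show "card {j \<in> {..<n}. y \<in> L j} \<le> 1" for y
      using card_mono[of "{lev y}" "{j \<in> {..<n}. y \<in> L j}"] unfolding L_def by auto
    have i: "integrable \<mu> (\<lambda>x. real j * \<eta> * indicator (L j) x)" for j
      using L emeasure_bounded_finite[OF L(2)] by (intro integrable_mult_right integrable_real_indicator) auto
    have "(\<Sum>j<n. real j * \<eta> * measure \<mu> (L j)) = (\<Sum>j<n. \<integral>x. real j * \<eta> * indicator (L j) x \<partial>\<mu>)"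
      using L by (intro sum.cong) auto
    also have "\<dots> = (\<integral>x. (\<Sum>j<n. real j * \<eta> * indicator (L j) x) \<partial>\<mu>)"
      using i by (intro Bochner_Integration.integral_sum[symmetric]) auto
    also have "\<dots> \<le> (\<integral>x. norm (f x) \<partial>\<mu>)"
    proof (rule integral_mono)
      show "integrable \<mu> (\<lambda>x. \<Sum>j<n. real j * \<eta> * indicator (L j) x)"
        by (intro Bochner_Integration.integrable_sum i)
      show "integrable \<mu> (\<lambda>x. norm (f x))" using integrable_test[OF f(1)] by (rule integrable_norm)
      fix x
      have "(\<Sum>j<n. real j * \<eta> * indicator (L j) x) = (\<Sum>j<n. if j = lev x then real (lev x) * \<eta> * indicator E x else 0)"
        by (intro sum.cong) (auto simp: L_def indicator_def)
      also have "\<dots> \<le> norm (f x)" using levn[of x] lev(1)[of x] by (simp add: indicator_def)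
      finally show "(\<Sum>j<n. real j * \<eta> * indicator (L j) x) \<le> norm (f x)" .
    qed
    finally show "(\<Sum>j<n. real j * \<eta> * measure \<mu> (L j)) \<le> (\<integral>x. norm (f x) \<partial>\<mu>)" .
  qed (use L E \<Lambda> \<eta> in \<open>auto simp: L_def\<close>)
  also have "\<dots> \<le> \<Lambda> * (\<integral>x. norm (f x) \<partial>\<mu>) + e" using \<eta>(2) by (simp add: algebra_simps)
  finally show "norm (form f g) \<le> (l + C\<epsilon> + 41 * N) * (\<integral>x. norm (f x) \<partial>\<mu>) + e" unfolding \<Lambda>_def .
qed

text \<open>One good-\<lambda> step splits U into V, of half the measure, and U - V, where the
  transposed truncations of g are at most l + \<open>level_step\<close>. There the
  \<open>L^1\<close> bound and hypothesis \<open>H\<close> apply; on V the argument is repeated at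
  the raised level, which is why U and l are generalised. The last term is the L2 bound on the set
  left after n steps, the only place where the bound c on \<psi> enters.\<close>

lemma form_iteration:
  assumes g: "test_fun g" "\<And>x. norm (g x) \<le> 1" "\<And>x. x \<notin> D \<Longrightarrow> g x = 0" "bounded D" "D \<in> sets borel"
    and \<psi>: "test_fun \<psi>" "\<And>x. norm (\<psi> x) \<le> c" and "\<theta> > 0" "A \<ge> 0"
    and H: "\<And>U. open U \<Longrightarrow> bounded U \<Longrightarrow> (\<integral>x. norm (restr U \<psi> x) \<partial>\<mu>) \<le> measure \<mu> U powr \<theta> * A"
  shows "open U \<Longrightarrow> bounded U \<Longrightarrow> l \<ge> 0 \<Longrightarrow> (\<And>z. z \<notin> U \<Longrightarrow> tr_bounded g l z) \<Longrightarrow>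
    norm (form (restr U \<psi>) g) \<le>
      (\<Sum>i<n. (l + (real i + 1) * level_step + C\<epsilon> + 41 * N) * (measure \<mu> U powr \<theta> * (2 powr -\<theta>) ^ i * A))
      + N * c * sqrt (measure \<mu> U * (1 / 2) ^ n) * sqrt (measure \<mu> D)"
proof (induction n arbitrary: U l)
  case 0
  have "norm (form (restr U \<psi>) g) \<le> N * c * sqrt (measure \<mu> U) * sqrt (measure \<mu> D)"
    by (rule form_bound_sets) (use g \<psi> 0 in \<open>auto intro: test_fun_restr order_trans[OF norm_restr_le]\<close>)
  then show ?case by simp
next
  case (Suc n)
  have c: "c \<ge> 0" using \<psi>(2)[of 0] norm_ge_zero order_trans by blast
  obtain V where V: "open V" "V \<subseteq> U" "measure \<mu> V \<le> measure \<mu> U / 2"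
    "\<And>z. z \<notin> V \<Longrightarrow> tr_bounded g (l + level_step) z"
    by (rule good_lambda_step[OF g(1,2) Suc.prems]) (assumption | rule that)+
  have bV: "bounded V" using V(2) Suc.prems(2) bounded_subset by blast
  define P where "P = measure \<mu> U powr \<theta> * A"
  define \<Lambda> where "\<Lambda> = C\<epsilon> + 41 * N"
  have \<Lambda>: "\<Lambda> \<ge> 0" unfolding \<Lambda>_def using C\<epsilon>_pos N_nonneg by simp
  have P: "P \<ge> 0" unfolding P_def using \<open>A \<ge> 0\<close> by simp
  have tU: "test_fun (restr U \<psi>)" using \<psi> Suc.prems by (intro test_fun_restr) auto
  have "form (restr U \<psi>) g = form (restr V (restr U \<psi>)) g + form (restr (- V) (restr U \<psi>)) g"
    using V by (intro form_split_left[OF tU g(1)]) auto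
  also have "restr V (restr U \<psi>) = restr V \<psi>" using V(2) by (auto simp: restr_def indicator_def fun_eq_iff)
  finally have split: "form (restr U \<psi>) g = form (restr V \<psi>) g + form (restr (- V) (restr U \<psi>)) g" .
  have "norm (form (restr (- V) (restr U \<psi>)) g) \<le> ((l + level_step) + C\<epsilon> + 41 * N) * (\<integral>x. norm (restr (- V) (restr U \<psi>) x) \<partial>\<mu>)"
  proof (rule form_L1_bound[where E = "U - V"])
    show "restr (- V) (restr U \<psi>) x = 0" if "x \<notin> U - V" for x using that by (auto simp: restr_def)
    show "bounded (U - V)" using Suc.prems(2) by (rule bounded_subset) auto
  qed (use tU V Suc.prems g level_step_pos in \<open>auto intro: test_fun_restr\<close>)
  also have "\<dots> \<le> ((l + level_step) + C\<epsilon> + 41 * N) * P"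
  proof (rule mult_left_mono)
    \<comment> \<open>Enlarging U - V to U is affordable, since \<mu>(U) is already small at later
      stages.\<close>
    have "(\<integral>x. norm (restr (- V) (restr U \<psi>) x) \<partial>\<mu>) \<le> (\<integral>x. norm (restr U \<psi> x) \<partial>\<mu>)"
      using tU V \<psi>(1) Suc.prems(1) by (intro integral_mono integrable_norm integrable_test test_fun_restr norm_restr_le) auto
    also have "\<dots> \<le> P" unfolding P_def using H Suc.prems by blast
    finally show "(\<integral>x. norm (restr (- V) (restr U \<psi>) x) \<partial>\<mu>) \<le> P" .
  qed (use level_step_pos Suc.prems(3) C\<epsilon>_pos N_nonneg in simp)
  finally have 1: "norm (form (restr (- V) (restr U \<psi>)) g) \<le> (l + level_step + \<Lambda>) * P"
    unfolding \<Lambda>_def by (simp only: add.assoc)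
  have VU: "measure \<mu> V powr \<theta> \<le> measure \<mu> U powr \<theta> * 2 powr -\<theta>"
  proof -
    have "measure \<mu> V powr \<theta> \<le> (measure \<mu> U / 2) powr \<theta>" using V(3) \<open>\<theta> > 0\<close> by (intro powr_mono2) auto
    also have "\<dots> = measure \<mu> U powr \<theta> * 2 powr -\<theta>" by (simp add: powr_divide powr_minus field_simps)
    finally show ?thesis .
  qed
  have "norm (form (restr V \<psi>) g) \<le>
      (\<Sum>i<n. ((l + level_step) + (real i + 1) * level_step + C\<epsilon> + 41 * N) * (measure \<mu> V powr \<theta> * (2 powr -\<theta>) ^ i * A))
      + N * c * sqrt (measure \<mu> V * (1 / 2) ^ n) * sqrt (measure \<mu> D)"
    by (rule Suc.IH) (use V bV Suc.prems level_step_pos in auto)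
  also have "\<dots> \<le> (\<Sum>i<n. (l + (real (Suc i) + 1) * level_step + \<Lambda>) * (P * (2 powr -\<theta>) ^ Suc i))
      + N * c * sqrt (measure \<mu> U * (1 / 2) ^ Suc n) * sqrt (measure \<mu> D)"
  proof (intro add_mono sum_mono)
    fix i
    have "measure \<mu> V powr \<theta> * (2 powr -\<theta>) ^ i * A \<le> measure \<mu> U powr \<theta> * 2 powr -\<theta> * (2 powr -\<theta>) ^ i * A"
      using VU \<open>A \<ge> 0\<close> by (intro mult_right_mono) auto
    also have "\<dots> = P * (2 powr -\<theta>) ^ Suc i" unfolding P_def by (simp add: mult_ac)
    finally have "(l + (real (Suc i) + 1) * level_step + \<Lambda>) * (measure \<mu> V powr \<theta> * (2 powr -\<theta>) ^ i * A)
       \<le> (l + (real (Suc i) + 1) * level_step + \<Lambda>) * (P * (2 powr -\<theta>) ^ Suc i)"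
      using Suc.prems(3) level_step_pos \<Lambda> by (intro mult_left_mono) auto
    then show "(l + level_step + (real i + 1) * level_step + C\<epsilon> + 41 * N) * (measure \<mu> V powr \<theta> * (2 powr -\<theta>) ^ i * A)
       \<le> (l + (real (Suc i) + 1) * level_step + \<Lambda>) * (P * (2 powr -\<theta>) ^ Suc i)"
      unfolding \<Lambda>_def by (simp add: algebra_simps)
  next
    have "measure \<mu> V * (1 / 2) ^ n \<le> measure \<mu> U * (1 / 2) ^ Suc n"
      using mult_right_mono[OF V(3), of "(1 / 2) ^ n"] by simp
    then show "N * c * sqrt (measure \<mu> V * (1 / 2) ^ n) * sqrt (measure \<mu> D)
       \<le> N * c * sqrt (measure \<mu> U * (1 / 2) ^ Suc n) * sqrt (measure \<mu> D)"
      using N_nonneg c by (intro mult_right_mono mult_left_mono real_sqrt_le_mono) auto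
  qed
  finally have "norm (form (restr U \<psi>) g) \<le> (l + level_step + \<Lambda>) * P +
      (\<Sum>i<n. (l + (real (Suc i) + 1) * level_step + \<Lambda>) * (P * (2 powr -\<theta>) ^ Suc i))
      + N * c * sqrt (measure \<mu> U * (1 / 2) ^ Suc n) * sqrt (measure \<mu> D)"
    using 1 norm_triangle_ineq[of "form (restr V \<psi>) g" "form (restr (- V) (restr U \<psi>)) g"] unfolding split by linarith
  also have "(l + level_step + \<Lambda>) * P + (\<Sum>i<n. (l + (real (Suc i) + 1) * level_step + \<Lambda>) * (P * (2 powr -\<theta>) ^ Suc i))
     = (\<Sum>i<Suc n. (l + (real i + 1) * level_step + \<Lambda>) * (P * (2 powr -\<theta>) ^ i))"
    by (subst sum.lessThan_Suc_shift) simp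
  also have "\<dots> = (\<Sum>i<Suc n. (l + (real i + 1) * level_step + C\<epsilon> + 41 * N) * (measure \<mu> U powr \<theta> * (2 powr -\<theta>) ^ i * A))"
    unfolding P_def \<Lambda>_def by (intro sum.cong) (auto simp: algebra_simps)
  finally show ?case .
qed

abbreviation C_local :: "real \<Rightarrow> real" where
  "C_local \<equiv> local_const \<epsilon> N"

text \<open>The iteration can start from U = B(z,3R): outside it the support of g is at distance at
  least 2R, so every transposed truncation of g is at most R/(2R) \<le> 1. The L2 remainder tends to
  0 with n, so the size of \<psi> disappears from the constant.\<close>

lemma form_local_bound:
  assumes "R > 0"
    and g: "test_fun g" "\<And>x. norm (g x) \<le> 1" "\<And>x. x \<notin> ball z R \<Longrightarrow> g x = 0"
    and \<psi>: "test_fun \<psi>" "\<And>x. x \<notin> ball z (3 * R) \<Longrightarrow> \<psi> x = 0" and "\<theta> > 0" "A \<ge> 0"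
    and H: "\<And>U. open U \<Longrightarrow> bounded U \<Longrightarrow> (\<integral>x. norm (restr U \<psi> x) \<partial>\<mu>) \<le> measure \<mu> U powr \<theta> * A"
  shows "norm (form \<psi> g) \<le> C_local \<theta> * (measure \<mu> (ball z (3 * R)) powr \<theta> * A)"
proof -
  let ?U = "ball z (3 * R)"
  define q where "q = 2 powr -\<theta>"
  have q: "0 \<le> q" "q < 1" unfolding q_def using \<open>\<theta> > 0\<close> by (auto simp: powr_less_one)
  obtain c where c: "c > 0" "\<And>x. norm (\<psi> x) \<le> c" using test_fun_bound[OF \<psi>(1)] by blast
  have tb: "tr_bounded g 1 w" if w: "w \<notin> ?U" for w
    unfolding tr_bounded_def
  proof (intro allI impI)
    fix r :: real assume "r > 0"
    have "norm (tr.Kint (restr (- ball w r) g) w) \<le> 1 / (2 * R) * measure \<mu> (ball z R)"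
      unfolding tr.Kint_def
    proof (rule norm_integral_le_measure)
      fix y
      show "norm (K y w * restr (- ball w r) g y) \<le> 1 / (2 * R)" if "y \<in> ball z R"
      proof -
        have "dist y w \<ge> 2 * R" using that w dist_triangle[of z w y] by (simp add: dist_commute)
        then have "norm (K y w) \<le> 1 / (2 * R)" using \<open>R > 0\<close> by (intro norm_K_le) auto
        moreover have "norm (restr (- ball w r) g y) \<le> 1" using norm_restr_le g(2) order_trans by blast
        ultimately have "norm (K y w) * norm (restr (- ball w r) g y) \<le> 1 / (2 * R) * 1"
          using \<open>R > 0\<close> by (intro mult_mono) auto
        then show ?thesis by (simp add: norm_mult)
      qed
      show "K y w * restr (- ball w r) g y = 0" if "y \<notin> ball z R"
        using g(3)[OF that] by (simp add: restr_def)
    qed (use \<open>R > 0\<close> in auto)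
    also have "\<dots> \<le> 1 / (2 * R) * R"
      using \<open>R > 0\<close> by (intro mult_left_mono measure_ball_le) auto
    finally show "norm (tr.Kint (restr (- ball w r) g) w) \<le> 1" using \<open>R > 0\<close> by simp
  qed
  define P where "P = measure \<mu> ?U powr \<theta> * A"
  have P: "P \<ge> 0" unfolding P_def using \<open>A \<ge> 0\<close> by simp
  have eq: "restr ?U \<psi> = \<psi>" using \<psi>(2) by (auto simp: fun_eq_iff restr_def indicator_def)
  have bound: "norm (form \<psi> g) \<le> C_local \<theta> * P + N * c * sqrt (measure \<mu> ?U * (1 / 2) ^ n) * sqrt (measure \<mu> (ball z R))" for n
  proof -
    have "norm (form (restr ?U \<psi>) g) \<le>
      (\<Sum>i<n. (1 + (real i + 1) * level_step + C\<epsilon> + 41 * N) * (measure \<mu> ?U powr \<theta> * (2 powr -\<theta>) ^ i * A))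
      + N * c * sqrt (measure \<mu> ?U * (1 / 2) ^ n) * sqrt (measure \<mu> (ball z R))"
      by (rule form_iteration[OF g _ _ \<psi>(1) c(2) \<open>\<theta> > 0\<close> \<open>A \<ge> 0\<close> H]) (use tb in auto)
    moreover have "(\<Sum>i<n. (1 + (real i + 1) * level_step + C\<epsilon> + 41 * N) * (measure \<mu> ?U powr \<theta> * (2 powr -\<theta>) ^ i * A)) \<le> C_local \<theta> * P"
    proof -
      have "(\<Sum>i<n. (1 + (real i + 1) * level_step + C\<epsilon> + 41 * N) * (measure \<mu> ?U powr \<theta> * (2 powr -\<theta>) ^ i * A))
        \<le> (\<Sum>i<n. (1 + level_step + C\<epsilon> + 41 * N) * P * (of_nat (Suc i) * q ^ i))"
      proof (rule sum_mono)
        fix i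
        have "1 + (real i + 1) * level_step + C\<epsilon> + 41 * N \<le> (1 + level_step + C\<epsilon> + 41 * N) * of_nat (Suc i)"
          using C\<epsilon>_pos N_nonneg by (simp add: algebra_simps)
        then have "(1 + (real i + 1) * level_step + C\<epsilon> + 41 * N) * (P * q ^ i)
          \<le> (1 + level_step + C\<epsilon> + 41 * N) * of_nat (Suc i) * (P * q ^ i)"
          using P q by (intro mult_right_mono) auto
        then show "(1 + (real i + 1) * level_step + C\<epsilon> + 41 * N) * (measure \<mu> ?U powr \<theta> * (2 powr -\<theta>) ^ i * A)
          \<le> (1 + level_step + C\<epsilon> + 41 * N) * P * (of_nat (Suc i) * q ^ i)"
          unfolding P_def q_def by (simp add: mult_ac)
      qed
      also have "\<dots> = (1 + level_step + C\<epsilon> + 41 * N) * P * (\<Sum>i<n. of_nat (Suc i) * q ^ i)"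
        by (simp add: sum_distrib_left)
      also have "\<dots> \<le> (1 + level_step + C\<epsilon> + 41 * N) * P * (1 / (1 - q)\<^sup>2)"
      proof (rule mult_left_mono)
        have s: "(\<lambda>i. of_nat (Suc i) * q ^ i) sums (1 / (1 - q)\<^sup>2)"
          using q by (intro geometric_deriv_sums) auto
        show "(\<Sum>i<n. of_nat (Suc i) * q ^ i) \<le> 1 / (1 - q)\<^sup>2"
          using sum_le_suminf[OF sums_summable[OF s], of "{..<n}"] q sums_unique[OF s] by auto
      qed (use P level_step_pos C\<epsilon>_pos N_nonneg in simp)
      also have "\<dots> = C_local \<theta> * P" unfolding local_const_def q_def[symmetric] by simp
      finally show ?thesis .
    qed
    ultimately show ?thesis unfolding eq by linarith
  qed
  have "(\<lambda>n. C_local \<theta> * P + N * c * sqrt (measure \<mu> ?U * (1 / 2) ^ n) * sqrt (measure \<mu> (ball z R)))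
    \<longlonglongrightarrow> C_local \<theta> * P + N * c * sqrt (measure \<mu> ?U * 0) * sqrt (measure \<mu> (ball z R))"
    by (intro tendsto_intros LIMSEQ_power_zero) auto
  then have "norm (form \<psi> g) \<le> C_local \<theta> * P + N * c * sqrt (measure \<mu> ?U * 0) * sqrt (measure \<mu> (ball z R))"
    by (rule LIMSEQ_le_const) (use bound in blast)
  then show ?thesis unfolding P_def by simp
qed

end

section \<open>Cotlar's inequality\<close>

lemma norm_indicator_complex: "norm (indicator U x :: complex) = indicator U x"
  by (simp add: indicator_def)

lemma ennpowr_finite: "u < \<infinity> \<Longrightarrow> ennpowr u a = ennreal (enn2real u powr a)"
  unfolding ennpowr_def by auto

lemma ennpowr_infinity: "\<not> u < \<infinity> \<Longrightarrow> ennpowr u a = \<infinity>"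
  unfolding ennpowr_def by (simp add: not_less top_unique)

section \<open>Maximal functions in real form and approximation in \<open>Lp_space\<close>\<close>

context linear_growth begin

lemma M_prime_ge:
  assumes "M_prime \<mu> f x < \<infinity>" "t > 0"
  shows "(\<integral>\<^sup>+y\<in>ball x t. ennreal (norm (f y)) \<partial>\<mu>) \<le> ennreal (enn2real (M_prime \<mu> f x) * t)"
proof -
  let ?I = "\<integral>\<^sup>+y\<in>ball x t. ennreal (norm (f y)) \<partial>\<mu>"
  have "?I / ennreal t \<le> M_prime \<mu> f x"
    unfolding M_prime_def using assms(2) by (intro SUP_upper) auto
  then have "?I / ennreal t * ennreal t \<le> M_prime \<mu> f x * ennreal t" by (intro mult_right_mono) auto
  moreover have "?I / ennreal t * ennreal t = ?I"
    using assms(2) by (simp add: ennreal_divide_times ennreal_times_divide[symmetric])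
  moreover have "M_prime \<mu> f x * ennreal t = ennreal (enn2real (M_prime \<mu> f x) * t)"
    using assms by (simp add: ennreal_mult less_top)
  ultimately show ?thesis by simp
qed

lemma M_tilde_ge:
  assumes dbl: "doubling x r" and fin: "M_tilde \<mu> f x < \<infinity>" and a: "ennreal a \<le> (\<integral>\<^sup>+y\<in>ball x r. ennreal (norm (f y)) \<partial>\<mu>)" "a \<ge> 0"
  shows "a \<le> measure \<mu> (ball x r) * enn2real (M_tilde \<mu> f x)"
proof -
  let ?m = "measure \<mu> (ball x r)"
  have r: "r > 0" and m: "?m > 0" and m3: "measure \<mu> (ball x (3 * r)) \<le> 81 * ?m"
    using dbl unfolding doubling_def by auto
  have "emeasure \<mu> (ball x (3 * r)) \<le> 81 * emeasure \<mu> (ball x r)"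
  proof -
    have "ennreal (measure \<mu> (ball x (3 * r))) \<le> ennreal (81 * ?m)" using m3 by (intro ennreal_leI)
    also have "\<dots> = 81 * ennreal ?m" by (simp add: ennreal_mult')
    finally show ?thesis by (simp add: emeasure_bounded)
  qed
  then have "(\<integral>\<^sup>+y\<in>ball x r. ennreal (norm (f y)) \<partial>\<mu>) / emeasure \<mu> (ball x r) \<le> M_tilde \<mu> f x"
    unfolding M_tilde_def using r m by (intro SUP_upper) (auto simp: emeasure_bounded)
  moreover have "ennreal a / ennreal ?m \<le> (\<integral>\<^sup>+y\<in>ball x r. ennreal (norm (f y)) \<partial>\<mu>) / emeasure \<mu> (ball x r)"
    using a by (simp add: emeasure_bounded divide_right_mono_ennreal)
  ultimately have "ennreal (a / ?m) \<le> M_tilde \<mu> f x"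
    using a m by (simp add: divide_ennreal)
  then have "ennreal (a / ?m) \<le> ennreal (enn2real (M_tilde \<mu> f x))" using fin by (simp add: less_top)
  then have "a / ?m \<le> enn2real (M_tilde \<mu> f x)" by simp
  then show ?thesis using m by (simp add: divide_le_eq mult.commute)
qed

lemma Lp_local_average:
  assumes "p > 1" "h \<in> Lp_space p \<mu>" "bounded U" "U \<in> sets borel"
  shows "integrable \<mu> (\<lambda>x. norm (h x) * indicator U x)"
    and "(\<integral>x. norm (h x) * indicator U x \<partial>\<mu>) \<le> Lp_norm p \<mu> h * measure \<mu> U powr (1 - 1 / p)"
proof -
  define q where "q = p / (p - 1)"
  have q: "q > 1" "1 / p + 1 / q = 1" "1 / q = 1 - 1 / p" unfolding q_def using \<open>p > 1\<close> by (auto simp: field_simps)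
  have [measurable]: "h \<in> borel_measurable borel" using assms(2) by (simp add: Lp_space_def measurable_mu)
  note [measurable] = assms(4)
  have ind: "indicator U x powr q = (indicator U x :: real)" for x by (simp add: indicator_def)
  have m: "(\<lambda>x. norm (h x)) \<in> borel_measurable \<mu>" "(\<lambda>x. indicator U x :: real) \<in> borel_measurable \<mu>"
    by measurable
  have i: "integrable \<mu> (\<lambda>x. norm (h x) powr p)" "integrable \<mu> (\<lambda>x. indicator U x powr q :: real)"
    using assms(2) emeasure_bounded_finite[OF assms(3)] assms(4) unfolding Lp_space_def ind by auto
  note H = Hoelder_integral[OF m \<open>p > 1\<close> q(1,2) _ _ i]
  show "integrable \<mu> (\<lambda>x. norm (h x) * indicator U x)" by (rule H) auto
  have "(\<integral>x. norm (h x) * indicator U x \<partial>\<mu>)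
    \<le> (\<integral>x. norm (h x) powr p \<partial>\<mu>) powr (1 / p) * (\<integral>x. indicator U x powr q \<partial>\<mu>) powr (1 / q)"
    by (rule H) auto
  also have "\<dots> = Lp_norm p \<mu> h * measure \<mu> U powr (1 - 1 / p)"
    unfolding Lp_norm_def ind q(3) using assms(4) by simp
  finally show "(\<integral>x. norm (h x) * indicator U x \<partial>\<mu>) \<le> Lp_norm p \<mu> h * measure \<mu> U powr (1 - 1 / p)" .
qed

text \<open>A restriction to a set rather than a clipping of values: it is dominated by |\<phi>|,
  and so is the difference from \<phi>; at each point it eventually equals \<phi>.\<close>

definition cutoff :: "(complex \<Rightarrow> complex) \<Rightarrow> nat \<Rightarrow> complex \<Rightarrow> complex" where
  "cutoff \<phi> n = restr {y. norm y \<le> real n \<and> norm (\<phi> y) \<le> real n} \<phi>"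

lemma cutoff_set_borel:
  assumes [measurable]: "\<phi> \<in> borel_measurable borel"
  shows "{y :: complex. norm y \<le> real n \<and> norm (\<phi> y :: complex) \<le> real n} \<in> sets borel"
proof -
  have "{y \<in> space borel. norm y \<le> real n \<and> norm (\<phi> y :: complex) \<le> real n} \<in> sets borel" by measurable
  then show ?thesis by simp
qed

lemma restr_borel_measurable:
  assumes [measurable]: "\<phi> \<in> borel_measurable borel" "E \<in> sets borel"
  shows "restr E \<phi> \<in> borel_measurable borel"
  unfolding restr_def[abs_def] by measurable

lemma test_fun_cutoff:
  assumes "\<phi> \<in> borel_measurable borel" shows "test_fun (cutoff \<phi> n)"
proof (rule test_funI[where C = "real n" and E = "cball 0 (real n)"])
  show "cutoff \<phi> n \<in> borel_measurable borel"
    unfolding cutoff_def using assms by (intro restr_borel_measurable cutoff_set_borel)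
  show "norm (cutoff \<phi> n x) \<le> real n" for x unfolding cutoff_def restr_def by (auto simp: indicator_def)
  show "x \<in> cball 0 (real n)" if "cutoff \<phi> n x \<noteq> 0" for x
    using that unfolding cutoff_def restr_def by (auto simp: indicator_def split: if_splits)
qed auto

lemma cutoff_eventually: "\<forall>\<^sub>F n in sequentially. cutoff \<phi> n x = \<phi> x"
proof -
  obtain n0 :: nat where n0: "max (norm x) (norm (\<phi> x)) \<le> real n0" using real_arch_simple by blast
  show ?thesis
    using eventually_ge_at_top[of n0]
  proof eventually_elim
    case (elim n)
    then have "real n0 \<le> real n" by simp
    then have "norm x \<le> real n \<and> norm (\<phi> x) \<le> real n" using n0 by linarith
    then show ?case unfolding cutoff_def by simp
  qed
qed

lemma Lp_norm_cutoff_tendsto: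
  assumes "p > 1" "\<phi> \<in> Lp_space p \<mu>"
  shows "(\<lambda>x. \<phi> x - cutoff \<phi> n x) \<in> Lp_space p \<mu>"
    and "(\<lambda>n. Lp_norm p \<mu> (\<lambda>x. \<phi> x - cutoff \<phi> n x)) \<longlonglongrightarrow> 0"
proof -
  have \<phi>: "\<phi> \<in> borel_measurable borel" "integrable \<mu> (\<lambda>x. norm (\<phi> x) powr p)"
    using assms(2) by (auto simp: Lp_space_def measurable_mu)
  note [measurable] = \<phi>(1) test_fun_measurable[OF test_fun_cutoff[OF \<phi>(1)]]
  have le: "norm (norm (\<phi> x - cutoff \<phi> n x) powr p) \<le> norm (\<phi> x) powr p" for n x
    unfolding cutoff_def restr_def using \<open>p > 1\<close> by (auto simp: indicator_def)
  have m: "(\<lambda>x. norm (\<phi> x - cutoff \<phi> n x) powr p) \<in> borel_measurable \<mu>" for n by measurable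
  have "integrable \<mu> (\<lambda>x. norm (\<phi> x - cutoff \<phi> n x) powr p)" for n
    by (rule Bochner_Integration.integrable_bound[OF \<phi>(2) m]) (use le in auto)
  moreover have "(\<lambda>x. \<phi> x - cutoff \<phi> n x) \<in> borel_measurable \<mu>" for n by measurable
  ultimately show "(\<lambda>x. \<phi> x - cutoff \<phi> n x) \<in> Lp_space p \<mu>" unfolding Lp_space_def by simp
  have "(\<lambda>n. \<integral>x. norm (\<phi> x - cutoff \<phi> n x) powr p \<partial>\<mu>) \<longlonglongrightarrow> (\<integral>x. 0 \<partial>\<mu>)"
  proof (rule integral_dominated_convergence[OF _ m \<phi>(2)])
    show "AE x in \<mu>. (\<lambda>n. norm (\<phi> x - cutoff \<phi> n x) powr p) \<longlonglongrightarrow> 0"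
    proof (rule AE_I2)
      fix x
      have "\<forall>\<^sub>F n in sequentially. norm (\<phi> x - cutoff \<phi> n x) powr p = 0"
        using cutoff_eventually[of \<phi> x] by eventually_elim simp
      then show "(\<lambda>n. norm (\<phi> x - cutoff \<phi> n x) powr p) \<longlonglongrightarrow> 0" by (rule tendsto_eventually)
    qed
  qed (use le in auto)
  then have "(\<lambda>n. (\<integral>x. norm (\<phi> x - cutoff \<phi> n x) powr p \<partial>\<mu>) powr (1 / p)) \<longlonglongrightarrow> 0"
    using \<open>p > 1\<close> by (intro tendsto_zero_powrI[where b = "1 / p"]) auto
  then show "(\<lambda>n. Lp_norm p \<mu> (\<lambda>x. \<phi> x - cutoff \<phi> n x)) \<longlonglongrightarrow> 0" unfolding Lp_norm_def .
qed

end

context growth_kernel begin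

text \<open>Young's inequality bounds |\<phi>| / |z - y| by |\<phi>|^p + |z - y|^(-q), q being the
  conjugate exponent; the second term is integrable off the ball by \<open>tail_bound\<close> with q
  - 1 in the role of \<epsilon>.\<close>

lemma far_integrable_Lp:
  assumes "p > 1" "\<phi> \<in> Lp_space p \<mu>" "r > 0"
  shows "integrable \<mu> (\<lambda>y. K z y * restr (- ball z r) \<phi> y)"
proof (rule integrableI_bounded)
  define q where "q = p / (p - 1)"
  have q: "q > 1" "1 / p + 1 / q = 1" unfolding q_def using \<open>p > 1\<close> by (auto simp: field_simps)
  have \<phi>: "\<phi> \<in> borel_measurable borel" "integrable \<mu> (\<lambda>x. norm (\<phi> x) powr p)"
    using assms(2) by (auto simp: Lp_space_def measurable_mu)
  note [measurable] = \<phi>(1) K_measurable1[of z]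
  have [measurable]: "restr (- ball z r) \<phi> \<in> borel_measurable borel"
    using \<phi>(1) by (intro restr_borel_measurable) auto
  show "(\<lambda>y. K z y * restr (- ball z r) \<phi> y) \<in> borel_measurable \<mu>" by measurable
  have pt: "ennreal (norm (K z y * restr (- ball z r) \<phi> y))
     \<le> ennreal (norm (\<phi> y) powr p) + ennreal (1 / r powr (q - 1)) * (1 * ennreal (r powr (q - 1) / dist z y powr (1 + (q - 1))) * indicator (- ball z r) y)" for y
  proof (cases "y \<in> ball z r")
    case False
    then have d: "dist z y \<ge> r" "dist z y > 0" "z \<noteq> y" using \<open>r > 0\<close> by auto
    have "norm (K z y * \<phi> y) \<le> norm (\<phi> y) * (1 / dist z y)"
      unfolding norm_mult using CZ_kernelD1[OF CZ d(3)] by (subst mult.commute) (intro mult_left_mono; simp)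
    also have "\<dots> \<le> norm (\<phi> y) powr p / p + (1 / dist z y) powr q / q"
      by (rule Youngs_inequality[OF \<open>p > 1\<close> q]) auto
    also have "\<dots> \<le> norm (\<phi> y) powr p + (1 / dist z y) powr q"
      using \<open>p > 1\<close> q(1) by (intro add_mono) (auto simp: divide_le_eq mult_le_cancel_left1)
    also have "(1 / dist z y) powr q = 1 / r powr (q - 1) * (r powr (q - 1) / dist z y powr (1 + (q - 1)))"
      using d \<open>r > 0\<close> by (simp add: powr_divide)
    finally have "ennreal (norm (K z y * \<phi> y)) \<le> ennreal (norm (\<phi> y) powr p + 1 / r powr (q - 1) * (r powr (q - 1) / dist z y powr (1 + (q - 1))))"
      by (rule ennreal_leI)
    also have "\<dots> = ennreal (norm (\<phi> y) powr p) + ennreal (1 / r powr (q - 1)) * ennreal (r powr (q - 1) / dist z y powr (1 + (q - 1)))"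
      by (subst ennreal_plus, simp, simp, subst ennreal_mult, auto)
    finally show ?thesis using False by simp
  qed simp
  have "(\<integral>\<^sup>+y. ennreal (norm (K z y * restr (- ball z r) \<phi> y)) \<partial>\<mu>)
    \<le> (\<integral>\<^sup>+y. ennreal (norm (\<phi> y) powr p) + ennreal (1 / r powr (q - 1)) * (1 * ennreal (r powr (q - 1) / dist z y powr (1 + (q - 1))) * indicator (- ball z r) y) \<partial>\<mu>)"
    by (intro nn_integral_mono pt)
  also have "\<dots> = (\<integral>\<^sup>+y. ennreal (norm (\<phi> y) powr p) \<partial>\<mu>)
     + ennreal (1 / r powr (q - 1)) * (\<integral>\<^sup>+y\<in>-ball z r. 1 * ennreal (r powr (q - 1) / dist z y powr (1 + (q - 1))) \<partial>\<mu>)"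
    by (subst nn_integral_add; (subst nn_integral_cmult)?) measurable
  also have "\<dots> \<le> (\<integral>\<^sup>+y. ennreal (norm (\<phi> y) powr p) \<partial>\<mu>)
     + ennreal (1 / r powr (q - 1)) * ennreal (2 / (1 - 2 powr -(q - 1)) * 1)"
  proof (intro add_left_mono mult_left_mono tail_bound)
    fix t assume "r \<le> t"
    then have "t > 0" using \<open>r > 0\<close> by simp
    then show "(\<integral>\<^sup>+y\<in>ball z t. 1 \<partial>\<mu>) \<le> ennreal (1 * t)" using growth[of t z] by simp
  qed (use \<open>r > 0\<close> q in auto)
  also have "\<dots> < \<infinity>"
    using \<phi>(2) unfolding integrable_iff_bounded by (simp add: ennreal_mult_less_top)
  finally show "(\<integral>\<^sup>+y. ennreal (norm (K z y * restr (- ball z r) \<phi> y)) \<partial>\<mu>) < \<infinity>" .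
qed

lemma Kint_cutoff_tendsto:
  assumes "p > 1" "\<phi> \<in> Lp_space p \<mu>" "r > 0"
  shows "(\<lambda>n. Kint (restr (- ball z r) (cutoff \<phi> n)) z) \<longlonglongrightarrow> Kint (restr (- ball z r) \<phi>) z"
  unfolding Kint_def
proof (rule integral_dominated_convergence)
  have \<phi>: "\<phi> \<in> borel_measurable borel" using assms(2) by (auto simp: Lp_space_def measurable_mu)
  note [measurable] = K_measurable1[of z]
  have [measurable]: "restr (- ball z r) \<phi> \<in> borel_measurable borel" using \<phi> by (intro restr_borel_measurable) auto
  have [measurable]: "restr (- ball z r) (cutoff \<phi> n) \<in> borel_measurable borel" for n
    using test_fun_measurable[OF test_fun_cutoff[OF \<phi>]] by (intro restr_borel_measurable) auto
  show "(\<lambda>y. K z y * restr (- ball z r) \<phi> y) \<in> borel_measurable \<mu>" by measurable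
  show "(\<lambda>y. K z y * restr (- ball z r) (cutoff \<phi> n) y) \<in> borel_measurable \<mu>" for n by measurable
  show "integrable \<mu> (\<lambda>y. norm (K z y * restr (- ball z r) \<phi> y))"
    by (rule integrable_norm[OF far_integrable_Lp[OF assms]])
  show "AE y in \<mu>. (\<lambda>n. K z y * restr (- ball z r) (cutoff \<phi> n) y) \<longlonglongrightarrow> K z y * restr (- ball z r) \<phi> y"
  proof (rule AE_I2)
    fix y
    have "\<forall>\<^sub>F n in sequentially. K z y * restr (- ball z r) (cutoff \<phi> n) y = K z y * restr (- ball z r) \<phi> y"
      using cutoff_eventually[of \<phi> y] by eventually_elim (simp add: restr_def)
    then show "(\<lambda>n. K z y * restr (- ball z r) (cutoff \<phi> n) y) \<longlonglongrightarrow> K z y * restr (- ball z r) \<phi> y"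
      by (rule tendsto_eventually)
  qed
  show "AE y in \<mu>. norm (K z y * restr (- ball z r) (cutoff \<phi> n) y) \<le> norm (K z y * restr (- ball z r) \<phi> y)" for n
    by (intro AE_I2) (auto simp: norm_mult restr_def cutoff_def indicator_def)
qed

end

section \<open>Passage from test functions to \<open>Lp_space\<close>\<close>

context cz_operator begin

lemma C_local_pos: "\<theta> > 0 \<Longrightarrow> C_local \<theta> > 0"
  using level_step_pos C\<epsilon>_pos N_nonneg unfolding local_const_def by (simp add: powr_less_one add_pos_nonneg)

text \<open>This is how the abstract extension S is reached: on a cutoff it agrees with T almost
  everywhere, and on the remainder its local integral is controlled by its operator bound and
  Hoelder's inequality.\<close>

lemma S_local_tendsto:
  assumes "p > 1" "Lp_extension p \<mu> T S" "\<phi> \<in> Lp_space p \<mu>" "bounded U" "U \<in> sets borel"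
  shows "(\<lambda>n. form (cutoff \<phi> n) (indicator U)) \<longlonglongrightarrow> (\<integral>x. S \<phi> x * indicator U x \<partial>\<mu>)"
proof -
  obtain C where C: "Lp_operator_bound p \<mu> S C" using assms(2) unfolding Lp_extension_def by blast
  have \<phi>: "\<phi> \<in> borel_measurable borel" using assms(3) by (auto simp: Lp_space_def measurable_mu)
  have cp: "cutoff \<phi> n \<in> Lp_space p \<mu>" for n
    using test_fun_Lp_space[OF test_fun_cutoff[OF \<phi>]] \<open>p > 1\<close> by simp
  define h where "h n = (\<lambda>x. \<phi> x - cutoff \<phi> n x)" for n
  have h: "h n \<in> Lp_space p \<mu>" for n unfolding h_def by (rule Lp_norm_cutoff_tendsto(1)[OF assms(1,3)])
  have SL: "S f \<in> Lp_space p \<mu>" if "f \<in> Lp_space p \<mu>" for f using C that unfolding Lp_operator_bound_def by blast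
  have Sm: "S f \<in> borel_measurable borel" if "f \<in> Lp_space p \<mu>" for f
    using SL[OF that] by (auto simp: Lp_space_def measurable_mu)
  have Si: "integrable \<mu> (\<lambda>x. S f x * indicator U x)" if f: "f \<in> Lp_space p \<mu>" for f
  proof -
    note [measurable] = Sm[OF f] assms(5)
    have "integrable \<mu> (\<lambda>x. norm (S f x * indicator U x))"
      using Lp_local_average(1)[OF assms(1) SL[OF f] assms(4,5)] by (simp add: norm_mult norm_indicator_complex)
    then show ?thesis by (subst (asm) integrable_norm_iff) auto
  qed
  have eq: "(\<integral>x. S \<phi> x * indicator U x \<partial>\<mu>) - form (cutoff \<phi> n) (indicator U) = (\<integral>x. S (h n) x * indicator U x \<partial>\<mu>)" for n
  proof -
    note [measurable] = Sm[OF assms(3)] Sm[OF h[of n]] Sm[OF cp[of n]] assms(5) T_L2(1)[OF test_fun_cutoff[OF \<phi>], of n]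
    have "AE x in \<mu>. S (\<lambda>y. cutoff \<phi> n y + h n y) x = S (cutoff \<phi> n) x + S (h n) x"
      using C cp h unfolding Lp_operator_bound_def by blast
    then have "(\<integral>x. S \<phi> x * indicator U x \<partial>\<mu>) = (\<integral>x. S (cutoff \<phi> n) x * indicator U x + S (h n) x * indicator U x \<partial>\<mu>)"
      by (intro integral_cong_AE; measurable?) (auto simp: h_def distrib_right)
    also have "\<dots> = (\<integral>x. S (cutoff \<phi> n) x * indicator U x \<partial>\<mu>) + (\<integral>x. S (h n) x * indicator U x \<partial>\<mu>)"
      using Si cp h by (intro Bochner_Integration.integral_add) auto
    also have "(\<integral>x. S (cutoff \<phi> n) x * indicator U x \<partial>\<mu>) = form (cutoff \<phi> n) (indicator U)"
    proof -
      have "AE x in \<mu>. S (cutoff \<phi> n) x = T (cutoff \<phi> n) x"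
        using assms(2) cp[of n] test_L2[OF test_fun_cutoff[OF \<phi>], of n] unfolding Lp_extension_def by blast
      then show ?thesis unfolding form_def by (intro integral_cong_AE; measurable?) auto
    qed
    finally show ?thesis by simp
  qed
  have le: "norm (form (cutoff \<phi> n) (indicator U) - (\<integral>x. S \<phi> x * indicator U x \<partial>\<mu>))
     \<le> C * Lp_norm p \<mu> (h n) * measure \<mu> U powr (1 - 1 / p)" for n
  proof -
    have "norm (form (cutoff \<phi> n) (indicator U) - (\<integral>x. S \<phi> x * indicator U x \<partial>\<mu>)) = norm (\<integral>x. S (h n) x * indicator U x \<partial>\<mu>)"
      by (subst norm_minus_commute) (simp only: eq)
    also have "\<dots> \<le> (\<integral>x. norm (S (h n) x * indicator U x) \<partial>\<mu>)" by (rule integral_norm_bound)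
    also have "\<dots> = (\<integral>x. norm (S (h n) x) * indicator U x \<partial>\<mu>)" by (simp add: norm_mult norm_indicator_complex)
    also have "\<dots> \<le> Lp_norm p \<mu> (S (h n)) * measure \<mu> U powr (1 - 1 / p)"
      by (rule Lp_local_average(2)[OF assms(1) SL[OF h] assms(4,5)])
    also have "\<dots> \<le> C * Lp_norm p \<mu> (h n) * measure \<mu> U powr (1 - 1 / p)"
      using C h[of n] unfolding Lp_operator_bound_def by (intro mult_right_mono) auto
    finally show ?thesis .
  qed
  have "(\<lambda>n. C * Lp_norm p \<mu> (h n) * measure \<mu> U powr (1 - 1 / p)) \<longlonglongrightarrow> C * 0 * measure \<mu> U powr (1 - 1 / p)"
    unfolding h_def by (intro tendsto_intros Lp_norm_cutoff_tendsto(2)[OF assms(1,3)])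
  then have "(\<lambda>n. form (cutoff \<phi> n) (indicator U) - (\<integral>x. S \<phi> x * indicator U x \<partial>\<mu>)) \<longlonglongrightarrow> 0"
    by (intro Lim_null_comparison[OF always_eventually[OF allI[OF le]]]) simp
  then show ?thesis by (simp add: LIM_zero_iff)
qed

text \<open>The local part of f is subtracted by \<open>form_local_bound\<close> and the far part
  compared by \<open>Kint_le_average\<close>. The numbers \<open>M\<close> and \<open>a\<close>
  stand in for the maximal functions, so that the same values serve all cutoffs of one
  function.\<close>

lemma cotlar_test_fun:
  assumes f: "test_fun f" and "r > 0" "\<beta> > 1" "M \<ge> 0"
    and k: "\<And>j. j < k \<Longrightarrow> 81 * mu3 x r j \<le> mu3 x r (j + 2)" and R: "R = 3 ^ k * r"
    and M: "\<And>t. t > 0 \<Longrightarrow> (\<integral>\<^sup>+y\<in>ball x t. ennreal (norm (f y)) \<partial>\<mu>)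
              \<le> ennreal (M * t powr (1 - \<theta>) * measure \<mu> (ball x t) powr \<theta>)"
    and a: "(\<integral>y. norm (restr (ball x (3 * R)) f y) powr \<beta> \<partial>\<mu>) \<le> a"
    and \<theta>: "\<theta> = 1 - 1 / \<beta>"
  shows "norm (Kint (restr (- ball x r) f) x) * measure \<mu> (ball x R)
    \<le> norm (form f (indicator (ball x R)))
      + C_local \<theta> * (measure \<mu> (ball x (3 * R)) powr \<theta> * a powr (1 / \<beta>))
      + (9 / (1 - 3 powr -\<theta>) + C\<epsilon>) * M * measure \<mu> (ball x R)"
proof -
  have th: "0 < \<theta>" "\<theta> \<le> 1" unfolding \<theta> using \<open>\<beta> > 1\<close> by auto
  have R0: "R > 0" using \<open>r > 0\<close> unfolding R by simp
  let ?I = "indicator (ball x R) :: complex \<Rightarrow> complex"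
  let ?n = "restr (ball x (3 * R)) f"
  let ?g = "restr (- ball x (3 * R)) f"
  have I: "test_fun ?I" by (rule test_fun_indicator) auto
  have tn: "test_fun ?n" and tg: "test_fun ?g" using f by (auto intro: test_fun_restr)
  note [measurable] = test_fun_measurable[OF f] T_L2(1)[OF tg] Kint_measurable[OF tg]
  have "(\<integral>y. ?I y * Kint ?g y \<partial>\<mu>) = form ?g ?I"
    unfolding form_def
  proof (rule integral_cong_AE)
    have "AE y in \<mu>. (\<forall>w \<in> ball y (2 * R). ?g w = 0) \<longrightarrow> T ?g y = Kint ?g y"
      by (rule T_eq_Kint[OF tg]) (use R0 in simp)
    then show "AE y in \<mu>. ?I y * Kint ?g y = T ?g y * ?I y"
    proof eventually_elim
      case (elim y)
      have "\<forall>w \<in> ball y (2 * R). ?g w = 0" if "y \<in> ball x R"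
      proof
        fix w assume "w \<in> ball y (2 * R)"
        then have "w \<in> ball x (3 * R)" using that dist_triangle[of x w y] by simp
        then show "?g w = 0" by simp
      qed
      then show ?case using elim by (cases "y \<in> ball x R") auto
    qed
  qed measurable
  moreover have "form f ?I = form ?n ?I + form ?g ?I" by (rule form_split_left[OF f I]) auto
  moreover have "norm (form ?n ?I) \<le> C_local \<theta> * (measure \<mu> (ball x (3 * R)) powr \<theta> * a powr (1 / \<beta>))"
  proof (rule form_local_bound[OF R0 I])
    fix U :: "complex set" assume U: "open U" "bounded U"
    have "(\<integral>y. norm (restr U ?n y) \<partial>\<mu>) \<le> measure \<mu> U powr (1 - 1 / \<beta>) * (\<integral>y. norm (?n y) powr \<beta> \<partial>\<mu>) powr (1 / \<beta>)"
      by (rule integral_restr_Hoelder[OF tn \<open>\<beta> > 1\<close>]) (use U in auto)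
    also have "\<dots> \<le> measure \<mu> U powr \<theta> * a powr (1 / \<beta>)"
      unfolding \<theta> using a \<open>\<beta> > 1\<close> by (intro mult_left_mono powr_mono2) auto
    finally show "(\<integral>y. norm (restr U ?n y) \<partial>\<mu>) \<le> measure \<mu> U powr \<theta> * a powr (1 / \<beta>)" .
  qed (use th tn in \<open>auto simp: indicator_def\<close>)
  moreover have "norm (Kint (restr (- ball x r) f) x) * measure \<mu> (ball x R)
     \<le> norm (\<integral>y. ?I y * Kint ?g y \<partial>\<mu>) + (9 / (1 - 3 powr -\<theta>) + C\<epsilon>) * M * measure \<mu> (ball x R)"
    by (rule Kint_le_average[OF f \<open>r > 0\<close> th \<open>M \<ge> 0\<close> k R M])
  moreover have "norm (form ?g ?I) \<le> norm (form f ?I) + norm (form ?n ?I)" if "form f ?I = form ?n ?I + form ?g ?I"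
    using norm_triangle_ineq4[of "form f ?I" "form ?n ?I"] that by simp
  ultimately show ?thesis by simp
qed

lemma cotlar_inequality:
  assumes "\<beta> > 1" "p > 1" "Lp_extension p \<mu> T S" "\<phi> \<in> Lp_space p \<mu>"
  shows "maximal_op \<mu> K \<phi> x
    \<le> M_tilde \<mu> (S \<phi>) x + ennreal (81 * C_local (1 - 1 / \<beta>)) * M_tilde_pow \<beta> \<mu> \<phi> x
      + ennreal (9 / (1 - 3 powr - (1 - 1 / \<beta>)) + C\<epsilon>) * M_prime_pow \<beta> \<mu> \<phi> x"
proof -
  define \<theta> where "\<theta> = 1 - 1 / \<beta>"
  have th: "0 < \<theta>" "\<theta> \<le> 1" unfolding \<theta>_def using \<open>\<beta> > 1\<close> by auto
  define B where "B = 81 * C_local \<theta>"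
  define B' where "B' = 9 / (1 - 3 powr -\<theta>) + C\<epsilon>"
  have q: "3 powr -\<theta> < (1::real)" using th by (simp add: powr_less_one)
  have B: "B > 0" "B' > 0" unfolding B_def B'_def using C_local_pos[OF th(1)] C\<epsilon>_pos q by (auto simp: add_pos_pos)
  have \<phi>: "\<phi> \<in> borel_measurable borel" using assms(4) by (auto simp: Lp_space_def measurable_mu)
  let ?w = "\<lambda>y. norm (\<phi> y) powr \<beta>"
  define s where "s = M_tilde \<mu> (S \<phi>) x"
  define v where "v = M_tilde \<mu> ?w x"
  define u where "u = M_prime \<mu> ?w x"
  have main: "ennreal (norm (Kint (restr (- ball x r) \<phi>) x)) \<le> s + ennreal B * ennpowr v (1 / \<beta>) + ennreal B' * ennpowr u (1 / \<beta>)"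
    if "r > 0" for r
  \<comment> \<open>If a maximal function is infinite, so is the right-hand side. This uses that B
    and B' are strictly positive, since 0 times \<infinity> is 0 in \<open>ennreal\<close>.\<close>
  proof (cases "s < \<infinity> \<and> v < \<infinity> \<and> u < \<infinity>")
    case False
    then have "s = \<infinity> \<or> ennpowr v (1 / \<beta>) = \<infinity> \<or> ennpowr u (1 / \<beta>) = \<infinity>"
      using ennpowr_infinity by (auto simp: not_less top_unique)
    then have "s + ennreal B * ennpowr v (1 / \<beta>) + ennreal B' * ennpowr u (1 / \<beta>) = \<infinity>"
      using B by (auto simp: ennreal_mult_top)
    then show ?thesis by (simp only: infinity_ennreal_def top_greatest)
  next
    case True
    note fin = this
    define s' where "s' = enn2real s"
    define V where "V = enn2real v powr (1 / \<beta>)"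
    define M where "M = enn2real u powr (1 / \<beta>)"
    have rhs: "s + ennreal B * ennpowr v (1 / \<beta>) + ennreal B' * ennpowr u (1 / \<beta>) = ennreal (s' + B * V + B' * M)"
    proof -
      have "s = ennreal s'" unfolding s'_def using True by (simp add: less_top)
      then show ?thesis
        using True B unfolding V_def M_def s'_def by (simp add: ennpowr_finite ennreal_mult)
    qed
    have nn: "s' \<ge> 0" "V \<ge> 0" "M \<ge> 0" unfolding s'_def V_def M_def by auto
    have "norm (Kint (restr (- ball x r) \<phi>) x) \<le> s' + B * V + B' * M"
    proof (cases "\<forall>t. measure \<mu> (ball x t) = 0")
      case True
      then have "AE y in \<mu>. False" by (intro AE_False_if_null_balls) auto
      then have "Kint (restr (- ball x r) \<phi>) x = 0" unfolding Kint_def by (intro integral_eq_zero_AE) auto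
      then show ?thesis using nn B by simp
    next
      case False
      then obtain t where "measure \<mu> (ball x t) > 0" by (auto simp: zero_less_measure_iff)
      then obtain k R where R_def: "R = 3 ^ k * r" and dbl: "doubling x R" "doubling x (3 * R)"
        and k: "\<And>j. j < k \<Longrightarrow> 81 * mu3 x r j \<le> mu3 x r (j + 2)"
        using exists_doubling_ball[OF \<open>r > 0\<close>] by metis
      define m where "m = measure \<mu> (ball x R)"
      define m3 where "m3 = measure \<mu> (ball x (3 * R))"
      have R: "R > 0" and m: "m > 0" "m3 > 0" "m3 \<le> 81 * m"
        using dbl unfolding doubling_def m_def m3_def by auto
      define a where "a = (\<integral>y. norm (restr (ball x (3 * R)) \<phi> y) powr \<beta> \<partial>\<mu>)"
      have wfin: "(\<integral>\<^sup>+y\<in>ball x t. ennreal (norm (?w y)) \<partial>\<mu>) \<le> ennreal (enn2real u * t)" if "t > 0" for t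
        unfolding u_def using fin that by (intro M_prime_ge) (auto simp: u_def)
      have rw: "ennreal (norm (restr (ball x t) \<phi> y) powr \<beta>) = ennreal (norm (?w y)) * indicator (ball x t) y" for t y
        using \<open>\<beta> > 1\<close> by (simp add: restr_def indicator_def)
      have rm: "(\<lambda>y. norm (restr (ball x t) \<phi> y) powr \<beta>) \<in> borel_measurable \<mu>" for t
      proof -
        have [measurable]: "restr (ball x t) \<phi> \<in> borel_measurable borel" using \<phi> by (intro restr_borel_measurable) auto
        show ?thesis by measurable
      qed
      \<comment> \<open>Finiteness of M' at x alone puts \<phi> locally in \<open>L^\<beta>\<close>,
        whatever p is.\<close>
      have ri: "integrable \<mu> (\<lambda>y. norm (restr (ball x t) \<phi> y) powr \<beta>)" if "t > 0" for t
      proof (rule integrableI_bounded[OF rm])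
        have "(\<integral>\<^sup>+y. ennreal (norm (norm (restr (ball x t) \<phi> y) powr \<beta>)) \<partial>\<mu>) = (\<integral>\<^sup>+y\<in>ball x t. ennreal (norm (?w y)) \<partial>\<mu>)"
          by (simp add: rw)
        also have "\<dots> < \<infinity>" using wfin[OF that] by (simp add: le_less_trans)
        finally show "(\<integral>\<^sup>+y. ennreal (norm (norm (restr (ball x t) \<phi> y) powr \<beta>)) \<partial>\<mu>) < \<infinity>" .
      qed
      have rint: "ennreal (\<integral>y. norm (restr (ball x t) \<phi> y) powr \<beta> \<partial>\<mu>) = (\<integral>\<^sup>+y\<in>ball x t. ennreal (norm (?w y)) \<partial>\<mu>)" if "t > 0" for t
        using nn_integral_eq_integral[OF ri[OF that]] by (simp add: rw)
      have "a \<le> m3 * enn2real v"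
        unfolding m3_def v_def
      proof (rule M_tilde_ge)
        show "ennreal a \<le> (\<integral>\<^sup>+y\<in>ball x (3 * R). ennreal (norm (?w y)) \<partial>\<mu>)"
          unfolding a_def using rint[of "3 * R"] R by simp
      qed (use dbl fin in \<open>auto simp: v_def a_def\<close>)
      then have "a powr (1 / \<beta>) \<le> (m3 * enn2real v) powr (1 / \<beta>)"
        using \<open>\<beta> > 1\<close> by (intro powr_mono2) (auto simp: a_def)
      also have "\<dots> = m3 powr (1 / \<beta>) * V" unfolding V_def m3_def by (simp add: powr_mult)
      \<comment> \<open>The exponents \<theta> and 1/\<beta> add up to 1, so the Hoelder factor
        completes \<mu>(B(x,3R)), which is at most 81 \<mu>(B(x,R)).\<close>
      finally have "m3 powr \<theta> * a powr (1 / \<beta>) \<le> m3 powr \<theta> * (m3 powr (1 / \<beta>) * V)" by (rule mult_left_mono) simp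
      also have "\<dots> = m3 * V" using m unfolding \<theta>_def by (simp flip: powr_add mult.assoc)
      also have "\<dots> \<le> 81 * m * V" using m(3) nn by (intro mult_right_mono) auto
      finally have aV: "C_local \<theta> * (m3 powr \<theta> * a powr (1 / \<beta>)) \<le> B * V * m"
        using C_local_pos[OF th(1)] unfolding B_def by (simp add: mult_left_mono mult_ac)
      define cut where "cut = cutoff \<phi>"
      have tc: "test_fun (cut n)" for n unfolding cut_def by (rule test_fun_cutoff[OF \<phi>])
      have cle: "norm (cut n y) \<le> norm (\<phi> y)" for n y unfolding cut_def cutoff_def by (rule norm_restr_le)
      have crle: "norm (restr E (cut n) y) \<le> norm (restr E \<phi> y)" for E n y
        using cle[of n y] by (cases "y \<in> E") auto
      \<comment> \<open>Uniform in n: \<open>a\<close> and \<open>M\<close> are computed from \<phi>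
        itself, which dominates its cutoffs, and R depends only on x and r.\<close>
      have step: "norm (Kint (restr (- ball x r) (cut n)) x) * m \<le> norm (form (cut n) (indicator (ball x R)))
         + C_local \<theta> * (m3 powr \<theta> * a powr (1 / \<beta>)) + B' * M * m" for n
        unfolding m_def m3_def B'_def
      proof (rule cotlar_test_fun[OF tc \<open>r > 0\<close> \<open>\<beta> > 1\<close> nn(3) k R_def _ _ \<theta>_def])
        have ic: "integrable \<mu> (\<lambda>y. norm (restr (ball x t) (cut n) y) powr \<beta>)" for t
          using test_fun_Lp_space[OF test_fun_restr[OF tc, of "ball x t" n], of \<beta>] \<open>\<beta> > 1\<close> unfolding Lp_space_def by simp
        have ile: "(\<integral>y. norm (restr (ball x t) (cut n) y) powr \<beta> \<partial>\<mu>) \<le> (\<integral>y. norm (restr (ball x t) \<phi> y) powr \<beta> \<partial>\<mu>)" if "t > 0" for t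
          using crle \<open>\<beta> > 1\<close> by (intro integral_mono ic ri[OF that] powr_mono2) auto
        show "(\<integral>y. norm (restr (ball x (3 * R)) (cut n) y) powr \<beta> \<partial>\<mu>) \<le> a"
          unfolding a_def using R by (intro ile) simp
        fix t :: real assume t: "t > 0"
        have tr: "test_fun (restr (ball x t) (cut n))" using tc by (intro test_fun_restr) auto
        have idem: "restr (ball x t) (restr (ball x t) (cut n)) = restr (ball x t) (cut n)"
          by (auto simp: restr_def indicator_def fun_eq_iff)
        have "(\<integral>y. norm (restr (ball x t) (restr (ball x t) (cut n)) y) \<partial>\<mu>)
          \<le> measure \<mu> (ball x t) powr (1 - 1 / \<beta>) * (\<integral>y. norm (restr (ball x t) (cut n) y) powr \<beta> \<partial>\<mu>) powr (1 / \<beta>)"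
          by (rule integral_restr_Hoelder[OF tr \<open>\<beta> > 1\<close>]) auto
        also have "\<dots> \<le> measure \<mu> (ball x t) powr \<theta> * (enn2real u * t) powr (1 / \<beta>)"
        proof -
          have "ennreal (\<integral>y. norm (restr (ball x t) \<phi> y) powr \<beta> \<partial>\<mu>) \<le> ennreal (enn2real u * t)"
            unfolding rint[OF t] by (rule wfin[OF t])
          then have "(\<integral>y. norm (restr (ball x t) \<phi> y) powr \<beta> \<partial>\<mu>) \<le> enn2real u * t" using t by simp
          then show ?thesis
            unfolding \<theta>_def using ile[OF t] \<open>\<beta> > 1\<close> by (intro mult_left_mono powr_mono2) auto
        qed
        also have "\<dots> = M * t powr (1 - \<theta>) * measure \<mu> (ball x t) powr \<theta>"
          using t unfolding M_def \<theta>_def by (simp add: powr_mult)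
        finally have "(\<integral>y. norm (restr (ball x t) (cut n) y) \<partial>\<mu>) \<le> M * t powr (1 - \<theta>) * measure \<mu> (ball x t) powr \<theta>"
          unfolding idem .
        moreover have "(\<integral>\<^sup>+y\<in>ball x t. ennreal (norm (cut n y)) \<partial>\<mu>) = ennreal (\<integral>y. norm (restr (ball x t) (cut n) y) \<partial>\<mu>)"
        proof -
          have "(\<integral>\<^sup>+y\<in>ball x t. ennreal (norm (cut n y)) \<partial>\<mu>) = (\<integral>\<^sup>+y. ennreal (norm (restr (ball x t) (cut n) y)) \<partial>\<mu>)"
            by (intro nn_integral_cong) (auto simp: indicator_def restr_def)
          also have "\<dots> = ennreal (\<integral>y. norm (restr (ball x t) (cut n) y) \<partial>\<mu>)"
            by (rule nn_integral_eq_integral[OF integrable_norm[OF integrable_test[OF tr]]]) auto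
          finally show ?thesis .
        qed
        ultimately show "(\<integral>\<^sup>+y\<in>ball x t. ennreal (norm (cut n y)) \<partial>\<mu>)
          \<le> ennreal (M * t powr (1 - \<theta>) * measure \<mu> (ball x t) powr \<theta>)" by (simp add: ennreal_leI)
      qed
      define I where "I = (\<integral>y. S \<phi> y * indicator (ball x R) y \<partial>\<mu>)"
      have "norm (Kint (restr (- ball x r) \<phi>) x) * m \<le> norm I + C_local \<theta> * (m3 powr \<theta> * a powr (1 / \<beta>)) + B' * M * m"
      proof (rule LIMSEQ_le)
        show "(\<lambda>n. norm (Kint (restr (- ball x r) (cut n)) x) * m) \<longlonglongrightarrow> norm (Kint (restr (- ball x r) \<phi>) x) * m"
          unfolding cut_def by (intro tendsto_intros Kint_cutoff_tendsto[OF assms(2,4) \<open>r > 0\<close>])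
        show "(\<lambda>n. norm (form (cut n) (indicator (ball x R))) + C_local \<theta> * (m3 powr \<theta> * a powr (1 / \<beta>)) + B' * M * m)
          \<longlonglongrightarrow> norm I + C_local \<theta> * (m3 powr \<theta> * a powr (1 / \<beta>)) + B' * M * m"
          unfolding cut_def I_def by (intro tendsto_intros S_local_tendsto[OF assms(2-4)]) auto
      qed (use step in auto)
      moreover have "norm I \<le> s' * m"
      proof -
        have "norm I \<le> m * enn2real (M_tilde \<mu> (S \<phi>) x)"
          unfolding m_def
        proof (rule M_tilde_ge)
          have SL: "S \<phi> \<in> Lp_space p \<mu>"
            using assms(3,4) unfolding Lp_extension_def Lp_operator_bound_def by blast
          note i = Lp_local_average(1)[OF assms(2) SL bounded_ball[of x R]]
          have "norm I \<le> (\<integral>y. norm (S \<phi> y * indicator (ball x R) y) \<partial>\<mu>)" unfolding I_def by (rule integral_norm_bound)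
          also have "\<dots> = (\<integral>y. norm (S \<phi> y) * indicator (ball x R) y \<partial>\<mu>)"
            by (simp add: norm_mult norm_indicator_complex)
          finally have "ennreal (norm I) \<le> ennreal (\<integral>y. norm (S \<phi> y) * indicator (ball x R) y \<partial>\<mu>)" by (rule ennreal_leI)
          also have "\<dots> = (\<integral>\<^sup>+y. ennreal (norm (S \<phi> y) * indicator (ball x R) y) \<partial>\<mu>)"
            by (rule nn_integral_eq_integral[symmetric]) (use i in auto)
          also have "\<dots> = (\<integral>\<^sup>+y\<in>ball x R. ennreal (norm (S \<phi> y)) \<partial>\<mu>)"
            by (intro nn_integral_cong) (auto simp: indicator_def)
          finally show "ennreal (norm I) \<le> (\<integral>\<^sup>+y\<in>ball x R. ennreal (norm (S \<phi> y)) \<partial>\<mu>)" .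
        qed (use dbl fin in \<open>auto simp: s_def\<close>)
        then show ?thesis unfolding s'_def s_def by (simp add: mult.commute)
      qed
      ultimately have "norm (Kint (restr (- ball x r) \<phi>) x) * m \<le> (s' + B * V + B' * M) * m"
        using aV by (simp add: distrib_right)
      then show ?thesis using m(1) by simp
    qed
    then show ?thesis unfolding rhs by (rule ennreal_leI)
  qed
  show ?thesis
    unfolding maximal_op_def M_tilde_pow_def M_prime_pow_def
  proof (rule SUP_least)
    fix r :: real assume "r \<in> {0<..}"
    then show "ennreal (norm (truncated_op \<mu> K r \<phi> x))
      \<le> M_tilde \<mu> (S \<phi>) x + ennreal (81 * C_local (1 - 1 / \<beta>)) * ennpowr (M_tilde \<mu> ?w x) (1 / \<beta>)
      + ennreal (9 / (1 - 3 powr - (1 - 1 / \<beta>)) + C\<epsilon>) * ennpowr (M_prime \<mu> ?w x) (1 / \<beta>)"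
      using main[of r] unfolding truncated_op_eq B_def B'_def \<theta>_def s_def v_def u_def by simp
  qed
qed

end

text \<open>The values of \<open>K\<close> on the diagonal are arbitrary, possibly not measurable; replacing them by
  \<open>0\<close> changes nothing, as \<open>\<mu>\<close> has no atoms.\<close>

lemma cz_operator_off_diagonal:
  assumes "linear_growth \<mu>" "\<epsilon> > 0" "N \<ge> 0" "CZ_kernel \<epsilon> K" "CZ_operator \<mu> K T N"
  shows "cz_operator \<mu> \<epsilon> (\<lambda>x y. if x = y then 0 else K x y) T N"
proof -
  interpret linear_growth \<mu> by fact
  let ?K = "\<lambda>x y. if x = y then 0 else K x y"
  have ne: "AE y in \<mu>. x \<noteq> y" for x
  proof -
    have small: "emeasure \<mu> {x} \<le> ennreal e" if "e > 0" for e
    proof -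
      have "emeasure \<mu> {x} \<le> emeasure \<mu> (ball x e)" using that by (intro emeasure_mono) auto
      then show ?thesis using growth[OF that, of x] by (rule order_trans)
    qed
    have "emeasure \<mu> {x} \<le> 0" by (rule ennreal_le_epsilon) (simp add: small)
    then have "{x} \<in> null_sets \<mu>" by (intro null_setsI) auto
    from AE_not_in[OF this] show ?thesis by auto
  qed
  have K': "CZ_kernel \<epsilon> ?K"
    unfolding CZ_kernel_def
  proof (intro conjI allI impI)
    fix x y :: complex assume "x \<noteq> y"
    then show "norm (?K x y) \<le> 1 / dist x y" using CZ_kernelD1[OF assms(4)] by simp
  next
    fix x x' y :: complex assume xy: "x \<noteq> y" "dist x x' \<le> dist x y / 2"
    have x'y: "x' \<noteq> y"
    proof
      assume "x' = y"
      then show False using xy zero_less_dist_iff[of x y] by simp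
    qed
    show "norm (?K x y - ?K x' y) \<le> dist x x' powr \<epsilon> / dist x y powr (1 + \<epsilon>)"
      using CZ_kernelD2[OF assms(4) xy] xy(1) x'y by simp
    show "norm (?K y x - ?K y x') \<le> dist x x' powr \<epsilon> / dist x y powr (1 + \<epsilon>)"
      using CZ_kernelD3[OF assms(4) xy] xy(1) x'y by simp
  qed
  have "CZ_operator \<mu> ?K T N"
    unfolding CZ_operator_def
  proof (intro conjI ballI)
    show "Lp_operator_bound 2 \<mu> T N" using assms(5) unfolding CZ_operator_def by simp
    fix \<phi> assume \<phi>: "\<phi> \<in> Lp_space 2 \<mu>"
    have [measurable]: "\<phi> \<in> borel_measurable borel" using \<phi> by (simp add: Lp_space_def measurable_mu)
    have "AE x in \<mu>. x \<notin> closed_support \<mu> \<phi> \<longrightarrow>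
        integrable \<mu> (\<lambda>y. K x y * \<phi> y) \<and> T \<phi> x = (\<integral>y. K x y * \<phi> y \<partial>\<mu>)"
      using assms(5) \<phi> unfolding CZ_operator_def by blast
    then show "AE x in \<mu>. x \<notin> closed_support \<mu> \<phi> \<longrightarrow>
        integrable \<mu> (\<lambda>y. ?K x y * \<phi> y) \<and> T \<phi> x = (\<integral>y. ?K x y * \<phi> y \<partial>\<mu>)"
    proof eventually_elim
      case (elim x)
      show ?case
      proof
        assume "x \<notin> closed_support \<mu> \<phi>"
        then have i: "integrable \<mu> (\<lambda>y. K x y * \<phi> y)" "T \<phi> x = (\<integral>y. K x y * \<phi> y \<partial>\<mu>)" using elim by auto
        have m: "(\<lambda>y. ?K x y * \<phi> y) \<in> borel_measurable \<mu>"
        proof -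
          have "(\<lambda>y. if x = y then 0 else K x y * \<phi> y) \<in> borel_measurable \<mu>"
            using borel_measurable_integrable[OF i(1)] by (intro measurable_If) auto
          moreover have "(\<lambda>y. if x = y then 0 else K x y * \<phi> y) = (\<lambda>y. ?K x y * \<phi> y)" by auto
          ultimately show ?thesis by simp
        qed
        have ae: "AE y in \<mu>. K x y * \<phi> y = ?K x y * \<phi> y" using ne[of x] by eventually_elim simp
        show "integrable \<mu> (\<lambda>y. ?K x y * \<phi> y) \<and> T \<phi> x = (\<integral>y. ?K x y * \<phi> y \<partial>\<mu>)"
          by (rule conjI[OF integrable_cong_AE_imp[OF i(1) m ae]
                trans[OF i(2) integral_cong_AE[OF borel_measurable_integrable[OF i(1)] m ae]]])
      qed
    qed
  qed
  then show ?thesis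
    using CZ_kernel_measurable[OF assms(4,2)] K' assms(2,3)
    by unfold_locales auto
qed

theorem theorem2:
  fixes \<epsilon> N \<beta> :: real
  assumes "\<epsilon> > 0" and "N \<ge> 0" and "\<beta> > 1"
  shows "\<exists>B B' :: real. B \<ge> 0 \<and> B' \<ge> 0 \<and>
    (\<forall>(\<mu> :: complex measure) K T p S \<phi> x.
       sets \<mu> = sets borel \<longrightarrow>
       (\<forall>z r. r > 0 \<longrightarrow> emeasure \<mu> (ball z r) \<le> ennreal r) \<longrightarrow>
       CZ_kernel \<epsilon> K \<longrightarrow>
       CZ_operator \<mu> K T N \<longrightarrow>
       1 < p \<longrightarrow>
       Lp_extension p \<mu> T S \<longrightarrow>
       \<phi> \<in> Lp_space p \<mu> \<longrightarrow>
       maximal_op \<mu> K \<phi> x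
         \<le> M_tilde \<mu> (S \<phi>) x + ennreal B * M_tilde_pow \<beta> \<mu> \<phi> x
             + ennreal B' * M_prime_pow \<beta> \<mu> \<phi> x)"
proof (intro exI conjI allI impI)
  let ?\<theta> = "1 - 1 / \<beta>"
  have th: "?\<theta> > 0" using assms(3) by simp
  have C: "tail_const \<epsilon> > 0" unfolding tail_const_def using assms(1) by (simp add: powr_less_one)
  show "81 * local_const \<epsilon> N ?\<theta> \<ge> 0"
    unfolding local_const_def step_const_def using C assms(2) by (intro mult_nonneg_nonneg divide_nonneg_nonneg) auto
  have "3 powr - ?\<theta> < (1::real)" using th by (intro powr_less_one) auto
  then show "9 / (1 - 3 powr - ?\<theta>) + tail_const \<epsilon> \<ge> 0" using C by simp
next
  fix \<mu> :: "complex measure" and K T p S \<phi> x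
  assume sets: "sets \<mu> = sets borel"
    and growth: "\<forall>z r. r > 0 \<longrightarrow> emeasure \<mu> (ball z r) \<le> ennreal r"
    and K: "CZ_kernel \<epsilon> K" and T: "CZ_operator \<mu> K T N"
    and p: "1 < p" and S: "Lp_extension p \<mu> T S" and \<phi>: "\<phi> \<in> Lp_space p \<mu>"
  let ?K = "\<lambda>x y. if x = y then 0 else K x y"
  have "linear_growth \<mu>" using sets growth by unfold_locales auto
  then interpret cz_operator \<mu> \<epsilon> ?K T N
    by (rule cz_operator_off_diagonal[OF _ assms(1,2) K T])
  \<comment> \<open>The two kernels differ at y = x only, a point inside the excluded ball.\<close>
  have "truncated_op \<mu> K r \<phi> x = truncated_op \<mu> ?K r \<phi> x" if "r > 0" for r
    unfolding truncated_op_def set_lebesgue_integral_def using that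
    by (intro Bochner_Integration.integral_cong) (auto simp: indicator_def)
  then have "maximal_op \<mu> K \<phi> x = maximal_op \<mu> ?K \<phi> x"
    unfolding maximal_op_def by (intro SUP_cong) auto
  then show "maximal_op \<mu> K \<phi> x
      \<le> M_tilde \<mu> (S \<phi>) x + ennreal (81 * local_const \<epsilon> N (1 - 1 / \<beta>)) * M_tilde_pow \<beta> \<mu> \<phi> x
        + ennreal (9 / (1 - 3 powr - (1 - 1 / \<beta>)) + tail_const \<epsilon>) * M_prime_pow \<beta> \<mu> \<phi> x"
    using cotlar_inequality[OF assms(3) p S \<phi>, of x] by simp
qed

end
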